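(* Let $0\le\beta<1/2$ be fixed. Scale-free random 2-SAT formulas over $n$ variables with exponent $\beta$ have a SAT-UNSAT phase transition threshold at clause/variable ratio \[ \frac{m}{n}=\frac{1-2\beta}{(1-\beta)^2}. \] That is, for a scale-free random 2-SAT formula $F$ over $n$ variables with exponent $\beta$ and $m=m(n)$ clauses: if $c<\frac{1-2\beta}{(1-\beta)^2}$ is a constant and $m/n\le c$ for all $n$, then $F$ is satisfiable with probability $1-o(1)$; and if $c>\frac{1-2\beta}{(1-\beta)^2}$ is a constant and $m/n\ge c$ for all $n$, then $F$ is unsatisfiable with probability $1-o(1)$, as $n\to\infty$.
   Context: Scale-free random 2-SAT formulas. Variables are $x_1,\dots,x_n$; a literal is $x_i$ or $\neg x_i$. A clause is a disjunction (regarded as a set) of two literals on two distinct variables, so there are $4\binom{n}{2}$ clauses. Given $n,m$ and a real exponent $\beta\ge 0$, a scale-free random 2-SAT formula is a conjunction (multiset) of $m$ clauses sampled independently (repetitions allowed), each clause being sampled with probability proportional to $i^{-\beta}j^{-\beta}$, where $x_i,x_j$ are the two variables of the clause. Equivalently: sample two variables independently with $P(x_i)=i^{-\beta}/\sum_{j=1}^n j^{-\beta}$, negate each independently with probability $1/2$, and reject and resample the clause if the two variables coincide. *)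

theory Defs
  imports "HOL-Probability.Probability"
begin

(* The literal x_i is (i, True), its negation is (i, False). *)
type_synonym literal = "nat \<times> bool"
type_synonym clause = "literal set"
type_synonym formula = "clause multiset"

definition clauses :: "nat \<Rightarrow> clause set" where
  "clauses n = {{(i, a), (j, b)} | i a j b. i \<in> {1..n} \<and> j \<in> {1..n} \<and> i \<noteq> j}"

definition clause_vars :: "clause \<Rightarrow> nat set" where
  "clause_vars C = fst ` C"

definition clause_weight :: "real \<Rightarrow> clause \<Rightarrow> real" where
  "clause_weight \<beta> C = (\<Prod>i\<in>clause_vars C. real i powr (- \<beta>))"

(* For n < 2 there are no clauses, and the value is unspecified;
   for n >= 2 see pmf_random_clause below. *)
definition random_clause :: "nat \<Rightarrow> real \<Rightarrow> clause pmf" where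
  "random_clause n \<beta> = embed_pmf (\<lambda>C.
     if C \<in> clauses n then clause_weight \<beta> C / (\<Sum>D\<in>clauses n. clause_weight \<beta> D) else 0)"

definition random_2sat :: "nat \<Rightarrow> nat \<Rightarrow> real \<Rightarrow> formula pmf" where
  "random_2sat n m \<beta> = map_pmf mset (replicate_pmf m (random_clause n \<beta>))"

definition satisfies :: "(nat \<Rightarrow> bool) \<Rightarrow> formula \<Rightarrow> bool" where
  "satisfies \<alpha> F \<longleftrightarrow> (\<forall>C\<in>#F. \<exists>(i, b)\<in>C. \<alpha> i = b)"

definition satisfiable :: "formula \<Rightarrow> bool" where
  "satisfiable F \<longleftrightarrow> (\<exists>\<alpha>. satisfies \<alpha> F)"

lemma finite_clauses: "finite (clauses n)"
proof (rule finite_subset)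
  show "clauses n \<subseteq> Pow ({1..n} \<times> UNIV)"
    by (auto simp: clauses_def)
qed auto

lemma clause_weight_pair:
  "i \<noteq> j \<Longrightarrow> clause_weight \<beta> {(i, a), (j, b)} = real i powr (- \<beta>) * real j powr (- \<beta>)"
  by (simp add: clause_weight_def clause_vars_def)

lemma clause_weight_pos: "C \<in> clauses n \<Longrightarrow> clause_weight \<beta> C > 0"
  by (auto simp: clauses_def clause_weight_pair)

lemma clauses_nonempty: "n \<ge> 2 \<Longrightarrow> clauses n \<noteq> {}"
proof -
  assume "n \<ge> 2"
  then have "{(1, True), (2, True)} \<in> clauses n"
    unfolding clauses_def
    by (intro CollectI exI[of _ "1::nat"] exI[of _ True] exI[of _ "2::nat"]) auto
  then show ?thesis by blast
qed

lemma pmf_random_clause: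
  assumes "n \<ge> 2"
  shows "pmf (random_clause n \<beta>) C =
    (if C \<in> clauses n then clause_weight \<beta> C / (\<Sum>D\<in>clauses n. clause_weight \<beta> D) else 0)"
proof -
  let ?Z = "\<Sum>D\<in>clauses n. clause_weight \<beta> D"
  let ?f = "\<lambda>C. if C \<in> clauses n then clause_weight \<beta> C / ?Z else 0"
  have Z: "?Z > 0"
    using finite_clauses clauses_nonempty[OF assms] clause_weight_pos by (intro sum_pos) auto
  have nn: "0 \<le> ?f C" for C
    using Z clause_weight_pos[of C n \<beta>] by (auto intro: divide_nonneg_pos less_imp_le)
  have "(\<integral>\<^sup>+C. ennreal (?f C) \<partial>count_space UNIV) = (\<Sum>C\<in>clauses n. ennreal (?f C))"
    by (rule nn_integral_count_space'[OF finite_clauses]) auto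
  also have "\<dots> = ennreal (\<Sum>C\<in>clauses n. ?f C)"
    using nn by (intro sum_ennreal) blast
  also have "(\<Sum>C\<in>clauses n. ?f C) = (\<Sum>C\<in>clauses n. clause_weight \<beta> C / ?Z)"
    by (rule sum.cong) auto
  also have "\<dots> = 1"
    using Z by (simp flip: sum_divide_distrib)
  finally have "(\<integral>\<^sup>+C. ennreal (?f C) \<partial>count_space UNIV) = 1"
    by simp
  from pmf_embed_pmf[OF nn this] show ?thesis
    unfolding random_clause_def .
qed

end

(* The directed graph on literals with the two edges \<open>\<not>a \<rightarrow> b\<close>, \<open>\<not>b \<rightarrow> a\<close> for every clause \<open>{a, b}\<close> decides satisfiability.
   The clause of the edge \<open>a \<rightarrow> b\<close> occurs \<open>lam u(a) u(b)\<close> times on average, where \<open>u\<close> is the \<open>\<ell>\<^sup>2\<close>-normalised weight vector of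
   the literals; since this kernel has rank one, the expected number of walks of length \<open>k\<close> grows like \<open>lam ^ k\<close>, and
   \<open>lam\<close> tends to \<open>(m / n) (1 - \<beta>)\<^sup>2 / (1 - 2 \<beta>)\<close>.

   Below the threshold, an unsatisfiable formula contains a bicycle, i.e. a path on distinct variables with both ends
   bent back onto it, and the two additional visits cost a factor \<open>1 / \<Sum>i\<le>n. i powr (-2\<beta>)\<close>, which tends to \<open>0\<close>.

   Above the threshold, one discards the variables \<open>i \<le> e n\<close>, which keeps \<open>lam > 1\<close> and makes all remaining weights
   comparable, and applies the second moment method to the number of snakes \<open>\<not>x \<rightarrow> \<dots> \<rightarrow> x \<rightarrow> \<dots> \<rightarrow> \<not>x\<close> of length of order
   \<open>ln n\<close>.  Conditioning on one snake adds a sparse matrix \<open>J\<close> to the rank one kernel, and an explicit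
   supersolution of the perturbed kernel shows that this hardly changes the expected number of snakes. *)
theory Submission
  imports Defs "HOL-Real_Asymp.Real_Asymp"
begin

section \<open>Occurrence of a set of clauses in a random list\<close>

text \<open>The number of clauses is fixed, so clauses do not occur independently;
  \<open>hit_le\<close> and \<open>hit_ge\<close> show that for walks of O(ln n) edges this costs
  only a factor 1 - o(1). Heavy variables are the obstacle above the threshold. Conditioning on a
  snake with halves of t edges disturbs the second moment by terms of order t^3 U^4 relative to the
  sum of all u(z)^4, where U is the largest weight. With all variables present that sum is itself of
  order U^4 once \<beta> > 1/4. After truncation U^2 = O(1/n), while the sum is at least of order
  1/n, so the relative error is O(t^3/n). Truncating at a fixed fraction e of n costs lam only a
  factor 1 - e^(1-2\<beta>), because for \<beta> < 1/2 the large indices dominate the sum of squared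
  weights. The length is chosen so that lam^t is at least n. The expected number of snakes, about
  lam^(2t) times the sum of u(z)^4, then tends to infinity and outweighs the walks that merely
  follow the given snake.\<close>

lemma measure_replicate_pmf_Suc:
  "measure_pmf.prob (replicate_pmf (Suc m) p) A =
     (\<integral>x. measure_pmf.prob (replicate_pmf m p) {xs. x # xs \<in> A} \<partial>measure_pmf p)"
proof -
  have "replicate_pmf (Suc m) p = bind_pmf p (\<lambda>x. map_pmf ((#) x) (replicate_pmf m p))"
    by (simp add: map_pmf_def)
  then have "ennreal (measure_pmf.prob (replicate_pmf (Suc m) p) A) =
     (\<integral>\<^sup>+x. ennreal (measure_pmf.prob (replicate_pmf m p) {xs. x # xs \<in> A}) \<partial>measure_pmf p)"
    by (simp add: measure_pmf.emeasure_eq_measure[symmetric] vimage_def del: replicate_pmf.simps)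
  also have "\<dots> = ennreal (\<integral>x. measure_pmf.prob (replicate_pmf m p) {xs. x # xs \<in> A} \<partial>measure_pmf p)"
    by (intro nn_integral_eq_integral measure_pmf.integrable_const_bound[where B=1]) auto
  finally show ?thesis
    by (simp add: integral_nonneg_AE del: replicate_pmf.simps)
qed

text \<open>For T the clauses of a walk, this is the probability that the walk exists in the
  implication graph. The bounds below compare it with the product of the expected multiplicities
  \<open>real m * pmf p C\<close>.\<close>

definition hit :: "'a pmf \<Rightarrow> nat \<Rightarrow> 'a set \<Rightarrow> real" where
  "hit p m T = measure_pmf.prob (replicate_pmf m p) {xs. T \<subseteq> set xs}"

lemma hit_nonneg: "0 \<le> hit p m T"
  by (simp add: hit_def)

lemma hit_0: "hit p 0 T = (if T = {} then 1 else 0)"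
  by (auto simp: hit_def indicator_def)

text \<open>Condition on the first draw: if it is some C in T, the other draws must still produce
  \<open>T - {C}\<close>, otherwise all of T.\<close>

lemma hit_Suc:
  assumes "finite T"
  shows "hit p (Suc m) T = (1 - sum (pmf p) T) * hit p m T + (\<Sum>C\<in>T. pmf p C * hit p m (T - {C}))"
proof -
  \<comment> \<open>The integrand depends on the first draw x only through the indicators of the
    members of T, which turns the integral into a finite sum.\<close>
  have eq: "hit p m (T - {x}) = hit p m T + (\<Sum>C\<in>T. indicator {C} x * (hit p m (T - {C}) - hit p m T))" for x
  proof (cases "x \<in> T")
    case True
    have "(\<Sum>C\<in>T. indicator {C} x * (hit p m (T - {C}) - hit p m T)) = 
       (\<Sum>C\<in>T. if C = x then hit p m (T - {C}) - hit p m T else 0)"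
      by (intro sum.cong) (auto simp: indicator_def)
    then show ?thesis using True assms by simp
  next
    case False
    then have "(\<Sum>C\<in>T. indicator {C} x * (hit p m (T - {C}) - hit p m T)) = 0"
      by (intro sum.neutral) (auto simp: indicator_def)
    with False show ?thesis by simp
  qed
  have int_ind: "integrable (measure_pmf p) (indicator {C} :: 'a \<Rightarrow> real)" for C
    by (rule measure_pmf.integrable_const_bound[where B=1]) auto
  have "hit p (Suc m) T = (\<integral>x. hit p m (T - {x}) \<partial>measure_pmf p)"
    unfolding hit_def measure_replicate_pmf_Suc
    by (intro Bochner_Integration.integral_cong arg_cong2[where f=measure] refl) auto
  also have "\<dots> = (\<integral>x. hit p m T + (\<Sum>C\<in>T. indicator {C} x * (hit p m (T - {C}) - hit p m T)) \<partial>measure_pmf p)"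
    by (intro Bochner_Integration.integral_cong eq refl)
  also have "\<dots> = hit p m T + (\<integral>x. (\<Sum>C\<in>T. indicator {C} x * (hit p m (T - {C}) - hit p m T)) \<partial>measure_pmf p)"
    by (subst Bochner_Integration.integral_add)
      (auto intro!: Bochner_Integration.integrable_sum integrable_mult_left int_ind)
  also have "(\<integral>x. (\<Sum>C\<in>T. indicator {C} x * (hit p m (T - {C}) - hit p m T)) \<partial>measure_pmf p) =
      (\<Sum>C\<in>T. pmf p C * (hit p m (T - {C}) - hit p m T))"
    by (subst Bochner_Integration.integral_sum)
      (auto intro!: integrable_mult_left int_ind simp: measure_pmf_single)
  finally show ?thesis
    by (simp add: algebra_simps sum_subtractf sum_distrib_left sum_distrib_right)
qed

text \<open>For k = card T, \<open>hit_Suc\<close> reduces the induction step to m^k + k m^(k-1)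
  \<le> (m+1)^k, the first two terms of a binomial expansion.\<close>

lemma hit_le:
  assumes "finite T"
  shows "hit p m T \<le> (\<Prod>C\<in>T. real m * pmf p C)"
  using assms
proof (induction m arbitrary: T)
  case 0
  then show ?case by (auto simp: hit_0 card_gt_0_iff)
next
  case (Suc m)
  let ?k = "card T" and ?P = "\<Prod>C\<in>T. pmf p C"
  have P0: "?P \<ge> 0" by (intro prod_nonneg) auto
  have "(1 - sum (pmf p) T) * hit p m T \<le> 1 * hit p m T"
    by (intro mult_right_mono) (auto simp: sum_nonneg hit_nonneg)
  also have "\<dots> \<le> real m ^ ?k * ?P"
    using Suc.IH[OF Suc.prems] by (simp add: prod.distrib)
  finally have 1: "(1 - sum (pmf p) T) * hit p m T \<le> real m ^ ?k * ?P" .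
  have "pmf p C * hit p m (T - {C}) \<le> real m ^ (?k - 1) * ?P" if "C \<in> T" for C
  proof -
    have "pmf p C * hit p m (T - {C}) \<le> pmf p C * (\<Prod>C\<in>T-{C}. real m * pmf p C)"
      using Suc.IH[of "T - {C}"] Suc.prems by (intro mult_left_mono) auto
    also have "\<dots> = real m ^ (?k - 1) * ?P"
      using Suc.prems that by (simp add: prod.distrib prod.remove[of T C])
    finally show ?thesis .
  qed
  then have "(\<Sum>C\<in>T. pmf p C * hit p m (T - {C})) \<le> real ?k * (real m ^ (?k - 1) * ?P)"
    using sum_bounded_above[of T "\<lambda>C. pmf p C * hit p m (T - {C})"] by simp
  with 1 have "hit p (Suc m) T \<le> (real m ^ ?k + real ?k * real m ^ (?k - 1)) * ?P"
    unfolding hit_Suc[OF Suc.prems] by (simp add: algebra_simps)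
  also have "real m ^ ?k + real ?k * real m ^ (?k - 1) \<le> (real m + 1) ^ ?k"
  proof (cases "?k")
    case (Suc j)
    have "real m ^ Suc j + real (Suc j) * real m ^ j \<le> (real m + 1) ^ Suc j" for j
    proof (induction j)
      case (Suc j)
      have "(real m ^ Suc j + real (Suc j) * real m ^ j) * (real m + 1) \<le> (real m + 1) ^ Suc (Suc j)"
        using mult_right_mono[OF Suc.IH, of "real m + 1"] by (simp add: mult_ac)
      moreover have "real m ^ Suc (Suc j) + real (Suc (Suc j)) * real m ^ Suc j
         \<le> (real m ^ Suc j + real (Suc j) * real m ^ j) * (real m + 1)"
        by (simp add: algebra_simps)
      ultimately show ?case by linarith
    qed auto
    then show ?thesis using Suc by simp
  qed auto
  finally show ?case
    using P0 by (simp add: prod.distrib mult_right_mono add.commute)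
qed

text \<open>The falling factorial counts the placements of T into the m positions. Requiring that no
  member of T is drawn elsewhere makes these placements disjoint events; the last factor is a
  Bernoulli lower bound for the cost of that requirement.\<close>

lemma hit_ge:
  assumes "finite T"
  shows "hit p m T \<ge> fact (card T) * real (m choose card T) * (\<Prod>C\<in>T. pmf p C) * (1 - real m * sum (pmf p) T)"
  using assms
proof (induction m arbitrary: T)
  case 0
  then show ?case by (cases "card T") (auto simp: hit_0)
next
  case (Suc m)
  let ?k = "card T" and ?P = "\<Prod>C\<in>T. pmf p C" and ?s = "sum (pmf p) T"
  define a where "a = fact ?k * real (m choose ?k)"
  \<comment> \<open>For empty T the difference \<open>?k - 1\<close> is truncated. Setting b to 0
    there makes \<open>rec\<close>, the recursion of falling factorials, valid in every
    case.\<close>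
  define b where "b = (if T = {} then 0 else fact (?k - 1) * real (m choose (?k - 1)))"
  have nn: "0 \<le> a" "0 \<le> b" "0 \<le> ?P" by (auto simp: a_def b_def intro!: prod_nonneg)
  have s: "?s \<ge> 0" "?s \<le> 1"
    using measure_measure_pmf_finite[OF Suc.prems, of p] measure_pmf.prob_le_1[of p T]
    by (auto intro: sum_nonneg)
  have rec: "fact ?k * real (Suc m choose ?k) = a + real ?k * b"
  proof (cases ?k)
    case (Suc j)
    then have "T \<noteq> {}" by auto
    then show ?thesis using Suc
      by (simp add: a_def b_def algebra_simps)
  qed (use Suc.prems in \<open>auto simp: a_def b_def\<close>)
  have 1: "a * ?P * (1 - real (Suc m) * ?s) \<le> (1 - ?s) * hit p m T"
  proof -
    have "a * ?P * (1 - real (Suc m) * ?s) \<le> a * ?P * ((1 - ?s) * (1 - real m * ?s))"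
      using nn s by (intro mult_left_mono) (auto simp: algebra_simps)
    also have "\<dots> = (1 - ?s) * (a * ?P * (1 - real m * ?s))" by simp
    also have "\<dots> \<le> (1 - ?s) * hit p m T"
      using Suc.IH[OF Suc.prems] s by (intro mult_left_mono) (auto simp: a_def)
    finally show ?thesis .
  qed
  have 2: "b * ?P * (1 - real (Suc m) * ?s) \<le> pmf p C * hit p m (T - {C})" if "C \<in> T" for C
  proof -
    have le: "sum (pmf p) (T - {C}) \<le> ?s"
      using Suc.prems by (intro sum_mono2) auto
    have "real m * sum (pmf p) (T - {C}) \<le> real (Suc m) * ?s"
      using le s by (intro mult_mono) (auto intro!: sum_nonneg)
    then have "b * ?P * (1 - real (Suc m) * ?s) \<le> b * ?P * (1 - real m * sum (pmf p) (T - {C}))"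
      using nn by (intro mult_left_mono) auto
    also have "\<dots> = pmf p C * (fact (card (T - {C})) * real (m choose card (T - {C})) *
        (\<Prod>C\<in>T - {C}. pmf p C) * (1 - real m * sum (pmf p) (T - {C})))"
      using that Suc.prems by (auto simp: b_def prod.remove[of T C])
    also have "\<dots> \<le> pmf p C * hit p m (T - {C})"
      using Suc.IH[of "T - {C}"] Suc.prems by (intro mult_left_mono) auto
    finally show ?thesis .
  qed
  have "real ?k * (b * ?P * (1 - real (Suc m) * ?s)) \<le> (\<Sum>C\<in>T. pmf p C * hit p m (T - {C}))"
    using sum_bounded_below[of T "b * ?P * (1 - real (Suc m) * ?s)" "\<lambda>C. pmf p C * hit p m (T - {C})"] 2 by simp
  with 1 show ?case
    unfolding hit_Suc[OF Suc.prems] rec by (simp add: algebra_simps)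
qed

text \<open>The birthday bound for a falling factorial. The induction rests on (1 - k/m)(1 - k^2/m)
  \<ge> 1 - (k+1)^2/m.\<close>

lemma fact_mult_binomial_ge:
  assumes "k \<le> m"
  shows "fact k * real (m choose k) \<ge> real m ^ k * (1 - (real k)\<^sup>2 / real m)"
  using assms
proof (induction k)
  case (Suc k)
  have m: "m > 0" using Suc.prems by simp
  have "fact (Suc k) * real (m choose Suc k) = fact k * real (Suc k * (m choose Suc k))"
    by (simp only: fact_Suc of_nat_mult mult_ac)
  also have "Suc k * (m choose Suc k) = (m - k) * (m choose k)"
    using binomial_absorb_comp[of m k] binomial_absorption[of k m] 
    by (metis Suc.prems Suc_diff_1 Suc_le_lessD binomial_absorb_comp binomial_absorption m mult.commute)
  also have "fact k * real ((m - k) * (m choose k)) = (real m - real k) * (fact k * real (m choose k))"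
    using Suc.prems by (simp add: of_nat_diff)
  also have "\<dots> \<ge> (real m - real k) * (real m ^ k * (1 - (real k)\<^sup>2 / real m))"
    using Suc by (intro mult_left_mono) auto
  also have "(real m - real k) * (real m ^ k * (1 - (real k)\<^sup>2 / real m)) =
      real m ^ Suc k * ((1 - real k / real m) * (1 - (real k)\<^sup>2 / real m))"
    using m by (simp add: field_simps)
  finally have A: "fact (Suc k) * real (m choose Suc k) \<ge> real m ^ Suc k * ((1 - real k / real m) * (1 - (real k)\<^sup>2 / real m))" .
  have "1 - (real (Suc k))\<^sup>2 / real m \<le> 1 - real k / real m - (real k)\<^sup>2 / real m"
    using m by (simp add: divide_simps) (simp add: power2_eq_square algebra_simps)
  also have "\<dots> \<le> 1 - real k / real m - (real k)\<^sup>2 / real m + (real k / real m) * ((real k)\<^sup>2 / real m)"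
    by simp
  also have "\<dots> = (1 - real k / real m) * (1 - (real k)\<^sup>2 / real m)"
    by (simp only: algebra_simps mult_1_left mult_1_right)
  finally have "real m ^ Suc k * (1 - (real (Suc k))\<^sup>2 / real m) \<le> real m ^ Suc k * ((1 - real k / real m) * (1 - (real k)\<^sup>2 / real m))"
    by (intro mult_left_mono) auto
  with A show ?case by linarith
qed auto

section \<open>The second moment method\<close>

text \<open>Cauchy--Schwarz, applied to the number of events that occur and to the indicator of its support.\<close>

lemma second_moment_count:
  fixes M :: "'b pmf" and E :: "'a \<Rightarrow> 'b set"
  assumes fin: "finite I"
  shows "(\<Sum>a\<in>I. measure_pmf.prob M (E a))\<^sup>2
     \<le> (\<Sum>a\<in>I. \<Sum>b\<in>I. measure_pmf.prob M (E a \<inter> E b)) * measure_pmf.prob M (\<Union>a\<in>I. E a)"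
proof -
  define X :: "'b \<Rightarrow> real" where "X = (\<lambda>w. \<Sum>a\<in>I. indicator (E a) w)"
  let ?U = "\<Union>a\<in>I. E a"
  have int: "integrable M (\<lambda>w. f w :: real)" if "\<And>w. \<bar>f w\<bar> \<le> B" for f B
    using that by (intro measure_pmf.integrable_const_bound[where B=B]) auto
  have EX: "(\<integral>w. X w \<partial>M) = (\<Sum>a\<in>I. measure_pmf.prob M (E a))"
    unfolding X_def by (subst Bochner_Integration.integral_sum) (auto intro!: int[where B=1])
  have XX: "(\<integral>w. X w * X w \<partial>M) = (\<Sum>a\<in>I. \<Sum>b\<in>I. measure_pmf.prob M (E a \<inter> E b))"
  proof -
    have "(\<lambda>w. X w * X w) = (\<lambda>w. \<Sum>a\<in>I. \<Sum>b\<in>I. indicator (E a \<inter> E b) w)"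
      by (simp add: X_def sum_product indicator_inter_arith)
    moreover have ind: "integrable M (indicator A :: 'b \<Rightarrow> real)" for A
      by (rule int[where B=1]) auto
    ultimately show ?thesis
      by (simp add: Bochner_Integration.integral_sum Bochner_Integration.integrable_sum)
  qed
  have XU: "X w * indicator ?U w = X w" for w
    by (cases "w \<in> ?U") (auto simp: X_def)
  have Xb: "\<bar>X w\<bar> \<le> real (card I)" for w
    using sum_bounded_above[of I "\<lambda>a. indicator (E a) w :: real" 1]
    by (auto simp: X_def indicator_def sum_nonneg)
  have XXb: "\<bar>X w * X w\<bar> \<le> real (card I) * real (card I)" for w
    unfolding abs_mult by (intro mult_mono Xb) auto
  define x where "x = (\<integral>w. X w \<partial>M)"
  define y where "y = (\<integral>w. X w * X w \<partial>M)"
  define z where "z = measure_pmf.prob M ?U"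
  \<comment> \<open>The second moment of s X minus the indicator of its support. At s = x / y the
    inequality becomes x^2 \<le> y z.\<close>
  have quad: "0 \<le> s\<^sup>2 * y - 2 * s * x + z" for s
  proof -
    have "0 \<le> (\<integral>w. (s * X w - indicator ?U w)\<^sup>2 \<partial>M)"
      by (intro integral_nonneg_AE) auto
    also have "(\<lambda>w. (s * X w - indicator ?U w)\<^sup>2) =
        (\<lambda>w. s\<^sup>2 * (X w * X w) - 2 * s * X w + indicator ?U w)"
    proof
      fix w
      show "(s * X w - indicator ?U w)\<^sup>2 = s\<^sup>2 * (X w * X w) - 2 * s * X w + indicator ?U w"
        using XU[of w] by (cases "w \<in> ?U") (auto simp: power2_eq_square algebra_simps)
    qed
    also have "(\<integral>w. s\<^sup>2 * (X w * X w) - 2 * s * X w + indicator ?U w \<partial>M) = s\<^sup>2 * y - 2 * s * x + z"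
    proof -
      have 1: "integrable M (\<lambda>w. s\<^sup>2 * (X w * X w))" "integrable M (\<lambda>w. 2 * s * X w)"
        by (intro integrable_mult_right int[OF Xb] int[OF XXb])+
      have 2: "integrable M (indicator ?U :: 'b \<Rightarrow> real)"
        by (rule int[where B=1]) auto
      show ?thesis
        using 1 2 unfolding x_def y_def z_def
        by (simp add: Bochner_Integration.integral_add Bochner_Integration.integral_diff)
    qed
    finally show ?thesis .
  qed
  have y0: "y \<ge> 0" unfolding y_def by (intro integral_nonneg_AE) auto
  have "x\<^sup>2 \<le> y * z"
  proof (cases "y = 0")
    case True
    have "x = 0"
    proof (rule ccontr)
      assume "x \<noteq> 0"
      \<comment> \<open>For y = 0 the polynomial is linear in s, and this choice of s gives it the
        value -1.\<close>
      then show False using quad[of "(z + 1) / (2 * x)"] True by (simp add: field_simps)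
    qed
    with True show ?thesis by simp
  next
    case False
    then have "0 \<le> y * ((x / y)\<^sup>2 * y - 2 * (x / y) * x + z)"
      using quad[of "x / y"] y0 by (intro mult_nonneg_nonneg) auto
    also have "\<dots> = y * z - x\<^sup>2"
      using False by (simp add: field_simps power2_eq_square)
    finally show ?thesis by simp
  qed
  then show ?thesis unfolding x_def y_def z_def EX XX .
qed

section \<open>Implication graphs and bicycles\<close>

definition neg :: "literal \<Rightarrow> literal" where
  "neg a = (fst a, \<not> snd a)"

lemma fst_neg [simp]: "fst (neg a) = fst a"
  and neg_neg [simp]: "neg (neg a) = a"
  and neg_neq [simp]: "neg a \<noteq> a" "a \<noteq> neg a"
  and neg_eq_iff [simp]: "neg a = neg b \<longleftrightarrow> a = b"
  by (auto simp: neg_def prod_eq_iff)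

lemma fst_eq_iff: "fst a = fst b \<longleftrightarrow> b = a \<or> b = neg a"
  by (auto simp: neg_def prod_eq_iff)

definition imp_clause :: "literal \<Rightarrow> literal \<Rightarrow> clause" where
  "imp_clause a b = {neg a, b}"

lemma imp_clause_contrapositive: "imp_clause (neg b) (neg a) = imp_clause a b"
  by (auto simp: imp_clause_def)

lemma imp_clause_eq_iff:
  "imp_clause a b = imp_clause c d \<longleftrightarrow> (a = c \<and> b = d) \<or> (a = neg d \<and> b = neg c)"
  by (auto simp: imp_clause_def doubleton_eq_iff)

fun steps :: "literal list \<Rightarrow> clause list" where
  "steps (a # b # l) = imp_clause a b # steps (b # l)"
| "steps _ = []"

lemma steps_append: "steps (l @ a # r) = steps (l @ [a]) @ steps (a # r)"
  by (induction l rule: steps.induct) auto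

lemma length_steps [simp]: "length (steps l) = length l - 1"
  by (induction l rule: steps.induct) auto

lemma nth_steps: "Suc i < length l \<Longrightarrow> steps l ! i = imp_clause (l ! i) (l ! Suc i)"
proof (induction l arbitrary: i rule: steps.induct)
  case (1 a b l)
  then show ?case by (cases i) auto
qed auto

lemma in_set_steps: "C \<in> set (steps l) \<Longrightarrow> \<exists>a\<in>set l. \<exists>b\<in>set l. C = imp_clause a b"
  by (induction l rule: steps.induct) auto

definition imp_graph :: "clause set \<Rightarrow> literal rel" where
  "imp_graph CS = {(a, b). imp_clause a b \<in> CS}"

lemma imp_graph_rtrancl_neg: "(a, b) \<in> (imp_graph CS)\<^sup>* \<Longrightarrow> (neg b, neg a) \<in> (imp_graph CS)\<^sup>*"
proof (induction rule: rtrancl_induct)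
  case (step b c)
  then have "(neg c, neg b) \<in> imp_graph CS"
    by (simp add: imp_graph_def imp_clause_contrapositive)
  with step.IH show ?case by (rule converse_rtrancl_into_rtrancl[rotated])
qed auto

lemma steps_imp_rtrancl:
  "set (steps l) \<subseteq> CS \<Longrightarrow> l \<noteq> [] \<Longrightarrow> (hd l, last l) \<in> (imp_graph CS)\<^sup>*"
proof (induction l rule: steps.induct)
  case (1 a b l)
  then have "(a, b) \<in> imp_graph CS" "(b, last (b # l)) \<in> (imp_graph CS)\<^sup>*"
    by (auto simp: imp_graph_def)
  then show ?case by (simp add: converse_rtrancl_into_rtrancl)
qed auto

lemma rtrancl_imp_steps:
  assumes "(a, b) \<in> (imp_graph CS)\<^sup>*"
  shows "\<exists>l. set (steps (l @ [b])) \<subseteq> CS \<and> hd (l @ [b]) = a"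
  using assms
proof (induction rule: converse_rtrancl_induct)
  case base
  then show ?case by (intro exI[of _ "[]"]) auto
next
  case (step y z)
  then obtain l where l: "set (steps (l @ [b])) \<subseteq> CS" "hd (l @ [b]) = z" by blast
  then have "steps (y # l @ [b]) = imp_clause y z # steps (l @ [b])"
    by (cases l) auto
  with l step show ?case
    by (intro exI[of _ "y # l"]) (auto simp: imp_graph_def)
qed

section \<open>Satisfiability in terms of implications\<close>

definition holds :: "(nat \<Rightarrow> bool) \<Rightarrow> literal \<Rightarrow> bool" where
  "holds \<alpha> a \<longleftrightarrow> \<alpha> (fst a) = snd a"

lemma holds_neg [simp]: "holds \<alpha> (neg a) \<longleftrightarrow> \<not> holds \<alpha> a"
  by (auto simp: holds_def neg_def)

lemma satisfies_mset: "satisfies \<alpha> (mset cs) \<longleftrightarrow> (\<forall>C\<in>set cs. \<exists>a\<in>C. holds \<alpha> a)"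
  by (auto simp: satisfies_def holds_def split_beta)

lemma holds_rtrancl:
  assumes "(a, b) \<in> (imp_graph (set cs))\<^sup>*" "satisfies \<alpha> (mset cs)" "holds \<alpha> a"
  shows "holds \<alpha> b"
  using assms
  by (induction rule: rtrancl_induct) (fastforce simp: imp_graph_def imp_clause_def satisfies_mset)+

lemma unsatisfiable_if_cycle:
  assumes "(x, neg x) \<in> (imp_graph (set cs))\<^sup>*" "(neg x, x) \<in> (imp_graph (set cs))\<^sup>*"
  shows "\<not> satisfiable (mset cs)"
  using holds_rtrancl[OF assms(1)] holds_rtrancl[OF assms(2)] by (auto simp: satisfiable_def)

text \<open>A maximal consistent set of literals that is closed under implication decides every variable:
  otherwise one could add everything reachable from an undecided literal.\<close>

lemma satisfiable_if_no_cycle: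
  assumes clauses: "\<And>C. C \<in> set cs \<Longrightarrow> \<exists>a b. C = {a, b}"
    and acyclic: "\<And>x. (x, neg x) \<in> (imp_graph (set cs))\<^sup>* \<Longrightarrow> (neg x, x) \<notin> (imp_graph (set cs))\<^sup>*"
  shows "satisfiable (mset cs)"
proof -
  define E where "E = imp_graph (set cs)"
  define V where "V = \<Union>(set cs) \<union> neg ` \<Union>(set cs)"
  have "finite C" if "C \<in> set cs" for C
    using clauses[OF that] by auto
  then have fin: "finite V" by (auto simp: V_def)
  have E_V: "b \<in> V" if "(a, b) \<in> E" for a b
    using that by (auto simp: E_def imp_graph_def imp_clause_def V_def)
  have negV: "neg a \<in> V" if "a \<in> V" for a
    using that by (auto simp: V_def)
  define good where "good A \<longleftrightarrow> A \<subseteq> V \<and> (\<forall>a\<in>A. neg a \<notin> A) \<and> E\<^sup>* `` A \<subseteq> A" for A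
  have "good {}" by (auto simp: good_def)
  moreover have "\<forall>A. good A \<longrightarrow> card A < Suc (card V)"
    using fin by (auto simp: good_def less_Suc_eq_le intro: card_mono)
  ultimately obtain A where A: "good A" and max: "\<And>B. good B \<Longrightarrow> card B \<le> card A"
    using ex_has_greatest_nat[of good "{}" card "Suc (card V)"] by auto
  have decided: "a \<in> A \<or> neg a \<in> A" if "a \<in> V" for a
  proof (rule ccontr)
    assume undec: "\<not> ?thesis"
    \<comment> \<open>By \<open>acyclic\<close> at least one of a and \<open>neg a\<close> does not
      imply its own negation; that one can be added.\<close>
    obtain x where x: "x \<in> V" "x \<notin> A" "neg x \<notin> A" "(x, neg x) \<notin> E\<^sup>*"
    proof (cases "(a, neg a) \<in> E\<^sup>*")
      case True
      then have "(neg a, neg (neg a)) \<notin> E\<^sup>*" using acyclic[of a] by (simp add: E_def)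
      with undec negV[OF \<open>a \<in> V\<close>] show ?thesis by (intro that[of "neg a"]) auto
    next
      case False
      with undec \<open>a \<in> V\<close> show ?thesis by (intro that[of a]) auto
    qed
    define R where "R = E\<^sup>* `` {x}"
    have RV: "R \<subseteq> V"
      using x E_V by (auto simp: R_def elim: rtranclE)
    \<comment> \<open>If x implied both y and \<open>neg y\<close>, contraposing the second
      implication would give x -> y -> \<open>neg x\<close>. The same contraposition shows in
      \<open>RA\<close> that R does not contradict A.\<close>
    have RR: "neg y \<notin> R" if "y \<in> R" for y
    proof
      assume "neg y \<in> R"
      then have "(y, neg x) \<in> E\<^sup>*"
        using imp_graph_rtrancl_neg[of x "neg y"] by (simp add: R_def E_def)
      with that x show False by (auto simp: R_def dest: rtrancl_trans)
    qed
    have RA: "neg y \<notin> A" if "y \<in> R" for y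
    proof
      assume "neg y \<in> A"
      moreover have "(neg y, neg x) \<in> E\<^sup>*"
        using imp_graph_rtrancl_neg[of x y] that by (simp add: R_def E_def)
      ultimately show False using A x by (auto simp: good_def)
    qed
    have "good (A \<union> R)"
      unfolding good_def
    proof (intro conjI ballI)
      show "E\<^sup>* `` (A \<union> R) \<subseteq> A \<union> R"
        using A by (auto simp: good_def R_def intro: rtrancl_trans)
      show "neg a \<notin> A \<union> R" if "a \<in> A \<union> R" for a
        using that RR[of a] RA[of a] RA[of "neg a"] A by (auto simp: good_def)
    qed (use A RV in \<open>auto simp: good_def\<close>)
    moreover have "card A < card (A \<union> R)"
    proof (rule psubset_card_mono)
      have "A \<union> R \<subseteq> V" using A RV unfolding good_def by blast
      then show "finite (A \<union> R)" using fin by (rule finite_subset)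
      have "x \<in> R" by (simp add: R_def)
      with \<open>x \<notin> A\<close> show "A \<subset> A \<union> R" by blast
    qed
    ultimately show False using max[of "A \<union> R"] by simp
  qed
  define \<alpha> where "\<alpha> = (\<lambda>i. (i, True) \<in> A)"
  have hA: "holds \<alpha> a" if "a \<in> A" for a
  proof (cases "snd a")
    case True
    with that show ?thesis by (cases a) (auto simp: holds_def \<alpha>_def)
  next
    case False
    then have "neg a = (fst a, True)" by (simp add: neg_def)
    with that A False show ?thesis by (auto simp: holds_def \<alpha>_def good_def)
  qed
  have "\<exists>a\<in>C. holds \<alpha> a" if C: "C \<in> set cs" for C
  proof -
    obtain a b where ab: "C = {a, b}" using clauses[OF C] by auto
    show ?thesis
    proof (cases "a \<in> A")
      case False
      have "a \<in> V" using C ab by (auto simp: V_def)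
      with False decided have "neg a \<in> A" by blast
      moreover have "(neg a, b) \<in> E" using C ab by (simp add: E_def imp_graph_def imp_clause_def)
      ultimately have "b \<in> A" using A unfolding good_def by blast
      with hA ab show ?thesis by auto
    qed (use hA ab in auto)
  qed
  then show ?thesis by (auto simp: satisfiable_def satisfies_mset)
qed

section \<open>Bicycles\<close>

text \<open>As in Chvatal and Reed's analysis of random 2-SAT.  The last condition excludes that the first and
  the last clause coincide, which would allow for satisfiable cycles.\<close>

definition bicycle :: "literal \<Rightarrow> literal list \<Rightarrow> literal \<Rightarrow> bool" where
  "bicycle y zs v \<longleftrightarrow> zs \<noteq> [] \<and> distinct (map fst zs) \<and> fst y \<in> fst ` set zs \<and> fst v \<in> fst ` set zs \<and> v \<noteq> hd zs"

text \<open>The inner variables are distinct, so two edges in the same direction can only agree if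
  they are the first and the last one, which \<open>v \<noteq> hd zs\<close> forbids. Two
  contrapositive edges would have to be adjacent, and then their common literal would equal its own
  negation.\<close>

lemma distinct_steps_bicycle:
  assumes "bicycle y zs v"
  shows "distinct (steps (y # zs @ [v]))"
proof -
  let ?l = "y # zs @ [v]" and ?s = "length zs"
  have inj: "i = j" if "fst (?l ! i) = fst (?l ! j)" "1 \<le> i" "i \<le> ?s" "1 \<le> j" "j \<le> ?s" for i j
  proof -
    obtain i' j' where "i = Suc i'" "j = Suc j'" using \<open>1 \<le> i\<close> \<open>1 \<le> j\<close> by (cases i; cases j; auto)
    with that assms nth_eq_iff_index_eq[of "map fst zs" i' j'] show ?thesis
      by (auto simp: bicycle_def nth_append)
  qed
  have v: "?l ! Suc ?s = v" and hd: "?l ! 1 \<noteq> v"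
    using assms by (auto simp: bicycle_def hd_conv_nth nth_append)
  have "imp_clause (?l ! i) (?l ! Suc i) \<noteq> imp_clause (?l ! j) (?l ! Suc j)" if "i < j" "j \<le> ?s" for i j
  proof
    assume "imp_clause (?l ! i) (?l ! Suc i) = imp_clause (?l ! j) (?l ! Suc j)"
    then consider "?l ! i = ?l ! j" "?l ! Suc i = ?l ! Suc j"
      | "?l ! i = neg (?l ! Suc j)" "?l ! Suc i = neg (?l ! j)"
      unfolding imp_clause_eq_iff by blast
    then show False
    proof cases
      case 1
      then show False
        using inj[of "Suc i" "Suc j"] inj[of i j] that v hd
        by (cases "i = 0"; cases "j = ?s") (auto simp del: nth_Cons_Suc)
    next
      case 2
      then have "Suc i = j"
        using inj[of "Suc i" j] that by (auto simp del: nth_Cons_Suc)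
      with 2 show False by auto
    qed
  qed
  then have "steps ?l ! i \<noteq> steps ?l ! j" if "i < j" "j < length (steps ?l)" for i j
    using that by (simp add: nth_steps del: steps.simps nth_Cons_Suc)
  then show ?thesis
    unfolding distinct_conv_nth by (metis nat_neq_iff)
qed

text \<open>Follow the path into h backwards and prepend its literals until a variable repeats; z
  repeats at the latest. The transitive closure without reflexivity guarantees an edge entering h,
  from which y can be taken.\<close>

lemma prefix_to_repeated_variable:
  assumes "(z, h) \<in> (imp_graph CS)\<^sup>+" "set (steps (h # W @ [v])) \<subseteq> CS"
    "distinct (map fst (h # W))" "fst z \<in> fst ` set (h # W)"
  shows "\<exists>P y. set (steps (y # P @ h # W @ [v])) \<subseteq> CS \<and> distinct (map fst (P @ h # W)) \<and>
    fst y \<in> fst ` set (P @ h # W)"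
  using assms
proof (induction arbitrary: W rule: trancl_induct)
  case (base h)
  then show ?case by (intro exI[of _ "[]"] exI[of _ z]) (auto simp: imp_graph_def)
next
  case (step h' h)
  show ?case
  proof (cases "fst h' \<in> fst ` set (h # W)")
    case True
    with step show ?thesis by (intro exI[of _ "[]"] exI[of _ h']) (auto simp: imp_graph_def)
  next
    case False
    have "\<exists>P y. set (steps (y # P @ h' # (h # W) @ [v])) \<subseteq> CS \<and> distinct (map fst (P @ h' # h # W)) \<and>
       fst y \<in> fst ` set (P @ h' # h # W)"
      using False step.prems step.hyps by (intro step.IH) (auto simp: imp_graph_def)
    then obtain P y where "set (steps (y # P @ h' # (h # W) @ [v])) \<subseteq> CS"
       "distinct (map fst (P @ h' # h # W))" "fst y \<in> fst ` set (P @ h' # h # W)" by blast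
    then show ?thesis
      by (intro exI[of _ "P @ [h']"] exI[of _ y]) auto
  qed
qed

text \<open>A shortest path of the form \<open>w, \<dots>, neg w\<close> repeats no variable before its end.  Prolonging it backwards,
  along a path from \<open>neg w\<close> to \<open>w\<close>, until a variable repeats gives the bicycle.\<close>

lemma exists_bicycle:
  assumes "(x, neg x) \<in> (imp_graph CS)\<^sup>*" "(neg x, x) \<in> (imp_graph CS)\<^sup>*"
  shows "\<exists>y zs v. bicycle y zs v \<and> set (steps (y # zs @ [v])) \<subseteq> CS"
proof -
  let ?E = "imp_graph CS"
  \<comment> \<open>The end \<open>neg (hd ws)\<close> is not stored in ws, and the head is not
    fixed to x: minimality ranges over all contradictory literals at once, which the case of
    complementary literals below exploits.\<close>
  define Q where "Q ws \<longleftrightarrow> ws \<noteq> [] \<and> set (steps (ws @ [neg (hd ws)])) \<subseteq> CS \<and> (neg (hd ws), hd ws) \<in> ?E\<^sup>*" for ws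
  obtain l where l: "set (steps (l @ [neg x])) \<subseteq> CS" "hd (l @ [neg x]) = x"
    using rtrancl_imp_steps[OF assms(1)] by blast
  then have "l \<noteq> []" by (auto simp: neg_eq_iff)
  with l assms have "Q l" by (auto simp: Q_def)
  then obtain ws where ws: "Q ws" and min: "\<And>ws'. Q ws' \<Longrightarrow> length ws \<le> length ws'"
    using ex_has_least_nat[of Q l length] by auto
  have dist: "distinct (map fst ws)"
  proof (rule ccontr)
    assume "\<not> ?thesis"
    then obtain p q r i where "map fst ws = p @ [i] @ q @ [i] @ r"
      using not_distinct_decomp by blast
    then obtain p' a q' b r' where dec: "ws = p' @ a # q' @ b # r'" "fst a = fst b"
      by (auto simp: map_eq_append_conv append_eq_map_conv map_eq_Cons_conv Cons_eq_map_conv)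
    let ?e = "neg (hd ws)"
    have st: "set (steps (p' @ [a])) \<subseteq> CS" "set (steps (a # q' @ [b])) \<subseteq> CS" "set (steps (b # r' @ [?e])) \<subseteq> CS"
      using ws steps_append[of p' a "q' @ b # r' @ [?e]"] steps_append[of "a # q'" b "r' @ [?e]"]
      unfolding Q_def dec(1) by auto
    from dec(2) consider "b = a" | "b = neg a" unfolding fst_eq_iff by blast
    then show False
    proof cases
      case 1
      have hd: "hd (p' @ a # r') = hd ws" using dec by (cases p') auto
      have "set (steps ((p' @ a # r') @ [?e])) \<subseteq> CS"
        using st steps_append[of p' a "r' @ [?e]"] 1 by auto
      then have "Q (p' @ a # r')" using ws hd by (auto simp: Q_def)
      then show False using min[of "p' @ a # r'"] dec by simp
    next
      \<comment> \<open>The segment from a to \<open>neg a\<close> is itself a shorter candidate.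
        Its return path runs along the rest of ws to the negated head, back to the head, and along
        the beginning of ws to a.\<close>
      case 2
      have "(b, ?e) \<in> ?E\<^sup>*"
        using steps_imp_rtrancl[OF st(3)] by simp
      moreover have "(?e, hd ws) \<in> ?E\<^sup>*" using ws by (simp add: Q_def)
      moreover have "(hd ws, a) \<in> ?E\<^sup>*"
        using steps_imp_rtrancl[OF st(1)] dec by (cases p') auto
      ultimately have "(neg a, a) \<in> ?E\<^sup>*" using 2 by (meson rtrancl_trans)
      then have "Q (a # q')" using st 2 by (auto simp: Q_def)
      then show False using min[of "a # q'"] dec by simp
    qed
  qed
  obtain h W where hW: "ws = h # W" using ws by (cases ws) (auto simp: Q_def)
  have "(neg h, h) \<in> ?E\<^sup>+"
    using ws hW by (auto simp: Q_def rtrancl_eq_or_trancl)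
  moreover have "set (steps (h # W @ [neg h])) \<subseteq> CS" using ws hW by (simp add: Q_def)
  ultimately obtain P y where P: "set (steps (y # P @ h # W @ [neg h])) \<subseteq> CS"
      "distinct (map fst (P @ h # W))" "fst y \<in> fst ` set (P @ h # W)"
    using prefix_to_repeated_variable[of "neg h" h CS W "neg h"] dist hW
    by (metis fst_neg image_eqI list.set_intros(1))
  have "neg h \<noteq> hd (P @ h # W)"
  proof (cases P)
    case (Cons p P')
    then have "fst p \<noteq> fst (neg h)" using P(2) by auto
    with Cons show ?thesis by (metis append_Cons list.sel(1))
  qed auto
  with P have "bicycle y (P @ h # W) (neg h)"
    by (simp add: bicycle_def)
  with P show ?thesis by (intro exI[of _ y] exI[of _ "P @ h # W"] exI[of _ "neg h"]) auto
qed

lemma unsatisfiable_imp_bicycle: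
  assumes "\<not> satisfiable (mset cs)" "set cs \<subseteq> clauses n"
  shows "\<exists>y zs v. bicycle y zs v \<and> set zs \<subseteq> {1..n} \<times> UNIV \<and> set (steps (y # zs @ [v])) \<subseteq> set cs"
proof -
  have "\<exists>a b. C = {a, b}" if "C \<in> set cs" for C
  proof -
    have "C \<in> clauses n" using that assms(2) by auto
    then show ?thesis by (auto simp: clauses_def)
  qed
  then obtain x where "(x, neg x) \<in> (imp_graph (set cs))\<^sup>*" "(neg x, x) \<in> (imp_graph (set cs))\<^sup>*"
    using satisfiable_if_no_cycle[of cs] assms(1) by blast
  from exists_bicycle[OF this] obtain y zs v where
    b: "bicycle y zs v" and st: "set (steps (y # zs @ [v])) \<subseteq> set cs" by blast
  have "z \<in> {1..n} \<times> UNIV" if "z \<in> set zs" for z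
  proof -
    obtain l r where zs: "zs = l @ z # r" using split_list[OF \<open>z \<in> set zs\<close>] by blast
    \<comment> \<open>Followed by v at the latest, z has an outgoing edge, whose clause confines the
      variable of z to 1..n.\<close>
    obtain b r' where "r @ [v] = b # r'" by (cases r) auto
    then have "imp_clause z b \<in> set (steps (y # zs @ [v]))"
      using steps_append[of "y # l" z "r @ [v]"] zs by auto
    then have "imp_clause z b \<in> clauses n" using st assms(2) by blast
    then have "neg z \<in> {1..n} \<times> UNIV"
      by (auto simp: imp_clause_def clauses_def doubleton_eq_iff)
    then show ?thesis by (cases z) (auto simp: neg_def)
  qed
  with b st show ?thesis by blast
qed

section \<open>Walk sums\<close>

fun walk_weight :: "(literal \<Rightarrow> literal \<Rightarrow> real) \<Rightarrow> literal list \<Rightarrow> real" where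
  "walk_weight g (a # b # l) = g a b * walk_weight g (b # l)"
| "walk_weight g _ = 1"

lemma walk_weight_append: "walk_weight g (l @ a # r) = walk_weight g (l @ [a]) * walk_weight g (a # r)"
  by (induction g l rule: walk_weight.induct) (auto simp: neq_Nil_conv)

lemma walk_weight_nonneg:
  "(\<And>a b. a \<in> set l \<Longrightarrow> b \<in> set l \<Longrightarrow> g a b \<ge> 0) \<Longrightarrow> walk_weight g l \<ge> 0"
  by (induction g l rule: walk_weight.induct) auto

lemma walk_weight_mono:
  assumes "\<And>a b. a \<in> set l \<Longrightarrow> b \<in> set l \<Longrightarrow> 0 \<le> g a b \<and> g a b \<le> h a b"
  shows "walk_weight g l \<le> walk_weight h l"
  using assms
proof (induction g l rule: walk_weight.induct)
  case (1 g a b l)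
  have "walk_weight g (b # l) \<le> walk_weight h (b # l)"
    using 1 by auto
  moreover have "0 \<le> walk_weight g (b # l)"
    using 1(2) by (intro walk_weight_nonneg) auto
  ultimately show ?case
    using 1(2)[of a b] by (auto intro!: mult_mono)
qed auto

lemma prod_list_steps: "prod_list (map f (steps l)) = walk_weight (\<lambda>a b. f (imp_clause a b)) l"
  by (induction l rule: steps.induct) auto

definition words :: "literal set \<Rightarrow> nat \<Rightarrow> literal list set" where
  "words V k = {zs. set zs \<subseteq> V \<and> length zs = k}"

lemma finite_words: "finite V \<Longrightarrow> finite (words V k)"
  unfolding words_def by (rule finite_lists_length_eq)

lemma words_0 [simp]: "words V 0 = {[]}"
  by (auto simp: words_def)

lemma sum_words_Suc: "(\<Sum>zs\<in>words V (Suc k). f zs) = (\<Sum>c\<in>V. \<Sum>zs\<in>words V k. f (c # zs))"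
proof -
  have "words V (Suc k) = (\<lambda>(c, zs). c # zs) ` (V \<times> words V k)"
    by (auto simp: words_def image_iff length_Suc_conv)
  then have "(\<Sum>zs\<in>words V (Suc k). f zs) = (\<Sum>(c, zs)\<in>V \<times> words V k. f (c # zs))"
    by (simp add: sum.reindex inj_on_def split_beta)
  then show ?thesis by (simp add: sum.cartesian_product)
qed

text \<open>The index counts intermediate vertices, so this is an entry of the (k+1)-st power of g
  with all intermediate vertices in V.\<close>

fun walk_sum :: "(literal \<Rightarrow> literal \<Rightarrow> real) \<Rightarrow> literal set \<Rightarrow> nat \<Rightarrow> literal \<Rightarrow> literal \<Rightarrow> real" where
  "walk_sum g V 0 a b = g a b"
| "walk_sum g V (Suc k) a b = (\<Sum>c\<in>V. g a c * walk_sum g V k c b)"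

lemma sum_walk_weight: "(\<Sum>zs\<in>words V k. walk_weight g (a # zs @ [b])) = walk_sum g V k a b"
  by (induction k arbitrary: a) (auto simp: sum_words_Suc sum_distrib_left[symmetric])

lemma walk_sum_nonneg: "(\<And>a b. g a b \<ge> 0) \<Longrightarrow> walk_sum g V k a b \<ge> 0"
  by (induction k arbitrary: a) (auto intro!: sum_nonneg)

text \<open>Each inner vertex is entered once and left once and so contributes u twice; the two ends
  contribute it once.\<close>

lemma walk_weight_rank_one:
  "walk_weight (\<lambda>a b. lam * u a * u b) (a # zs @ [b]) = lam ^ Suc (length zs) * u a * u b * (\<Prod>z\<leftarrow>zs. (u z)\<^sup>2)"
  by (induction zs arbitrary: a) (auto simp: power2_eq_square)

lemma sum_prod_list_words:
  assumes "finite V"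
  shows "(\<Sum>zs\<in>words V k. \<Prod>z\<leftarrow>zs. f z) = (\<Sum>z\<in>V. f z :: real) ^ k"
  by (induction k) (auto simp: sum_words_Suc sum_distrib_left[symmetric] sum_distrib_right[symmetric])

text \<open>Choose the letters one by one. At most \<open>card F + k\<close> variables are ever
  forbidden, each with two literals of squared weight at most d, so every choice retains mass at
  least 1 - 2d(card F + k). Adding the chosen variable to F keeps \<open>card F + k\<close> constant
  along the induction.\<close>

lemma sum_prod_list_distinct_words:
  fixes u :: "literal \<Rightarrow> real" and d :: real
  assumes fin: "finite V" and one: "(\<Sum>z\<in>V. (u z)\<^sup>2) = 1" and U: "\<And>z. z \<in> V \<Longrightarrow> (u z)\<^sup>2 \<le> d"
    and F: "finite F" and small: "2 * d * (card F + k) \<le> 1" and d: "d \<ge> 0"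
  shows "(\<Sum>zs | zs \<in> words V k \<and> distinct (map fst zs) \<and> (\<forall>z\<in>set zs. fst z \<notin> F). \<Prod>z\<leftarrow>zs. (u z)\<^sup>2)
    \<ge> (1 - 2 * d * (card F + k)) ^ k"
  using F small
proof (induction k arbitrary: F)
  case 0
  have *: "{zs \<in> words V 0. distinct (map fst zs) \<and> (\<forall>z\<in>set zs. fst z \<notin> F)} = {[]}" by auto
  show ?case unfolding * by simp
next
  case (Suc k)
  define S where "S k F = {zs. zs \<in> words V k \<and> distinct (map fst zs) \<and> (\<forall>z\<in>set zs. fst z \<notin> F)}" for k F
  define e where "e = 2 * d * (card F + Suc k)"
  have e: "0 \<le> e" "e \<le> 1" using Suc.prems d by (auto simp: e_def)
  have finS: "finite (S k F)" for k F
    by (rule finite_subset[OF _ finite_words[OF fin, of k]]) (auto simp: S_def)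
  have S_Suc: "S (Suc k) F = (\<lambda>(c, zs). c # zs) ` (SIGMA c:{c\<in>V. fst c \<notin> F}. S k (insert (fst c) F))"
    by (auto simp: S_def words_def image_iff length_Suc_conv)
  have eq: "(\<Sum>zs\<in>S (Suc k) F. \<Prod>z\<leftarrow>zs. (u z)\<^sup>2) =
      (\<Sum>c | c \<in> V \<and> fst c \<notin> F. (u c)\<^sup>2 * (\<Sum>zs\<in>S k (insert (fst c) F). \<Prod>z\<leftarrow>zs. (u z)\<^sup>2))"
  proof -
    have "(\<Sum>zs\<in>S (Suc k) F. \<Prod>z\<leftarrow>zs. (u z)\<^sup>2) =
      (\<Sum>(c, zs)\<in>(SIGMA c:{c\<in>V. fst c \<notin> F}. S k (insert (fst c) F)). (u c)\<^sup>2 * (\<Prod>z\<leftarrow>zs. (u z)\<^sup>2))"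
      unfolding S_Suc by (subst sum.reindex) (auto simp: inj_on_def split_def)
    also have "\<dots> = (\<Sum>c | c \<in> V \<and> fst c \<notin> F. \<Sum>zs\<in>S k (insert (fst c) F). (u c)\<^sup>2 * (\<Prod>z\<leftarrow>zs. (u z)\<^sup>2))"
      using fin finS by (intro sum.Sigma[symmetric]) auto
    finally show ?thesis by (simp add: sum_distrib_left)
  qed
  have "(1 - e) ^ k \<le> (\<Sum>zs\<in>S k (insert (fst c) F). \<Prod>z\<leftarrow>zs. (u z)\<^sup>2)" if "fst c \<notin> F" for c
    using Suc.IH[of "insert (fst c) F"] Suc.prems that by (auto simp: e_def S_def algebra_simps)
  then have "(\<Sum>zs\<in>S (Suc k) F. \<Prod>z\<leftarrow>zs. (u z)\<^sup>2) \<ge> (\<Sum>c | c \<in> V \<and> fst c \<notin> F. (u c)\<^sup>2 * (1 - e) ^ k)"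
    unfolding eq by (intro sum_mono mult_left_mono) auto
  also have "(\<Sum>c | c \<in> V \<and> fst c \<notin> F. (u c)\<^sup>2 * (1 - e) ^ k) = (\<Sum>c | c \<in> V \<and> fst c \<notin> F. (u c)\<^sup>2) * (1 - e) ^ k"
    by (simp add: sum_distrib_right)
  finally have *: "(\<Sum>c | c \<in> V \<and> fst c \<notin> F. (u c)\<^sup>2) * (1 - e) ^ k \<le> (\<Sum>zs\<in>S (Suc k) F. \<Prod>z\<leftarrow>zs. (u z)\<^sup>2)" .
  have "1 - e \<le> (\<Sum>c | c \<in> V \<and> fst c \<notin> F. (u c)\<^sup>2)"
  proof -
    have "(\<Sum>c | c \<in> V \<and> fst c \<in> F. (u c)\<^sup>2) \<le> real (card {c\<in>V. fst c \<in> F}) * d"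
      using U by (intro sum_bounded_above) auto
    also have "card {c\<in>V. fst c \<in> F} \<le> card (F \<times> (UNIV :: bool set))"
      using Suc.prems by (intro card_mono) auto
    also have "card (F \<times> (UNIV :: bool set)) = 2 * card F"
      by (simp add: card_cartesian_product)
    also have "real (2 * card F) * d \<le> e"
      using d by (auto simp: e_def algebra_simps)
    finally have *: "(\<Sum>c | c \<in> V \<and> fst c \<in> F. (u c)\<^sup>2) \<le> e" using d by (simp add: mult_right_mono)
    have "1 = (\<Sum>c | c \<in> V \<and> fst c \<in> F. (u c)\<^sup>2) + (\<Sum>c | c \<in> V \<and> fst c \<notin> F. (u c)\<^sup>2)"
      unfolding one[symmetric] using fin
      by (subst sum.union_disjoint[symmetric]) (auto intro!: sum.cong)
    with * show ?thesis by linarith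
  qed
  then have "(1 - e) ^ Suc k \<le> (\<Sum>c | c \<in> V \<and> fst c \<notin> F. (u c)\<^sup>2) * (1 - e) ^ k"
    using e by (simp add: mult_right_mono)
  also note *
  finally show ?case by (simp add: S_def e_def)
qed

section \<open>Perturbation of a rank one kernel\<close>

text \<open>If the rank one kernel \<open>lam * u * u\<close> is perturbed by a sparse kernel \<open>J\<close> whose growth is controlled
  by the potential \<open>v\<close>, then \<open>u + s * v\<close> is a supersolution with growth rate \<open>mu\<close>, hence the walk sums stay
  close to those of the unperturbed kernel.\<close>

lemma walk_sum_perturbed_le:
  fixes u v :: "literal \<Rightarrow> real" and J :: "literal \<Rightarrow> literal \<Rightarrow> real" and lam rho mu s eta kap U :: real
  assumes fin: "finite V"
    and u: "\<And>a. 0 \<le> u a" "(\<Sum>z\<in>V. (u z)\<^sup>2) = 1" "\<And>a. a \<in> V \<Longrightarrow> u a \<le> U"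
    and J: "\<And>a b. 0 \<le> J a b" "\<And>a b. J a b \<noteq> 0 \<Longrightarrow> a \<in> W \<and> b \<in> W" "\<And>a b. J a b \<le> 1"
    and v: "\<And>a. 0 \<le> v a" "\<And>a. a \<in> W \<Longrightarrow> 1 \<le> v a" "\<And>a. (\<Sum>b\<in>V. J a b * v b) \<le> rho * v a"
    and uv: "(\<Sum>z\<in>V. u z * v z) \<le> eta"
    and par: "0 \<le> rho" "0 \<le> lam" "rho < mu" "0 \<le> s" "U * rho \<le> s * (mu - rho)" "lam * (1 + s * eta) \<le> mu"
      "lam * eta \<le> kap * (mu - rho)" "0 \<le> kap" "0 \<le> U"
    and bV: "b \<in> V"
  shows "walk_sum (\<lambda>a b. lam * u a * u b + J a b) V k a b \<le>
     mu ^ Suc k * (u a + s * v a) * u b +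
     (if b \<in> W then rho ^ k * v a + kap * (mu ^ k - rho ^ k) * (u a + s * v a) else 0)"
proof -
  define i :: real where "i = (if b \<in> W then 1 else 0)"
  define w where "w a = u a + s * v a" for a
  define M where "M h a = (\<Sum>c\<in>V. (lam * u a * u c + J a c) * h c)" for h :: "literal \<Rightarrow> real" and a
  have M_split: "M h a = lam * u a * (\<Sum>c\<in>V. u c * h c) + (\<Sum>c\<in>V. J a c * h c)" for h a
    by (simp add: M_def algebra_simps sum.distrib sum_distrib_left)
  have i: "0 \<le> i" by (simp add: i_def)
  have mu: "0 \<le> mu" using par by linarith
  have pw: "rho ^ k \<le> mu ^ k" for k using par by (intro power_mono) auto
  have w0: "0 \<le> w a" for a using u v par by (auto simp: w_def)
  have uw: "u a \<le> w a" for a using v par by (auto simp: w_def)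
  \<comment> \<open>J lives on W, where v \<ge> 1, so u can be replaced by U v there. The parameter
    s is large enough for the gap between mu and rho to absorb the result.\<close>
  have Ju: "(\<Sum>c\<in>V. J a c * u c) \<le> s * (mu - rho) * v a" for a
  proof -
    have "(\<Sum>c\<in>V. J a c * u c) \<le> (\<Sum>c\<in>V. U * (J a c * v c))"
    proof (intro sum_mono)
      fix c assume c: "c \<in> V"
      show "J a c * u c \<le> U * (J a c * v c)"
      proof (cases "J a c = 0")
        case False
        then have "1 \<le> v c" using J v by blast
        then have "u c \<le> U * v c" using u(3)[OF c] par mult_left_mono[of 1 "v c" U] by auto
        then have "J a c * u c \<le> J a c * (U * v c)" using J by (intro mult_left_mono) auto
        then show ?thesis by (simp add: mult_ac)
      qed auto
    qed
    also have "\<dots> = U * (\<Sum>c\<in>V. J a c * v c)" by (simp add: sum_distrib_left)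
    also have "\<dots> \<le> U * (rho * v a)" using v par by (intro mult_left_mono) auto
    also have "\<dots> = U * rho * v a" by simp
    also have "\<dots> \<le> s * (mu - rho) * v a" using v par by (intro mult_right_mono) auto
    finally show ?thesis .
  qed
  have Mw: "M w a \<le> mu * w a" for a
  proof -
    have "(\<Sum>c\<in>V. u c * w c) = 1 + s * (\<Sum>c\<in>V. u c * v c)"
      unfolding u(2)[symmetric] by (simp add: w_def algebra_simps sum.distrib sum_distrib_left power2_eq_square)
    also have "\<dots> \<le> 1 + s * eta" using uv par by (simp add: mult_left_mono)
    finally have "lam * u a * (\<Sum>c\<in>V. u c * w c) \<le> lam * u a * (1 + s * eta)"
      using u par by (intro mult_left_mono) auto
    also have "\<dots> = lam * (1 + s * eta) * u a" by simp
    also have "\<dots> \<le> mu * u a" using u par by (intro mult_right_mono) auto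
    finally have 1: "lam * u a * (\<Sum>c\<in>V. u c * w c) \<le> mu * u a" .
    have "(\<Sum>c\<in>V. J a c * w c) = (\<Sum>c\<in>V. J a c * u c) + s * (\<Sum>c\<in>V. J a c * v c)"
      by (simp add: w_def algebra_simps sum.distrib sum_distrib_left)
    also have "\<dots> \<le> s * (mu - rho) * v a + s * (rho * v a)"
      using Ju v par by (intro add_mono mult_left_mono) auto
    finally show ?thesis using 1 unfolding M_split by (simp add: w_def algebra_simps)
  qed
  \<comment> \<open>Under M the potential grows by the factor rho and leaks a multiple of w, which
    then grows by the factor mu. Summing the leaks over k steps gives the factor mu^k - rho^k in the
    bound.\<close>
  have Mv: "M v a \<le> kap * (mu - rho) * w a + rho * v a" for a
  proof -
    have "lam * u a * (\<Sum>c\<in>V. u c * v c) \<le> lam * u a * eta"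
      using u uv par by (intro mult_left_mono) auto
    also have "\<dots> = lam * eta * u a" by simp
    also have "\<dots> \<le> kap * (mu - rho) * u a"
      using u par by (intro mult_right_mono) auto
    also have "\<dots> \<le> kap * (mu - rho) * w a"
      using par uw by (intro mult_left_mono) auto
    finally show ?thesis using v unfolding M_split by (intro add_mono) auto
  qed
  \<comment> \<open>The last edge decides: if it uses the rank one part, the walk sum starts from a
    multiple of w; if it uses J, it starts from at most v, and only for b in W.\<close>
  have "walk_sum (\<lambda>a b. lam * u a * u b + J a b) V k a b \<le>
      mu ^ Suc k * u b * w a + i * (rho ^ k * v a + kap * (mu ^ k - rho ^ k) * w a)"
  proof (induction k arbitrary: a)
    case 0
    have "lam * 1 \<le> lam * (1 + s * eta)"
    proof -
      have "0 \<le> (\<Sum>z\<in>V. u z * v z)" using u v by (intro sum_nonneg) auto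
      with uv par show ?thesis by (intro mult_left_mono) auto
    qed
    then have "lam * u a * u b \<le> mu * w a * u b"
      using par u uw mu w0 by (intro mult_mono mult_nonneg_nonneg) auto
    moreover have "J a b \<le> i * v a"
    proof (cases "J a b = 0")
      case False
      then have "a \<in> W" "b \<in> W" using J(2) by auto
      then show ?thesis using v(2)[of a] J(3)[of a b] by (simp add: i_def)
    qed (use i v in auto)
    ultimately show ?case by (simp add: mult_ac)
  next
    case (Suc k)
    have "walk_sum (\<lambda>a b. lam * u a * u b + J a b) V (Suc k) a b
        \<le> M (\<lambda>a. mu ^ Suc k * u b * w a + i * (rho ^ k * v a + kap * (mu ^ k - rho ^ k) * w a)) a"
      unfolding M_def walk_sum.simps using Suc u J par
      by (intro sum_mono mult_left_mono) (auto intro!: add_nonneg_nonneg mult_nonneg_nonneg)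
    also have "\<dots> = mu ^ Suc k * u b * M w a + i * (rho ^ k * M v a + kap * (mu ^ k - rho ^ k) * M w a)"
      by (simp add: M_def algebra_simps sum.distrib sum_distrib_left sum_subtractf)
    also have "\<dots> \<le> mu ^ Suc k * u b * (mu * w a) +
        i * (rho ^ k * (kap * (mu - rho) * w a + rho * v a) + kap * (mu ^ k - rho ^ k) * (mu * w a))"
      using Mw Mv mu u i par pw by (intro add_mono mult_left_mono mult_nonneg_nonneg) auto
    also have "\<dots> = mu ^ Suc (Suc k) * u b * w a + i * (rho ^ Suc k * v a + kap * (mu ^ Suc k - rho ^ Suc k) * w a)"
      by (simp add: algebra_simps)
    finally show ?case .
  qed
  then show ?thesis by (cases "b \<in> W") (simp_all add: w_def i_def mult_ac)
qed

lemma sum_of_bool_mult_le: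
  fixes v :: "'a \<Rightarrow> real"
  assumes "\<And>b. 0 \<le> v b" "finite V" "finite S" "\<And>b. P b \<Longrightarrow> b \<in> S"
  shows "(\<Sum>b\<in>V. of_bool (P b) * v b) \<le> (\<Sum>b\<in>S. v b)"
proof -
  have "(\<Sum>b\<in>V. of_bool (P b) * v b) = (\<Sum>b | b \<in> V \<and> P b. v b)"
    unfolding sum.inter_filter[OF assms(2)] by (intro sum.cong) auto
  also have "\<dots> \<le> (\<Sum>b\<in>S. v b)"
    using assms by (intro sum_mono2) auto
  finally show ?thesis .
qed

text \<open>The implication graph of a snake consists of directed paths of length \<open>t\<close> between the two pivot literals.
  Along each of them the potential increases linearly from \<open>1\<close> to \<open>2\<close>; at a pivot literal, where two paths
  start, it drops to about half its value.\<close>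

lemma snake_potential:
  fixes s :: "nat \<Rightarrow> literal" and t :: nat
  defines "W \<equiv> (\<lambda>i. fst (s i)) ` {1..<2*t}" and "T \<equiv> {imp_clause (s i) (s (Suc i)) | i. i < 2 * t}"
  assumes t: "t \<ge> 2" and inj: "inj_on (\<lambda>i. fst (s i)) {1..<2*t}"
    and s0: "s 0 = neg (s t)" and s2: "s (2 * t) = neg (s t)"
  shows "\<exists>v :: literal \<Rightarrow> real. (\<forall>a. 0 \<le> v a \<and> v a \<le> 2) \<and> (\<forall>a. fst a \<in> W \<longrightarrow> 1 \<le> v a) \<and>
    (\<forall>a. fst a \<notin> W \<longrightarrow> v a = 0) \<and>
    (\<forall>V a. finite V \<longrightarrow> (\<Sum>b\<in>V. of_bool (imp_clause a b \<in> T) * v b) \<le> (1 + 1 / t) * v a)"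
proof -
  define h :: "nat \<Rightarrow> real" where "h i = (if i < t then real i else real i - real t) / real t" for i
  define idx where "idx = the_inv_into {1..<2*t} (\<lambda>i. fst (s i))"
  \<comment> \<open>Contraposed paths run through the indices downwards, hence 2 - h for negated
    literals. Both literals of the pivot variable end one path and start two, and get the maximal
    value 2.\<close>
  define v :: "literal \<Rightarrow> real" where "v a =
    (if fst a \<notin> W then 0 else if idx (fst a) = t then 2
     else if a = s (idx (fst a)) then 1 + h (idx (fst a)) else 2 - h (idx (fst a)))" for a
  have idx: "idx (fst (s i)) = i" if "1 \<le> i" "i < 2 * t" for i
    unfolding idx_def using that by (intro the_inv_into_f_f inj) auto
  have inW: "fst (s i) \<in> W" if "1 \<le> i" "i < 2 * t" for i
    using that by (auto simp: W_def)
  have v_s: "v (s i) = 1 + h i" and v_neg: "v (neg (s i)) = 2 - h i" if "1 \<le> i" "i < 2 * t" "i \<noteq> t" for i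
    using that idx[of i] inW[of i] by (auto simp: v_def)
  have v_t: "v (s t) = 2" "v (neg (s t)) = 2"
    using t idx[of t] inW[of t] by (auto simp: v_def)
  have v_end: "v (s 0) = 2" "v (neg (s 0)) = 2" "v (s (2 * t)) = 2" "v (neg (s (2 * t))) = 2"
    using s0 s2 v_t by auto
  have h: "0 \<le> h i" "h i \<le> 1" if "i < 2 * t" for i
    using that t by (auto simp: h_def field_simps)
  have idxW: "1 \<le> idx w \<and> idx w < 2 * t \<and> fst (s (idx w)) = w" if "w \<in> W" for w
    using that idx by (auto simp: W_def)
  have v02: "0 \<le> v a \<and> v a \<le> 2" and v1: "fst a \<in> W \<Longrightarrow> 1 \<le> v a" for a
    using idxW[of "fst a"] h[of "idx (fst a)"] by (auto simp: v_def)
  have inj': "i = j" if "fst (s i) = fst (s j)" "1 \<le> i" "i < 2 * t" "1 \<le> j" "j < 2 * t" for i j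
    using inj that by (auto simp: inj_on_def)
  have succ: "\<exists>i<2*t. (a = s i \<and> b = s (Suc i)) \<or> (a = neg (s (Suc i)) \<and> b = neg (s i))"
    if "imp_clause a b \<in> T" for a b
    using that by (auto simp: T_def imp_clause_eq_iff)
  have allW: "fst (s i) \<in> W" if "i \<le> 2 * t" for i
    using that inW[of i] inW[of t] s0 s2 t by (cases "i = 0"; cases "i = 2 * t"; force)
  \<comment> \<open>The positions 0, t and 2t all carry the pivot variable, whose index is
    t.\<close>
  have one: "idx (fst (s i)) = i \<or> (idx (fst (s i)) = t \<and> i \<in> {0, 2 * t})" if "i \<le> 2 * t" for i
    using that idx[of i] idx[of t] s0 s2 t by (cases "i = 0"; cases "i = 2 * t"; force)
  have main: "(\<Sum>b\<in>V. of_bool (imp_clause a b \<in> T) * v b) \<le> (1 + 1 / t) * v a" if fin: "finite V" for V a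
  proof (cases "fst a \<in> W")
    case False
    have "imp_clause a b \<notin> T" for b
      using succ[of a b] allW False by fastforce
    then show ?thesis using v02[of a] by simp
  next
    case True
    define j where "j = idx (fst a)"
    have j: "1 \<le> j" "j < 2 * t" "fst a = fst (s j)" using idxW[OF True] by (auto simp: j_def)
    have bound: "(\<Sum>b\<in>V. of_bool (imp_clause a b \<in> T) * v b) \<le> (\<Sum>b\<in>S. v b)"
      if "finite S" "\<And>b. imp_clause a b \<in> T \<Longrightarrow> b \<in> S" for S
      using v02 fin that by (intro sum_of_bool_mult_le) auto
    have idx_a: "j = i \<or> (j = t \<and> i \<in> {0, 2 * t})" if "fst a = fst (s i)" "i \<le> 2 * t" for i
      using one[OF that(2)] that(1) by (simp add: j_def)
    show ?thesis
    proof (cases "j = t")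
      case False
      note jt = False
      from j(3) consider "a = s j" | "a = neg (s j)" using fst_eq_iff by metis
      then show ?thesis
      proof cases
        case 1
        have "b = s (Suc j)" if b: "imp_clause a b \<in> T" for b
        proof -
          obtain i where "i < 2 * t" "(a = s i \<and> b = s (Suc i)) \<or> (a = neg (s (Suc i)) \<and> b = neg (s i))"
            using succ[OF b] by auto
          then show ?thesis using idx_a[of i] idx_a[of "Suc i"] jt 1 by auto
        qed
        then have "(\<Sum>b\<in>V. of_bool (imp_clause a b \<in> T) * v b) \<le> v (s (Suc j))"
          using bound[of "{s (Suc j)}"] by auto
        also have "\<dots> \<le> (1 + 1 / t) * (1 + h j)"
        proof (cases "Suc j = t \<or> Suc j = 2 * t")
          case True
          then have "v (s (Suc j)) = 2" using v_t v_end by metis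
          moreover have "h j = 1 - 1 / t" using True t by (auto simp: h_def field_simps of_nat_diff)
          moreover have "(1 + 1 / real t) * (2 - 1 / real t) \<ge> 2"
            using t by (simp add: field_simps)
          ultimately show ?thesis by simp
        next
          case False
          then have "v (s (Suc j)) = 1 + h (Suc j)" using j by (intro v_s) auto
          moreover have "h (Suc j) = h j + 1 / t" using jt False j t by (auto simp: h_def field_simps)
          moreover have "1 + (h j + 1 / t) \<le> (1 + 1 / t) * (1 + h j)"
            using h[of j] j by (simp add: algebra_simps divide_right_mono)
          ultimately show ?thesis by simp
        qed
        finally show ?thesis using v_s[of j] j jt 1 by simp
      next
        case 2
        have "b = neg (s (j - 1))" if b: "imp_clause a b \<in> T" for b
        proof -
          obtain i where i: "i < 2 * t" "(a = s i \<and> b = s (Suc i)) \<or> (a = neg (s (Suc i)) \<and> b = neg (s i))"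
            using succ[OF b] by auto
          have "a \<noteq> s i"
          proof
            assume "a = s i"
            with idx_a[of i] i(1) jt have "j = i" by auto
            with \<open>a = s i\<close> 2 show False by simp
          qed
          then show ?thesis using i idx_a[of "Suc i"] jt by auto
        qed
        then have "(\<Sum>b\<in>V. of_bool (imp_clause a b \<in> T) * v b) \<le> v (neg (s (j - 1)))"
          using bound[of "{neg (s (j - 1))}"] by auto
        also have "\<dots> \<le> (1 + 1 / t) * (2 - h j)"
        proof (cases "j - 1 = t \<or> j - 1 = 0")
          case True
          then have "v (neg (s (j - 1))) = 2" using v_t v_end by metis
          moreover have "h j = 1 / t" using True t j by (auto simp: h_def field_simps of_nat_diff)
          moreover have "(1 + 1 / real t) * (2 - 1 / real t) \<ge> 2"
            using t by (simp add: field_simps)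
          ultimately show ?thesis by simp
        next
          case False
          then have "v (neg (s (j - 1))) = 2 - h (j - 1)" using j by (intro v_neg) auto
          moreover have "h (j - 1) = h j - 1 / t" using jt False j t by (auto simp: h_def field_simps of_nat_diff)
          moreover have "2 - (h j - 1 / t) \<le> (1 + 1 / t) * (2 - h j)"
            using h[of j] j mult_right_mono[of "h j" 1 "1 / t"] by (simp add: algebra_simps)
          ultimately show ?thesis by simp
        qed
        finally show ?thesis using v_neg[of j] j jt 2 by simp
      qed
    next
      case True
      from j(3) True consider "a = s t" | "a = neg (s t)" using fst_eq_iff by metis
      then show ?thesis
      proof cases
        case 1
        \<comment> \<open>Two edges leave s(t): the next step of the snake and the contrapositive of
          its last edge. Both lead to the value 1 + 1/t, in total (1 + 1/t) times the value 2 of the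
          pivot.\<close>
        have "b \<in> {s (Suc t), neg (s (2 * t - 1))}" if b: "imp_clause a b \<in> T" for b
        proof -
          obtain i where i: "i < 2 * t" "(a = s i \<and> b = s (Suc i)) \<or> (a = neg (s (Suc i)) \<and> b = neg (s i))"
            using succ[OF b] by auto
          then consider "a = s i" "b = s (Suc i)" | "a = neg (s (Suc i))" "b = neg (s i)" by blast
          then show ?thesis
          proof cases
            case fwd: 1
            then have "i = t \<or> i = 0" using idx_a[of i] True i(1) by auto
            moreover have "i \<noteq> 0"
            proof
              assume "i = 0"
              with fwd(1) \<open>a = s t\<close> s0 show False by (metis neg_neq(1) neg_neg)
            qed
            ultimately show ?thesis using fwd(2) by auto
          next
            case bwd: 2
            then have "Suc i = t \<or> Suc i = 2 * t" using idx_a[of "Suc i"] True i(1) by auto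
            moreover have "Suc i \<noteq> t"
            proof
              assume "Suc i = t"
              with bwd(1) \<open>a = s t\<close> show False by (metis neg_neq(1) neg_neg)
            qed
            ultimately have "i = 2 * t - 1" by auto
            then show ?thesis using bwd(2) by auto
          qed
        qed
        then have "(\<Sum>b\<in>V. of_bool (imp_clause a b \<in> T) * v b) \<le> (\<Sum>b\<in>{s (Suc t), neg (s (2 * t - 1))}. v b)"
          by (intro bound) auto
        also have "\<dots> \<le> v (s (Suc t)) + v (neg (s (2 * t - 1)))"
          using v02 by (cases "s (Suc t) = neg (s (2 * t - 1))") auto
        also have "\<dots> = 2 * (1 + 1 / t)"
        proof -
          have "real (2 * t - 1) = 2 * real t - 1" using t by (simp add: of_nat_diff)
          then have "h (2 * t - 1) = 1 - 1 / t" "h (Suc t) = 1 / t" using t by (auto simp: h_def field_simps)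
          moreover have "v (neg (s (2 * t - 1))) = 2 - h (2 * t - 1)" "v (s (Suc t)) = 1 + h (Suc t)"
            using t by (intro v_neg v_s; simp)+
          ultimately show ?thesis by simp
        qed
        finally show ?thesis using v_t 1 by simp
      next
        case 2
        \<comment> \<open>Symmetrically, \<open>neg (s t)\<close> is the start s(0) of the snake,
          and the second edge is the contrapositive of the one entering s(t).\<close>
        have "b \<in> {s 1, neg (s (t - 1))}" if b: "imp_clause a b \<in> T" for b
        proof -
          obtain i where i: "i < 2 * t" "(a = s i \<and> b = s (Suc i)) \<or> (a = neg (s (Suc i)) \<and> b = neg (s i))"
            using succ[OF b] by auto
          then consider "a = s i" "b = s (Suc i)" | "a = neg (s (Suc i))" "b = neg (s i)" by blast
          then show ?thesis
          proof cases
            case fwd: 1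
            then have "i = t \<or> i = 0" using idx_a[of i] True i(1) by auto
            moreover have "i \<noteq> t"
            proof
              assume "i = t"
              with fwd(1) \<open>a = neg (s t)\<close> show False by (metis neg_neq(1) neg_neg)
            qed
            ultimately show ?thesis using fwd(2) by auto
          next
            case bwd: 2
            then have "Suc i = t \<or> Suc i = 2 * t" using idx_a[of "Suc i"] True i(1) by auto
            moreover have "Suc i \<noteq> 2 * t"
            proof
              assume "Suc i = 2 * t"
              with bwd(1) \<open>a = neg (s t)\<close> s2 show False by (metis neg_neq(1) neg_neg)
            qed
            ultimately have "i = t - 1" by auto
            then show ?thesis using bwd(2) by auto
          qed
        qed
        then have "(\<Sum>b\<in>V. of_bool (imp_clause a b \<in> T) * v b) \<le> (\<Sum>b\<in>{s 1, neg (s (t - 1))}. v b)"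
          by (intro bound) auto
        also have "\<dots> \<le> v (s 1) + v (neg (s (t - 1)))"
          using v02 by (cases "s 1 = neg (s (t - 1))") auto
        also have "\<dots> = 2 * (1 + 1 / t)"
        proof -
          have "real (t - 1) = real t - 1" using t by (simp add: of_nat_diff)
          then have "h (t - 1) = 1 - 1 / t" "h 1 = 1 / t" using t by (auto simp: h_def field_simps)
          moreover have "v (neg (s (t - 1))) = 2 - h (t - 1)" "v (s 1) = 1 + h 1"
            using t by (intro v_neg v_s; simp)+
          ultimately show ?thesis by simp
        qed
        finally show ?thesis using v_t 2 by simp
      qed
    qed
  qed
  have "v a = 0" if "fst a \<notin> W" for a using that by (simp add: v_def)
  with main v02 v1 show ?thesis by (intro exI[of _ v]) blast
qed

section \<open>The first moment of bicycles\<close>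

lemma prod_set_steps:
  assumes "distinct (steps l)"
  shows "(\<Prod>C\<in>set (steps l). f C) = walk_weight (\<lambda>a b. f (imp_clause a b)) l"
  using prod.distinct_set_conv_list[OF assms, of f] by (simp add: prod_list_steps)

text \<open>Union bound over bicycles. Each end has at most 2k choices on the variables of zs and
  contributes one factor u \<le> U. The inner words, freed from distinctness, have total squared
  weight 1, and k + 1 edges give the power of lam. Distinct variables limit k to n.\<close>

lemma unsat_prob_le_sum_bicycles:
  fixes u :: "literal \<Rightarrow> real" and p :: "clause pmf" and n m :: nat and lam U :: real
  defines "V \<equiv> {1..n} \<times> (UNIV :: bool set)"
  assumes supp: "set_pmf p \<subseteq> clauses n"
    and ub: "\<And>a b. real m * pmf p (imp_clause a b) \<le> lam * u a * u b"
    and u: "\<And>a. 0 \<le> u a" "\<And>a. a \<in> V \<Longrightarrow> u a \<le> U" "(\<Sum>z\<in>V. (u z)\<^sup>2) = 1" and lam: "0 \<le> lam"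
  shows "measure_pmf.prob (replicate_pmf m p) {cs. \<not> satisfiable (mset cs)} \<le>
    (\<Sum>k=1..n. lam ^ Suc k * (4 * (real k)\<^sup>2) * U\<^sup>2)"
proof -
  have fin: "finite V" by (simp add: V_def)
  define Y where "Y zs = {y :: literal. fst y \<in> fst ` set zs}" for zs :: "literal list"
  have Y: "finite (Y zs)" "card (Y zs) \<le> 2 * length zs" for zs
  proof -
    have eq: "Y zs = (fst ` set zs) \<times> (UNIV :: bool set)" unfolding Y_def set_eq_iff mem_Times_iff by simp
    then show "finite (Y zs)" by simp
    have "card (fst ` set zs) \<le> length zs"
      by (meson List.finite_set card_image_le card_length order_trans)
    then show "card (Y zs) \<le> 2 * length zs" unfolding eq by (simp add: card_cartesian_product)
  qed
  define I where "I k = {(zs, yv). zs \<in> words V k \<and> yv \<in> Y zs \<times> Y zs \<and> bicycle (fst yv) zs (snd yv)}" for k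
  define ev where "ev = (\<lambda>(zs, yv). {cs. set (steps (fst yv # zs @ [snd yv])) \<subseteq> set cs})"
  have I_sub: "I k \<subseteq> (SIGMA zs:words V k. Y zs \<times> Y zs)" for k by (auto simp: I_def)
  have finS: "finite (SIGMA zs:words V k. Y zs \<times> Y zs)" for k
    using Y finite_words[OF fin] by auto
  have finI: "finite (I k)" for k by (rule finite_subset[OF I_sub finS])
  let ?M = "replicate_pmf m p"
  have one: "measure_pmf.prob ?M (ev i) \<le> lam ^ Suc k * U\<^sup>2 * (\<Prod>z\<leftarrow>fst i. (u z)\<^sup>2)" if i: "i \<in> I k" for i k
  proof -
    obtain zs y v where izs: "i = (zs, y, v)" by (cases i)
    have b: "bicycle y zs v" "zs \<in> words V k" using i by (auto simp: I_def izs)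
    have yv: "y \<in> V" "v \<in> V"
    proof -
      have "fst ` set zs \<subseteq> {1..n}" using b(2) by (auto simp: words_def V_def)
      then show "y \<in> V" "v \<in> V" using b(1) unfolding V_def bicycle_def mem_Times_iff by blast+
    qed
    have "measure_pmf.prob ?M (ev i) = hit p m (set (steps (y # zs @ [v])))"
      by (simp add: ev_def izs hit_def)
    also have "\<dots> \<le> (\<Prod>C\<in>set (steps (y # zs @ [v])). real m * pmf p C)"
      by (rule hit_le) simp
    also have "\<dots> = walk_weight (\<lambda>a b. real m * pmf p (imp_clause a b)) (y # zs @ [v])"
      by (rule prod_set_steps[OF distinct_steps_bicycle[OF b(1)]])
    also have "\<dots> \<le> walk_weight (\<lambda>a b. lam * u a * u b) (y # zs @ [v])"
      using ub by (intro walk_weight_mono) auto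
    also have "\<dots> = lam ^ Suc k * (u y * u v) * (\<Prod>z\<leftarrow>zs. (u z)\<^sup>2)"
      using b by (subst walk_weight_rank_one) (simp add: words_def mult_ac)
    also have "\<dots> \<le> lam ^ Suc k * U\<^sup>2 * (\<Prod>z\<leftarrow>zs. (u z)\<^sup>2)"
      using u yv lam order_trans[OF u(1) u(2)[OF yv(1)]] unfolding power2_eq_square[of U]
      by (intro mult_right_mono mult_left_mono mult_mono prod_list_nonneg) auto
    finally show ?thesis by (simp add: izs)
  qed
  have cover: "measure_pmf.prob ?M {cs. \<not> satisfiable (mset cs)} \<le> measure_pmf.prob ?M (\<Union>k\<in>{1..n}. \<Union>i\<in>I k. ev i)"
  proof (intro measure_pmf.finite_measure_mono_AE AE_pmfI impI)
    fix cs assume cs: "cs \<in> set_pmf ?M" and "cs \<in> {cs. \<not> satisfiable (mset cs)}"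
    then have uns: "\<not> satisfiable (mset cs)" by simp
    have "set cs \<subseteq> clauses n" using cs supp by (auto simp: set_replicate_pmf)
    from unsatisfiable_imp_bicycle[OF uns this] obtain y zs v where
      b: "bicycle y zs v" "set zs \<subseteq> {1..n} \<times> UNIV" "set (steps (y # zs @ [v])) \<subseteq> set cs" by blast
    have "length zs = card (fst ` set zs)"
      using b(1) distinct_card[of "map fst zs"] by (simp add: bicycle_def)
    also have "\<dots> \<le> card {1..n}" using b(2) by (intro card_mono) auto
    finally have "length zs \<in> {1..n}" using b(1) by (cases zs) (auto simp: bicycle_def)
    moreover have "(zs, y, v) \<in> I (length zs)"
      using b by (auto simp: I_def Y_def words_def V_def bicycle_def)
    moreover have "cs \<in> ev (zs, y, v)" using b by (simp add: ev_def)
    ultimately show "cs \<in> (\<Union>k\<in>{1..n}. \<Union>i\<in>I k. ev i)" by blast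
  qed auto
  also have "\<dots> \<le> (\<Sum>k=1..n. measure_pmf.prob ?M (\<Union>i\<in>I k. ev i))"
    by (intro measure_pmf.finite_measure_subadditive_finite) auto
  also have "\<dots> \<le> (\<Sum>k=1..n. lam ^ Suc k * (4 * (real k)\<^sup>2) * U\<^sup>2)"
  proof (intro sum_mono)
    fix k
    have "measure_pmf.prob ?M (\<Union>i\<in>I k. ev i) \<le> (\<Sum>i\<in>I k. measure_pmf.prob ?M (ev i))"
      using finI by (intro measure_pmf.finite_measure_subadditive_finite) auto
    also have "\<dots> \<le> (\<Sum>i\<in>I k. lam ^ Suc k * U\<^sup>2 * (\<Prod>z\<leftarrow>fst i. (u z)\<^sup>2))"
      by (intro sum_mono one)
    also have "\<dots> \<le> (\<Sum>i\<in>(SIGMA zs:words V k. Y zs \<times> Y zs). lam ^ Suc k * U\<^sup>2 * (\<Prod>z\<leftarrow>fst i. (u z)\<^sup>2))"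
      using lam by (intro sum_mono2 finS I_sub) (auto intro!: mult_nonneg_nonneg prod_list_nonneg)
    also have "\<dots> = (\<Sum>zs\<in>words V k. \<Sum>yv\<in>Y zs \<times> Y zs. lam ^ Suc k * U\<^sup>2 * (\<Prod>z\<leftarrow>zs. (u z)\<^sup>2))"
      using Y finite_words[OF fin] by (subst sum.Sigma) (auto simp: split_def)
    also have "\<dots> \<le> (\<Sum>zs\<in>words V k. 4 * (real k)\<^sup>2 * (lam ^ Suc k * U\<^sup>2 * (\<Prod>z\<leftarrow>zs. (u z)\<^sup>2)))"
    proof (intro sum_mono)
      fix zs assume "zs \<in> words V k"
      then have "card (Y zs \<times> Y zs) \<le> (2 * k) * (2 * k)"
        unfolding card_cartesian_product using Y(2)[of zs] by (intro mult_mono) (auto simp: words_def)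
      then have "real (card (Y zs \<times> Y zs)) \<le> 4 * (real k)\<^sup>2"
        by (simp add: power2_eq_square del: of_nat_mult flip: of_nat_mult)
      then have "real (card (Y zs \<times> Y zs)) * (lam ^ Suc k * U\<^sup>2 * (\<Prod>z\<leftarrow>zs. (u z)\<^sup>2)) \<le>
          4 * (real k)\<^sup>2 * (lam ^ Suc k * U\<^sup>2 * (\<Prod>z\<leftarrow>zs. (u z)\<^sup>2))"
        using lam by (intro mult_right_mono) (auto intro!: mult_nonneg_nonneg prod_list_nonneg)
      then show "(\<Sum>yv\<in>Y zs \<times> Y zs. lam ^ Suc k * U\<^sup>2 * (\<Prod>z\<leftarrow>zs. (u z)\<^sup>2)) \<le>
          4 * (real k)\<^sup>2 * (lam ^ Suc k * U\<^sup>2 * (\<Prod>z\<leftarrow>zs. (u z)\<^sup>2))" by simp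
    qed
    also have "\<dots> = 4 * (real k)\<^sup>2 * (lam ^ Suc k * U\<^sup>2) * (\<Sum>zs\<in>words V k. \<Prod>z\<leftarrow>zs. (u z)\<^sup>2)"
      by (simp add: sum_distrib_left mult_ac)
    also have "\<dots> = lam ^ Suc k * (4 * (real k)\<^sup>2) * U\<^sup>2"
      by (simp add: sum_prod_list_words[OF fin] u)
    finally show "measure_pmf.prob ?M (\<Union>i\<in>I k. ev i) \<le> lam ^ Suc k * (4 * (real k)\<^sup>2) * U\<^sup>2" .
  qed
  finally show ?thesis .
qed

section \<open>The second moment of snakes\<close>

definition snake :: "literal \<Rightarrow> literal list \<Rightarrow> literal list \<Rightarrow> literal list" where
  "snake x xs ys = neg x # xs @ x # ys @ [neg x]"

lemma unsatisfiable_if_snake: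
  assumes "set (steps (snake x xs ys)) \<subseteq> set cs"
  shows "\<not> satisfiable (mset cs)"
proof (rule unsatisfiable_if_cycle)
  have "steps (snake x xs ys) = steps ((neg x # xs) @ [x]) @ steps (x # ys @ [neg x])"
    using steps_append[of "neg x # xs" x "ys @ [neg x]"] by (simp add: snake_def)
  with assms have "set (steps ((neg x # xs) @ [x])) \<subseteq> set cs" "set (steps (x # ys @ [neg x])) \<subseteq> set cs"
    by auto
  from this[THEN steps_imp_rtrancl]
  show "(x, neg x) \<in> (imp_graph (set cs))\<^sup>*" "(neg x, x) \<in> (imp_graph (set cs))\<^sup>*" by auto
qed

text \<open>A snake is a bicycle both of whose ends are bent back to the pivot in its
  middle.\<close>

lemma distinct_steps_snake:
  assumes "distinct (map fst (xs @ x # ys))" "xs \<noteq> []"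
  shows "distinct (steps (snake x xs ys))"
proof -
  have "neg x \<noteq> hd xs"
  proof -
    have "fst (hd xs) \<noteq> fst x" using assms by (cases xs) auto
    then show ?thesis by (metis fst_neg)
  qed
  then have "bicycle (neg x) (xs @ x # ys) (neg x)"
    using assms by (auto simp: bicycle_def)
  from distinct_steps_bicycle[OF this] show ?thesis by (simp add: snake_def)
qed

lemma walk_weight_snake:
  "walk_weight g (snake x xs ys) = walk_weight g (neg x # xs @ [x]) * walk_weight g (x # ys @ [neg x])"
  using walk_weight_append[of g "neg x # xs" x "ys @ [neg x]"] by (simp add: snake_def)

text \<open>This is \<open>snake_potential\<close> for t = Suc k: positions 0, t and 2t of the list
  carry \<open>neg x\<close>, x and \<open>neg x\<close>, and the positions strictly between 0 and
  2t carry distinct variables.\<close>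

lemma snake_list_potential:
  assumes dist: "distinct (map fst (xs @ x # ys))" and len: "length xs = k" "length ys = k" "k \<ge> 1"
  shows "\<exists>v :: literal \<Rightarrow> real. (\<forall>a. 0 \<le> v a \<and> v a \<le> 2) \<and> (\<forall>a. fst a \<in> fst ` set (xs @ x # ys) \<longrightarrow> 1 \<le> v a) \<and>
    (\<forall>a. fst a \<notin> fst ` set (xs @ x # ys) \<longrightarrow> v a = 0) \<and>
    (\<forall>V a. finite V \<longrightarrow>
       (\<Sum>b\<in>V. of_bool (imp_clause a b \<in> set (steps (snake x xs ys))) * v b) \<le> (1 + 1 / Suc k) * v a)"
proof -
  define L where "L = snake x xs ys"
  define zs where "zs = xs @ x # ys"
  have L: "L = neg x # zs @ [neg x]" by (simp add: L_def snake_def zs_def)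
  have lzs: "length zs = 2 * Suc k - 1" using len by (simp add: zs_def)
  have Lz: "L ! i = zs ! (i - 1)" if "i \<in> {1..<2 * Suc k}" for i
    using that lzs by (cases i) (auto simp: L nth_append)
  have mid: "L ! Suc k = x" using len by (simp add: L_def snake_def nth_append)
  have inj: "inj_on (\<lambda>i. fst (L ! i)) {1..<2 * Suc k}"
  proof (rule inj_onI)
    fix i j assume ij: "i \<in> {1..<2 * Suc k}" "j \<in> {1..<2 * Suc k}" "fst (L ! i) = fst (L ! j)"
    moreover have "i - 1 < length zs" "j - 1 < length zs" using ij lzs by auto
    ultimately have "map fst zs ! (i - 1) = map fst zs ! (j - 1)" by (simp add: Lz)
    then have "i - 1 = j - 1"
      using ij lzs dist by (subst (asm) nth_eq_iff_index_eq) (auto simp: zs_def)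
    with ij show "i = j" by auto
  qed
  have ends: "L ! 0 = neg (L ! Suc k)" "L ! (2 * Suc k) = neg (L ! Suc k)"
    using mid lzs by (auto simp: L nth_append)
  have W: "(\<lambda>i. fst (L ! i)) ` {1..<2 * Suc k} = fst ` set zs"
  proof -
    have "(\<lambda>i. fst (L ! i)) ` {1..<2 * Suc k} = (\<lambda>i. fst (zs ! (i - 1))) ` {1..<2 * Suc k}"
      by (intro image_cong refl) (simp add: Lz)
    also have "\<dots> = (\<lambda>i. fst (zs ! i)) ` (\<lambda>i. i - 1) ` {1..<2 * Suc k}"
      by (simp add: image_image)
    also have "(\<lambda>i. i - 1) ` {1..<2 * Suc k} = {..<length zs}"
    proof (intro equalityI subsetI)
      fix j assume "j \<in> {..<length zs}"
      then show "j \<in> (\<lambda>i. i - 1) ` {1..<2 * Suc k}" using lzs by (intro image_eqI[of _ _ "Suc j"]) auto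
    qed (use lzs in auto)
    also have "(\<lambda>i. fst (zs ! i)) ` {..<length zs} = fst ` set zs"
      by (auto simp: set_conv_nth)
    finally show ?thesis .
  qed
  have T: "{imp_clause (L ! i) (L ! Suc i) | i. i < 2 * Suc k} = set (steps L)"
  proof -
    have "length (steps L) = 2 * Suc k" "length L = Suc (2 * Suc k)" using lzs by (auto simp: L)
    then show ?thesis unfolding set_conv_nth by (force simp: nth_steps)
  qed
  show ?thesis
    using snake_potential[of "Suc k" "(!) L", OF _ inj ends] len(3)
    unfolding W T unfolding L_def zs_def by auto
qed

lemma sum_words_add:
  "(\<Sum>zs\<in>words V (j + k). f (take j zs) (drop j zs)) = (\<Sum>xs\<in>words V j. \<Sum>ys\<in>words V k. f xs ys)"
proof (induction j arbitrary: f)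
  case (Suc j)
  have "(\<Sum>zs\<in>words V (Suc j + k). f (take (Suc j) zs) (drop (Suc j) zs)) =
     (\<Sum>c\<in>V. \<Sum>zs\<in>words V (j + k). f (c # take j zs) (drop j zs))"
    by (simp add: sum_words_Suc)
  also have "\<dots> = (\<Sum>c\<in>V. \<Sum>xs\<in>words V j. \<Sum>ys\<in>words V k. f (c # xs) ys)"
    by (intro sum.cong refl Suc.IH[of "\<lambda>xs ys. f (_ # xs) ys"])
  finally show ?case by (simp add: sum_words_Suc)
qed auto

text \<open>Expected number of snakes, given that the clauses of the snake \<open>(x, xs, ys)\<close> are present,
  relaxed to a sum over all closed walks through a pair of complementary literals.\<close>

lemma snake_correlation_le:
  fixes u :: "literal \<Rightarrow> real" and lam gam mu U :: real
  assumes V: "finite V" "\<And>a. a \<in> V \<Longrightarrow> neg a \<in> V"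
    and u: "\<And>a. 0 \<le> u a" "\<And>a. a \<in> V \<Longrightarrow> u a \<le> U" "(\<Sum>z\<in>V. (u z)\<^sup>2) = 1" "\<And>a. u (neg a) = u a"
    and lam: "lam = 1 + 2 * gam" "0 < gam" and k: "k \<ge> 1" "1 / Suc k \<le> gam" and U: "0 \<le> U"
    and dist: "distinct (map fst (xs @ x # ys))" and len: "length xs = k" "length ys = k"
    and mu: "mu = lam * (1 + 16 * Suc k * U\<^sup>2 / gam)"
  defines "J \<equiv> \<lambda>a b. of_bool (imp_clause a b \<in> set (steps (snake x xs ys))) :: real"
  defines "g \<equiv> \<lambda>a b. lam * u a * u b + J a b"
  shows "(\<Sum>z\<in>V. walk_sum g V k (neg z) z * walk_sum g V k z (neg z)) \<le>
    mu ^ (2 * Suc k) * (\<Sum>z\<in>V. (u z) ^ 4) +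
    4 * Suc k * (mu ^ Suc k * U\<^sup>2 * (1 + 4 / gam) * (1 + 8 * lam * Suc k / gam) + 6)\<^sup>2"
proof -
  define t where "t = Suc k"
  define Ws where "Ws = fst ` set (xs @ x # ys)"
  define W where "W = {a :: literal. fst a \<in> Ws}"
  define rho where "rho = 1 + 1 / real t"
  \<comment> \<open>These values meet the conditions of \<open>walk_sum_perturbed_le\<close>: s and
    kap because rho \<le> 2 and mu - rho \<ge> gam, and eta because at most 4t literals carry
    variables of the snake, each with u \<le> U and v \<le> 2. The rate mu is then lam (1 + s
    eta).\<close>
  define s where "s = 2 * U / gam"
  define eta where "eta = 8 * t * U"
  define kap where "kap = lam * eta / gam"
  have t: "t \<ge> 2" using k by (simp add: t_def)
  from snake_list_potential[OF dist len k(1)] obtain v :: "literal \<Rightarrow> real"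
    where v0: "\<forall>a. 0 \<le> v a \<and> v a \<le> 2" "\<forall>a. fst a \<in> Ws \<longrightarrow> 1 \<le> v a" "\<forall>a. fst a \<notin> Ws \<longrightarrow> v a = 0"
      "\<forall>V a. finite V \<longrightarrow> (\<Sum>b\<in>V. J a b * v b) \<le> (1 + 1 / Suc k) * v a"
    unfolding Ws_def J_def by blast
  have v: "0 \<le> v a" "v a \<le> 2" "a \<in> W \<Longrightarrow> 1 \<le> v a" "a \<notin> W \<Longrightarrow> v a = 0"
      "(\<Sum>b\<in>V. J a b * v b) \<le> rho * v a" for a
    using v0 V(1) unfolding W_def rho_def t_def mem_Collect_eq by blast+
  have lam1: "1 \<le> lam" using lam by simp
  have nn: "0 \<le> s" "0 \<le> eta" "0 \<le> kap" using U lam lam1 by (auto simp: s_def eta_def kap_def)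
  \<comment> \<open>Since rho exceeds 1 by 1/t \<le> gam while lam = 1 + 2 gam, a gap of at least
    gam remains between rho and mu.\<close>
  have rho: "1 \<le> rho" "rho \<le> 2" "rho \<le> 1 + gam"
    using t k by (auto simp: rho_def t_def)
  have mu_eq: "mu = lam * (1 + s * eta)"
    by (simp add: mu s_def eta_def t_def power2_eq_square)
  have mu_lam: "lam \<le> mu" using lam1 nn unfolding mu_eq
    by (metis le_add_same_cancel1 mult.right_neutral mult_left_mono mult_nonneg_nonneg order_trans zero_le_one)
  have mu_rho: "gam \<le> mu - rho" using mu_lam rho lam by simp
  have mu1: "1 \<le> mu" using mu_lam lam1 by simp
  have cardW: "finite (V \<inter> W)" "card (V \<inter> W) \<le> 4 * t"
  proof -
    have "card Ws \<le> length (xs @ x # ys)"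
      unfolding Ws_def by (metis card_length length_map set_map)
    then have "card (Ws \<times> (UNIV :: bool set)) \<le> 4 * t"
      using len by (simp add: card_cartesian_product t_def)
    moreover have "finite (Ws \<times> (UNIV :: bool set))" by (simp add: Ws_def)
    moreover have "V \<inter> W \<subseteq> Ws \<times> UNIV" by (auto simp: W_def)
    ultimately show "card (V \<inter> W) \<le> 4 * t" by (meson card_mono order_trans)
    show "finite (V \<inter> W)" using V by auto
  qed
  have uv: "(\<Sum>z\<in>V. u z * v z) \<le> eta"
  proof -
    have "(\<Sum>z\<in>V. u z * v z) = (\<Sum>z\<in>V \<inter> W. u z * v z)"
      using V v by (intro sum.mono_neutral_right) auto
    also have "\<dots> \<le> real (card (V \<inter> W)) * (U * 2)"
      using u v U by (intro sum_bounded_above mult_mono) auto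
    also have "\<dots> \<le> real (4 * t) * (U * 2)"
      using cardW U by (intro mult_right_mono) auto
    finally show ?thesis by (simp add: eta_def)
  qed
  have J_W: "a \<in> W \<and> b \<in> W" if "J a b \<noteq> 0" for a b
  proof -
    have "imp_clause a b \<in> set (steps (snake x xs ys))" using that by (auto simp: J_def)
    then obtain c d where "c \<in> set (snake x xs ys)" "d \<in> set (snake x xs ys)" "imp_clause a b = imp_clause c d"
      using in_set_steps by blast
    moreover have "\<forall>l\<in>set (snake x xs ys). fst l \<in> Ws"
      by (auto simp: snake_def Ws_def)
    ultimately have "fst c \<in> Ws" "fst d \<in> Ws" "imp_clause a b = imp_clause c d" by blast+
    then show ?thesis by (auto simp: imp_clause_eq_iff W_def)
  qed
  have bound: "walk_sum g V k a b \<le> mu ^ Suc k * (u a + s * v a) * u b +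
     (if b \<in> W then rho ^ k * v a + kap * (mu ^ k - rho ^ k) * (u a + s * v a) else 0)" if "b \<in> V" for a b
    unfolding g_def
  proof (rule walk_sum_perturbed_le[where U = U and eta = eta, OF V(1) u(1,3,2) _ J_W _ v(1,3,5) uv])
    have "U * rho \<le> U * 2" using rho U by (intro mult_left_mono) auto
    also have "\<dots> = s * gam" using lam by (simp add: s_def)
    also have "\<dots> \<le> s * (mu - rho)" using mu_rho nn by (intro mult_left_mono) auto
    finally show "U * rho \<le> s * (mu - rho)" .
    have "lam * eta = kap * gam" using lam by (simp add: kap_def)
    also have "\<dots> \<le> kap * (mu - rho)" using mu_rho nn by (intro mult_left_mono) auto
    finally show "lam * eta \<le> kap * (mu - rho)" .
  qed (use that rho lam mu_eq mu_rho nn U in \<open>auto simp: J_def\<close>)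
  define B where "B = mu ^ t * U\<^sup>2 * (1 + 4 / gam) * (1 + 8 * lam * t / gam) + 6"
  have g0: "0 \<le> g a b" for a b using u lam1 by (auto simp: g_def J_def)
  \<comment> \<open>Away from the variables of the given snake the potential vanishes, and only the
    rank one part remains.\<close>
  have out: "walk_sum g V k a b \<le> mu ^ t * (u b)\<^sup>2" if "b \<in> V" "b \<notin> W" "a = neg b" for a b
  proof -
    have "a \<notin> W" using that by (simp add: W_def)
    with bound[of b a] that v u show ?thesis by (simp add: t_def power2_eq_square)
  qed
  have inn: "walk_sum g V k a b \<le> B" if "a \<in> V" "b \<in> V" for a b
  proof -
    have w: "0 \<le> u a + s * v a" "u a + s * v a \<le> U * (1 + 4 / gam)"
    proof -
      have "s * v a \<le> s * 2" using v nn by (intro mult_left_mono) auto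
      then show "u a + s * v a \<le> U * (1 + 4 / gam)" using u(2)[OF that(1)] by (simp add: s_def algebra_simps)
      show "0 \<le> u a + s * v a" using u v nn by simp
    qed
    \<comment> \<open>The power (1 + 1/t)^k stays below e \<le> 3, so the perturbation by itself
      contributes only the constant 3 * 2.\<close>
    have rk: "rho ^ k * v a \<le> 6"
    proof -
      have "rho ^ k \<le> exp (1 / t) ^ k" using rho unfolding rho_def by (intro power_mono) auto
      also have "\<dots> = exp (k / t)" by (simp add: exp_of_nat_mult[symmetric])
      also have "\<dots> \<le> exp 1" by (simp add: t_def)
      also have "\<dots> \<le> 3" by (rule exp_le)
      finally show ?thesis using v[of a] mult_mono[of "rho ^ k" 3 "v a" 2] by simp
    qed
    have "walk_sum g V k a b \<le> mu ^ Suc k * (u a + s * v a) * u b + (rho ^ k * v a + kap * mu ^ Suc k * (u a + s * v a))"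
    proof -
      have "mu ^ k - rho ^ k \<le> mu ^ Suc k"
      proof -
        have "mu ^ k \<le> mu ^ Suc k" using mu1 by (intro power_increasing) auto
        moreover have "0 \<le> rho ^ k" using rho by simp
        ultimately show ?thesis by linarith
      qed
      then have "kap * (mu ^ k - rho ^ k) * (u a + s * v a) \<le> kap * mu ^ Suc k * (u a + s * v a)"
        using nn w by (intro mult_right_mono mult_left_mono) auto
      moreover have "0 \<le> rho ^ k * v a" "0 \<le> kap * mu ^ Suc k * (u a + s * v a)"
        using rho v nn w mu1 by auto
      ultimately show ?thesis using bound[OF that(2), of a] by (auto split: if_splits)
    qed
    also have "\<dots> = mu ^ t * ((u a + s * v a) * (u b + kap)) + rho ^ k * v a"
      by (simp add: t_def algebra_simps)
    also have "\<dots> \<le> mu ^ t * ((U * (1 + 4 / gam)) * (U + kap)) + 6"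
      using w rk u that nn mu1 U lam by (intro add_mono mult_left_mono mult_mono) auto
    also have "U + kap = U * (1 + 8 * lam * t / gam)" by (simp add: kap_def eta_def algebra_simps)
    finally show ?thesis by (simp add: B_def power2_eq_square mult_ac)
  qed
  have B0: "0 \<le> B" using mu1 lam lam1 by (simp add: B_def)
  have "(\<Sum>z\<in>V. walk_sum g V k (neg z) z * walk_sum g V k z (neg z)) \<le>
     (\<Sum>z\<in>V. mu ^ (2 * t) * (u z) ^ 4 + (if z \<in> W then B\<^sup>2 else 0))"
  proof (intro sum_mono)
    fix z assume z: "z \<in> V"
    have ws0: "0 \<le> walk_sum g V k a b" for a b using g0 by (rule walk_sum_nonneg)
    show "walk_sum g V k (neg z) z * walk_sum g V k z (neg z) \<le> mu ^ (2 * t) * (u z) ^ 4 + (if z \<in> W then B\<^sup>2 else 0)"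
    proof (cases "z \<in> W")
      case True
      have "walk_sum g V k (neg z) z * walk_sum g V k z (neg z) \<le> B * B"
        using z V inn ws0 B0 by (intro mult_mono) auto
      moreover have "0 \<le> mu ^ (2 * t) * (u z) ^ 4" using mu1 by simp
      ultimately show ?thesis unfolding power2_eq_square if_P[OF True] by linarith
    next
      case False
      have "walk_sum g V k (neg z) z * walk_sum g V k z (neg z) \<le> (mu ^ t * (u z)\<^sup>2) * (mu ^ t * (u z)\<^sup>2)"
      proof (intro mult_mono)
        show "walk_sum g V k z (neg z) \<le> mu ^ t * (u z)\<^sup>2"
          using out[of "neg z" z] False z V u by (simp add: W_def)
      qed (use out[of z "neg z"] z False ws0 mu1 in auto)
      also have "\<dots> = mu ^ (2 * t) * (u z) ^ 4" by (simp add: mult_2 power_add eval_nat_numeral)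
      finally show ?thesis using False by simp
    qed
  qed
  also have "\<dots> = mu ^ (2 * t) * (\<Sum>z\<in>V. (u z) ^ 4) + card (V \<inter> W) * B\<^sup>2"
    using V by (simp add: sum.distrib sum_distrib_left sum.inter_restrict[symmetric])
  also have "\<dots> \<le> mu ^ (2 * t) * (\<Sum>z\<in>V. (u z) ^ 4) + real (4 * t) * B\<^sup>2"
    using cardW by (intro add_left_mono mult_right_mono) auto
  finally show ?thesis by (simp add: t_def B_def)
qed

section \<open>Lower bound for the probability of unsatisfiability\<close>

lemma walk_weight_cong:
  "successively (\<lambda>a b. g a b = h a b) l \<Longrightarrow> walk_weight g l = walk_weight h l"
  by (induction g l rule: walk_weight.induct) auto

lemma successively_distinct_vars:
  assumes "distinct (map fst l)"
  shows "successively (\<lambda>a b. fst a \<noteq> fst b) l"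
  using assms by (induction l rule: induct_list012) auto

text \<open>Only edges between distinct variables have the exact rate assumed in
  \<open>unsat_prob_ge\<close>; next to the pivot this needs both halves to be nonempty.\<close>

lemma successively_snake:
  assumes "distinct (map fst (xs @ x # ys))" "xs \<noteq> []" "ys \<noteq> []"
  shows "successively (\<lambda>a b. fst a \<noteq> fst b) (snake x xs ys)"
proof -
  have "successively (\<lambda>a b. fst a \<noteq> fst b) (xs @ x # ys)"
    by (rule successively_distinct_vars[OF assms(1)])
  moreover have "fst x \<noteq> fst (hd xs)" "fst (last ys) \<noteq> fst x"
  proof -
    have "fst x \<notin> fst ` set xs" "fst x \<notin> fst ` set ys" using assms(1) by simp_all
    moreover have "hd xs \<in> set xs" "last ys \<in> set ys" using assms(2,3) by simp_all
    ultimately show "fst x \<noteq> fst (hd xs)" "fst (last ys) \<noteq> fst x" by (metis image_eqI)+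
  qed
  ultimately show ?thesis
    using assms(2,3) by (simp add: snake_def successively_append_iff successively_Cons)
qed

text \<open>With W = lam^(2t) S4, the expected number of snakes is at least d1 d2 d3 W. The joint
  probabilities of pairs sum to at most W G, as G bounds the correlation sum of every fixed snake.
  Then \<open>second_moment_count\<close> gives (d1 d2 d3 W)^2 \<le> W G P, and one factor W
  cancels.\<close>

lemma unsat_prob_ge:
  fixes u :: "literal \<Rightarrow> real" and p :: "clause pmf" and m k :: nat and lam gam mu U :: real
  assumes V: "finite V" "\<And>a. a \<in> V \<Longrightarrow> neg a \<in> V"
    and u: "\<And>a. 0 \<le> u a" "\<And>a. a \<in> V \<Longrightarrow> u a \<le> U" "(\<Sum>z\<in>V. (u z)\<^sup>2) = 1" "\<And>a. u (neg a) = u a"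
    and lam: "lam = 1 + 2 * gam" "0 < gam" and k: "k \<ge> 1" "1 / Suc k \<le> gam" and U: "0 \<le> U"
    and eq: "\<And>a b. a \<in> V \<Longrightarrow> b \<in> V \<Longrightarrow> fst a \<noteq> fst b \<Longrightarrow> real m * pmf p (imp_clause a b) = lam * u a * u b"
    and ub: "\<And>a b. real m * pmf p (imp_clause a b) \<le> lam * u a * u b"
    and mu: "mu = lam * (1 + 16 * Suc k * U\<^sup>2 / gam)"
    and small: "2 * Suc k \<le> m" "(2 * real (Suc k))\<^sup>2 \<le> m" "2 * Suc k * lam * U\<^sup>2 \<le> 1" "4 * Suc k * U\<^sup>2 \<le> 1"
  shows "((1 - (2 * real (Suc k))\<^sup>2 / m) * (1 - 2 * Suc k * lam * U\<^sup>2) * (1 - 4 * Suc k * U\<^sup>2) ^ (2 * k))\<^sup>2 *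
      (lam ^ (2 * Suc k) * (\<Sum>z\<in>V. (u z) ^ 4)) \<le>
    (mu ^ (2 * Suc k) * (\<Sum>z\<in>V. (u z) ^ 4) +
      4 * Suc k * (mu ^ Suc k * U\<^sup>2 * (1 + 4 / gam) * (1 + 8 * lam * Suc k / gam) + 6)\<^sup>2) *
    measure_pmf.prob (replicate_pmf m p) {cs. \<not> satisfiable (mset cs)}"
proof -
  define t where "t = Suc k"
  define S4 where "S4 = (\<Sum>z\<in>V. (u z) ^ 4)"
  \<comment> \<open>Losses in the lower bound: d1 for the falling factorial of m, d2 for the last
    factor in \<open>hit_ge\<close>, d3 for the words excluded by the distinctness of
    variables.\<close>
  define d1 where "d1 = 1 - (2 * real t)\<^sup>2 / m"
  define d2 where "d2 = 1 - 2 * t * lam * U\<^sup>2"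
  define d3 where "d3 = (1 - 4 * t * U\<^sup>2) ^ (2 * k)"
  define G where "G = mu ^ (2 * t) * S4 + 4 * t * (mu ^ t * U\<^sup>2 * (1 + 4 / gam) * (1 + 8 * lam * t / gam) + 6)\<^sup>2"
  define h where "h C = real m * pmf p C" for C
  define r where "r a b = lam * u a * u b" for a b
  define D where "D x = {zs. zs \<in> words V (k + k) \<and> distinct (map fst zs) \<and> (\<forall>z\<in>set zs. fst z \<notin> {fst x})}" for x :: literal
  define I where "I = (SIGMA x:V. D x)"
  define L where "L = (\<lambda>(x, zs). snake x (take k zs) (drop k zs))"
  define T where "T i = set (steps (L i))" for i
  define wt where "wt i = walk_weight r (L i)" for i
  define E where "E i = {cs. T i \<subseteq> set cs}" for i
  let ?M = "replicate_pmf m p"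
  have m0: "0 < m" using small by simp
  have lam1: "1 \<le> lam" using lam by simp
  have d0: "0 \<le> d1" "0 \<le> d2" "0 \<le> d3"
    using small m0 by (auto simp: d1_def d2_def d3_def t_def field_simps)
  have r0: "0 \<le> r a b" for a b using u lam1 by (simp add: r_def)
  have finD: "finite (D x)" for x
    by (rule finite_subset[OF _ finite_words[OF V(1), of "k + k"]]) (auto simp: D_def)
  have finI: "finite I" unfolding I_def using V finD by auto
  \<comment> \<open>The pivot x is passed once and \<open>neg x\<close> forms both ends, hence the
    fourth power.\<close>
  have wt_eq: "wt (x, zs) = lam ^ (2 * t) * (u x) ^ 4 * (\<Prod>z\<leftarrow>zs. (u z)\<^sup>2)" if "zs \<in> words V (k + k)" for x zs
  proof -
    have "(\<Prod>z\<leftarrow>zs. (u z)\<^sup>2) = (\<Prod>z\<leftarrow>take k zs @ drop k zs. (u z)\<^sup>2)" by simp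
    also have "\<dots> = (\<Prod>z\<leftarrow>take k zs. (u z)\<^sup>2) * (\<Prod>z\<leftarrow>drop k zs. (u z)\<^sup>2)"
      unfolding map_append prod_list.append ..
    finally show ?thesis using that u(4)
      by (simp add: wt_def L_def walk_weight_snake r_def[abs_def] walk_weight_rank_one words_def t_def
          power_add mult_2 eval_nat_numeral)
  qed
  have wt0: "0 \<le> wt i" for i unfolding wt_def by (rule walk_weight_nonneg) (rule r0)
  have memI: "x \<in> V" "zs \<in> words V (k + k)" "length (take k zs) = k" "length (drop k zs) = k"
      "distinct (map fst (take k zs @ x # drop k zs))" "set (L (x, zs)) \<subseteq> V" if "(x, zs) \<in> I" for x zs
  proof -
    show *: "x \<in> V" "zs \<in> words V (k + k)" "length (take k zs) = k" "length (drop k zs) = k"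
      using that by (auto simp: I_def D_def words_def)
    have "distinct (map fst (take k zs @ drop k zs))" "fst x \<notin> set (map fst (take k zs @ drop k zs))"
      using that by (auto simp: I_def D_def)
    then show "distinct (map fst (take k zs @ x # drop k zs))" unfolding map_append set_append by auto
    show "set (L (x, zs)) \<subseteq> V"
      using * V(2) by (auto simp: L_def snake_def words_def dest: in_set_takeD in_set_dropD)
  qed
  have dist: "distinct (steps (L i))" and prodT: "(\<Prod>C\<in>T i. h C) = wt i" and cardT: "card (T i) = 2 * t"
    and inV: "set (L i) \<subseteq> V" if "i \<in> I" for i
  proof -
    obtain x zs where i: "i = (x, zs)" by (cases i)
    note mi = memI[OF that[unfolded i]]
    have ne: "take k zs \<noteq> []" "drop k zs \<noteq> []" using mi(3,4) k(1) by force+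
    show dist: "distinct (steps (L i))"
      using distinct_steps_snake[OF mi(5) ne(1)] by (simp add: L_def i)
    show inV: "set (L i) \<subseteq> V" using mi(6) i by simp
    have "successively (\<lambda>a b. fst a \<noteq> fst b) (L i)"
      using successively_snake[OF mi(5) ne] by (simp add: L_def i)
    then have "successively (\<lambda>a b. h (imp_clause a b) = r a b) (L i)"
      by (rule successively_mono) (use eq inV in \<open>unfold h_def r_def, blast\<close>)
    then show "(\<Prod>C\<in>T i. h C) = wt i"
      unfolding T_def prod_set_steps[OF dist] wt_def by (rule walk_weight_cong)
    show "card (T i) = 2 * t"
      unfolding T_def distinct_card[OF dist] using mi(3,4) by (simp add: L_def i snake_def t_def)
  qed
  have finT: "finite (T i)" for i by (simp add: T_def)
  have lower: "d1 * d2 * wt i \<le> measure_pmf.prob ?M (E i)" if i: "i \<in> I" for i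
  proof -
    have "real m * sum (pmf p) (T i) = (\<Sum>C\<in>T i. h C)" by (simp add: h_def sum_distrib_left)
    also have "\<dots> \<le> real (card (T i)) * (lam * (U * U))"
    proof (rule sum_bounded_above)
      fix C assume "C \<in> T i"
      then obtain a b where ab: "a \<in> set (L i)" "b \<in> set (L i)" "C = imp_clause a b"
        using in_set_steps unfolding T_def by blast
      then have "a \<in> V" "b \<in> V" using inV[OF i] by auto
      then have "lam * (u a * u b) \<le> lam * (U * U)"
        using u lam1 U by (intro mult_left_mono mult_mono) auto
      then show "h C \<le> lam * (U * U)" using ub[of a b] ab by (simp add: h_def)
    qed
    also have "\<dots> = 2 * t * lam * U\<^sup>2" unfolding cardT[OF i] by (simp add: power2_eq_square)
    finally have q: "d2 \<le> 1 - real m * sum (pmf p) (T i)" by (simp add: d2_def)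
    have f: "real m ^ (2 * t) * d1 \<le> fact (2 * t) * real (m choose (2 * t))"
      using fact_mult_binomial_ge[of "2 * t" m] small by (simp add: d1_def t_def)
    have "d1 * d2 * wt i = real m ^ (2 * t) * d1 * (\<Prod>C\<in>T i. pmf p C) * d2"
      unfolding prodT[OF i, symmetric] using cardT[OF i] by (simp add: h_def prod.distrib)
    also have "\<dots> \<le> fact (2 * t) * real (m choose (2 * t)) * (\<Prod>C\<in>T i. pmf p C) * (1 - real m * sum (pmf p) (T i))"
      using q d0 by (intro mult_mono[OF mult_right_mono[OF f]] mult_nonneg_nonneg prod_nonneg) auto
    also have "\<dots> \<le> hit p m (T i)"
      using hit_ge[OF finT, of i m p] cardT[OF i] by simp
    finally show ?thesis by (simp add: hit_def E_def)
  qed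
  \<comment> \<open>Clauses shared with snake i cost a factor 1, all others their rate. Adding the
    indicator to the rate dominates both cases and yields the kernel of
    \<open>snake_correlation_le\<close>.\<close>
  have upper: "measure_pmf.prob ?M (E i \<inter> E j) \<le> wt i * walk_weight (\<lambda>a b. lam * u a * u b + of_bool (imp_clause a b \<in> T i)) (L j)"
    if ij: "i \<in> I" "j \<in> I" for i j
  proof -
    have "E i \<inter> E j = {cs. T i \<union> T j \<subseteq> set cs}" by (auto simp: E_def)
    then have "measure_pmf.prob ?M (E i \<inter> E j) = hit p m (T i \<union> T j)" by (simp add: hit_def)
    also have "\<dots> \<le> (\<Prod>C\<in>T i \<union> T j. h C)" unfolding h_def by (rule hit_le) (simp add: T_def)
    also have "T i \<union> T j = T i \<union> (T j - T i)" by auto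
    also have "(\<Prod>C\<in>\<dots>. h C) = wt i * (\<Prod>C\<in>T j - T i. h C)"
      unfolding prodT[OF ij(1), symmetric] by (rule prod.union_disjoint) (auto simp: T_def)
    also have "(\<Prod>C\<in>T j - T i. h C) = (\<Prod>C\<in>T j. if C \<in> T i then 1 else h C)"
      using finT by (intro prod.mono_neutral_cong_left) auto
    also have "\<dots> = walk_weight (\<lambda>a b. if imp_clause a b \<in> T i then 1 else h (imp_clause a b)) (L j)"
      unfolding T_def[of j] by (rule prod_set_steps[OF dist[OF ij(2)]])
    also have "\<dots> \<le> walk_weight (\<lambda>a b. lam * u a * u b + of_bool (imp_clause a b \<in> T i)) (L j)"
      using ub r0 by (intro walk_weight_mono) (auto simp: h_def r_def)
    finally show ?thesis using wt0 by (simp add: mult_left_mono)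
  qed
  have corr: "(\<Sum>j\<in>I. walk_weight (\<lambda>a b. lam * u a * u b + of_bool (imp_clause a b \<in> T i)) (L j)) \<le> G" if i: "i \<in> I" for i
  proof -
    obtain x zs where ixz: "i = (x, zs)" by (cases i)
    note mi = memI[OF i[unfolded ixz]]
    define g where "g a b = lam * u a * u b + of_bool (imp_clause a b \<in> T i)" for a b
    have g0: "0 \<le> g a b" for a b using r0[of a b] by (simp add: g_def r_def)
    \<comment> \<open>Without the distinctness of variables the sum over the two halves factors into
      walk sums.\<close>
    have "(\<Sum>j\<in>I. walk_weight g (L j)) \<le> (\<Sum>j\<in>V \<times> words V (k + k). walk_weight g (L j))"
      using V finite_words[OF V(1)] g0 by (intro sum_mono2) (auto simp: I_def D_def intro!: walk_weight_nonneg)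
    also have "\<dots> = (\<Sum>z\<in>V. \<Sum>zs\<in>words V (k + k). walk_weight g (snake z (take k zs) (drop k zs)))"
      by (simp add: sum.cartesian_product L_def split_def)
    also have "\<dots> = (\<Sum>z\<in>V. walk_sum g V k (neg z) z * walk_sum g V k z (neg z))"
    proof (intro sum.cong refl)
      fix z
      have "(\<Sum>zs\<in>words V (k + k). walk_weight g (snake z (take k zs) (drop k zs))) =
         (\<Sum>xs\<in>words V k. \<Sum>ys\<in>words V k. walk_weight g (neg z # xs @ [z]) * walk_weight g (z # ys @ [neg z]))"
        unfolding walk_weight_snake by (rule sum_words_add[where f="\<lambda>xs ys. walk_weight g (neg z # xs @ [z]) * walk_weight g (z # ys @ [neg z])"])
      also have "\<dots> = (\<Sum>xs\<in>words V k. walk_weight g (neg z # xs @ [z])) * (\<Sum>ys\<in>words V k. walk_weight g (z # ys @ [neg z]))"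
        by (simp add: sum_product)
      finally show "(\<Sum>zs\<in>words V (k + k). walk_weight g (snake z (take k zs) (drop k zs))) =
         walk_sum g V k (neg z) z * walk_sum g V k z (neg z)"
        unfolding sum_walk_weight .
    qed
    also have "\<dots> \<le> G"
    proof -
      have "T i = set (steps (snake x (take k zs) (drop k zs)))" by (simp add: T_def L_def ixz)
      then show ?thesis
        using snake_correlation_le[OF V u lam k U mi(5,3,4) mu]
        unfolding g_def[abs_def] G_def S4_def t_def by simp
    qed
    finally show ?thesis unfolding g_def[abs_def] .
  qed
  define W where "W = lam ^ (2 * t) * S4"
  have sumI: "(\<Sum>i\<in>I. wt i) = (\<Sum>x\<in>V. \<Sum>zs\<in>D x. wt (x, zs))"
    unfolding I_def using V finD by (subst sum.Sigma) (auto simp: split_def)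
  have sumI': "(\<Sum>i\<in>I. wt i) = (\<Sum>x\<in>V. lam ^ (2 * t) * (u x) ^ 4 * (\<Sum>zs\<in>D x. \<Prod>z\<leftarrow>zs. (u z)\<^sup>2))"
    unfolding sumI by (auto simp: sum_distrib_left D_def wt_eq intro!: sum.cong)
  have W_up: "(\<Sum>i\<in>I. wt i) \<le> W"
  proof -
    have "(\<Sum>zs\<in>D x. \<Prod>z\<leftarrow>zs. (u z)\<^sup>2) \<le> (\<Sum>zs\<in>words V (k + k). \<Prod>z\<leftarrow>zs. (u z)\<^sup>2)" for x
      using finite_words[OF V(1)] by (intro sum_mono2) (auto simp: D_def intro!: prod_list_nonneg)
    then have "(\<Sum>zs\<in>D x. \<Prod>z\<leftarrow>zs. (u z)\<^sup>2) \<le> 1" for x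
      unfolding sum_prod_list_words[OF V(1)] u by simp
    then have "(\<Sum>i\<in>I. wt i) \<le> (\<Sum>x\<in>V. lam ^ (2 * t) * (u x) ^ 4 * 1)"
      unfolding sumI' using lam1 by (intro sum_mono mult_left_mono) auto
    then show ?thesis by (simp add: W_def S4_def sum_distrib_left)
  qed
  have W_low: "d3 * W \<le> (\<Sum>i\<in>I. wt i)"
  proof -
    have "d3 \<le> (\<Sum>zs\<in>D x. \<Prod>z\<leftarrow>zs. (u z)\<^sup>2)" for x
    proof -
      have c: "real (card {fst x} + (k + k)) \<le> 2 * t" by (simp add: t_def)
      have le: "2 * U\<^sup>2 * (card {fst x} + (k + k)) \<le> 4 * t * U\<^sup>2"
        using mult_left_mono[OF c, of "2 * U\<^sup>2"] by (simp add: mult_ac)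
      have s4: "4 * t * U\<^sup>2 \<le> 1" using small by (simp add: t_def)
      have "d3 \<le> (1 - 2 * U\<^sup>2 * (card {fst x} + (k + k))) ^ (k + k)"
        unfolding d3_def mult_2 using le s4 by (intro power_mono) auto
      also have "\<dots> \<le> (\<Sum>zs\<in>D x. \<Prod>z\<leftarrow>zs. (u z)\<^sup>2)"
        unfolding D_def
      proof (rule sum_prod_list_distinct_words[OF V(1) u(3)])
        show "(u z)\<^sup>2 \<le> U\<^sup>2" if "z \<in> V" for z using u that by (intro power_mono) auto
      qed (use le s4 in auto)
      finally show ?thesis .
    qed
    then have "(\<Sum>x\<in>V. lam ^ (2 * t) * (u x) ^ 4 * d3) \<le> (\<Sum>i\<in>I. wt i)"
      unfolding sumI' using lam1 by (intro sum_mono mult_left_mono) auto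
    then show ?thesis by (simp add: W_def S4_def sum_distrib_left sum_distrib_right mult_ac)
  qed
  have Wpos: "0 < W"
  proof -
    have "S4 \<noteq> 0"
    proof
      assume "S4 = 0"
      then have "\<forall>z\<in>V. u z ^ 4 = 0" unfolding S4_def using V by (subst (asm) sum_nonneg_eq_0_iff) auto
      then have "(\<Sum>z\<in>V. (u z)\<^sup>2) = 0" by simp
      with u show False by simp
    qed
    moreover have "0 \<le> S4" unfolding S4_def by (intro sum_nonneg) auto
    ultimately show ?thesis using lam1 by (simp add: W_def)
  qed
  have G0: "0 \<le> G"
  proof -
    have "0 \<le> mu" using lam1 lam by (simp add: mu)
    then show ?thesis unfolding G_def S4_def by (intro add_nonneg_nonneg mult_nonneg_nonneg sum_nonneg) auto
  qed
  define P where "P = measure_pmf.prob ?M {cs. \<not> satisfiable (mset cs)}"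
  have "(d1 * d2 * d3 * W)\<^sup>2 \<le> (\<Sum>i\<in>I. measure_pmf.prob ?M (E i))\<^sup>2"
  proof (rule power_mono)
    have "d1 * d2 * d3 * W \<le> d1 * d2 * (\<Sum>i\<in>I. wt i)"
      using W_low d0 mult_left_mono[OF W_low, of "d1 * d2"] by (simp add: mult_ac)
    also have "\<dots> \<le> (\<Sum>i\<in>I. measure_pmf.prob ?M (E i))"
      unfolding sum_distrib_left by (intro sum_mono lower)
    finally show "d1 * d2 * d3 * W \<le> (\<Sum>i\<in>I. measure_pmf.prob ?M (E i))" .
  qed (use d0 Wpos in auto)
  also have "\<dots> \<le> (\<Sum>i\<in>I. \<Sum>j\<in>I. measure_pmf.prob ?M (E i \<inter> E j)) * measure_pmf.prob ?M (\<Union>i\<in>I. E i)"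
    by (rule second_moment_count[OF finI])
  also have "\<dots> \<le> (W * G) * P"
  proof (rule mult_mono)
    have "(\<Sum>i\<in>I. \<Sum>j\<in>I. measure_pmf.prob ?M (E i \<inter> E j)) \<le>
       (\<Sum>i\<in>I. wt i * (\<Sum>j\<in>I. walk_weight (\<lambda>a b. lam * u a * u b + of_bool (imp_clause a b \<in> T i)) (L j)))"
      unfolding sum_distrib_left by (intro sum_mono upper)
    also have "\<dots> \<le> (\<Sum>i\<in>I. wt i * G)"
      using wt0 by (intro sum_mono mult_left_mono corr) auto
    also have "\<dots> = (\<Sum>i\<in>I. wt i) * G" by (simp add: sum_distrib_right)
    also have "\<dots> \<le> W * G" using W_up G0 by (rule mult_right_mono)
    finally show "(\<Sum>i\<in>I. \<Sum>j\<in>I. measure_pmf.prob ?M (E i \<inter> E j)) \<le> W * G" .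
    show "measure_pmf.prob ?M (\<Union>i\<in>I. E i) \<le> P"
      unfolding P_def
    proof (intro measure_pmf.finite_measure_mono subsetI CollectI)
      fix cs assume "cs \<in> (\<Union>i\<in>I. E i)"
      then obtain x zs where "set (steps (snake x (take k zs) (drop k zs))) \<subseteq> set cs"
        by (auto simp: E_def T_def L_def)
      then show "\<not> satisfiable (mset cs)" by (rule unsatisfiable_if_snake)
    qed auto
  qed (use Wpos G0 in auto)
  finally have "W * ((d1 * d2 * d3)\<^sup>2 * W) \<le> W * (G * P)"
    by (simp add: power2_eq_square mult_ac)
  then have "(d1 * d2 * d3)\<^sup>2 * W \<le> G * P"
    using Wpos by simp
  then show ?thesis
    unfolding d1_def d2_def d3_def W_def G_def P_def S4_def t_def .
qed

text \<open>Replaces lam, mu, U and m by bounds that leave an expression in t and N alone, ready for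
  passing to the limit. The assumption that N is at most \<open>l0 ^ Suc k\<close> serves to absorb
  the constant 6 into lam^t / N.\<close>

lemma unsat_prob_ge_explicit:
  fixes u :: "literal \<Rightarrow> real" and p :: "clause pmf" and m k :: nat and lam l0 l1 C N c :: real
  assumes V: "finite V" "\<And>a. a \<in> V \<Longrightarrow> neg a \<in> V" "card V \<le> 2 * N"
    and u: "\<And>a. 0 \<le> u a" "\<And>a. a \<in> V \<Longrightarrow> (u a)\<^sup>2 \<le> C / N" "(\<Sum>z\<in>V. (u z)\<^sup>2) = 1" "\<And>a. u (neg a) = u a"
    and eq: "\<And>a b. a \<in> V \<Longrightarrow> b \<in> V \<Longrightarrow> fst a \<noteq> fst b \<Longrightarrow> real m * pmf p (imp_clause a b) = lam * u a * u b"
    and ub: "\<And>a b. real m * pmf p (imp_clause a b) \<le> lam * u a * u b"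
    and lam: "1 < l0" "l0 \<le> lam" "lam \<le> l1" and g0: "g0 = (l0 - 1) / 2"
    and k: "k \<ge> 1" and t: "t = real (Suc k)"
    and N: "0 < N" "N \<le> l0 ^ Suc k" and C: "0 < C" and c: "0 < c" "c * N \<le> m"
    and small: "1 \<le> t * g0" "4 * t\<^sup>2 \<le> c * N" "2 * t * l1 * C \<le> N" "8 * t\<^sup>2 * C \<le> N"
  shows "((1 - 4 * t\<^sup>2 / (c * N)) * (1 - 2 * t * l1 * C / N) * (1 - 8 * t\<^sup>2 * C / N))\<^sup>2 /
     (exp (32 * t\<^sup>2 * C / (N * g0)) +
      8 * t / N * (exp (16 * t\<^sup>2 * C / (N * g0)) * C * (1 + 4 / g0) * (1 + 8 * l1 * t / g0) + 6)\<^sup>2)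
     \<le> measure_pmf.prob (replicate_pmf m p) {cs. \<not> satisfiable (mset cs)}"
proof -
  define P where "P = measure_pmf.prob (replicate_pmf m p) {cs. \<not> satisfiable (mset cs)}"
  define U where "U = sqrt (C / N)"
  define gam where "gam = (lam - 1) / 2"
  define mu where "mu = lam * (1 + 16 * Suc k * U\<^sup>2 / gam)"
  define S4 where "S4 = (\<Sum>z\<in>V. (u z) ^ 4)"
  define d where "d = (1 - (2 * real (Suc k))\<^sup>2 / m) * (1 - 2 * Suc k * lam * U\<^sup>2) * (1 - 4 * Suc k * U\<^sup>2) ^ (2 * k)"
  define d' where "d' = (1 - 4 * t\<^sup>2 / (c * N)) * (1 - 2 * t * l1 * C / N) * (1 - 8 * t\<^sup>2 * C / N)"
  define B where "B = mu ^ Suc k * U\<^sup>2 * (1 + 4 / gam) * (1 + 8 * lam * t / gam) + 6"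
  define B' where "B' = exp (16 * t\<^sup>2 * C / (N * g0)) * C * (1 + 4 / g0) * (1 + 8 * l1 * t / g0) + 6"
  define X where "X = exp (32 * t\<^sup>2 * C / (N * g0))"
  define W where "W = lam ^ (2 * Suc k) * S4"
  have t2: "2 \<le> t" using k t by simp
  have U2: "U\<^sup>2 = C / N" "0 \<le> U" using N C by (auto simp: U_def)
  have gpos: "0 < g0" "g0 \<le> gam" using lam by (auto simp: g0 gam_def)
  have cN: "0 < c * N" using c N by simp
  have tt: "t \<le> t\<^sup>2" using t2 by (simp add: power2_eq_square)
  have tC: "8 * t * C \<le> N"
  proof -
    have "8 * t * C \<le> 8 * t\<^sup>2 * C" using tt C by simp
    with small show ?thesis by linarith
  qed
  have lt: "2 * t * lam * C \<le> 2 * t * l1 * C" using lam t2 C by simp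
  have mt: "4 * t\<^sup>2 \<le> m" using small c by linarith
  have main: "d\<^sup>2 * W \<le> (mu ^ (2 * Suc k) * S4 + 4 * Suc k * B\<^sup>2) * P"
    unfolding d_def W_def S4_def B_def P_def t
  proof (rule unsat_prob_ge[OF V(1,2) u(1) _ u(3,4)])
    show "u a \<le> U" if "a \<in> V" for a
      unfolding U_def using u(2)[OF that] by (rule real_le_rsqrt)
    show "lam = 1 + 2 * gam" by (simp add: gam_def field_simps)
    show "1 / real (Suc k) \<le> gam"     proof -
      have "1 \<le> t * gam" using small(1) gpos(2) t2 mult_left_mono[of g0 gam t] by linarith
      then show ?thesis using t2 unfolding t[symmetric] by (simp add: divide_le_eq mult.commute)
    qed
    show "2 * Suc k \<le> m"
    proof -
      have "2 * t \<le> 4 * t\<^sup>2" using tt t2 by linarith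
      then have "real (2 * Suc k) \<le> real m" using mt t by simp
      then show ?thesis by simp
    qed
    show "(2 * real (Suc k))\<^sup>2 \<le> m" unfolding t[symmetric] power_mult_distrib using mt by simp
    show "real (2 * Suc k) * lam * U\<^sup>2 \<le> 1"
      using small lt N unfolding U2 by (simp add: t field_simps)
    show "real (4 * Suc k) * U\<^sup>2 \<le> 1"
      using tC C N t2 unfolding U2 by (simp add: t field_simps)
  qed (use eq ub gpos k U2 mu_def in auto)
  \<comment> \<open>Cauchy-Schwarz: the squares of the weights sum to 1 over at most 2N
    literals.\<close>
  have S4: "1 / (2 * N) \<le> S4"
  proof -
    have "(\<Sum>z\<in>V. (u z)\<^sup>2)\<^sup>2 \<le> (\<Sum>z\<in>V. ((u z)\<^sup>2)\<^sup>2) * card V"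
      by (rule sum_squared_le_sum_of_squares)
    then have "1 \<le> S4 * card V" by (simp add: u S4_def)
    also have "\<dots> \<le> S4 * (2 * N)" using V by (intro mult_left_mono) (auto simp: S4_def intro!: sum_nonneg)
    finally show ?thesis using N by (simp add: field_simps)
  qed
  then have S4pos: "0 < S4" using N by (smt (verit) divide_pos_pos)
  have lamk: "N \<le> lam ^ Suc k" using N lam power_mono[of l0 lam "Suc k"] by linarith
  have Wpos: "0 < W" using S4pos lam by (simp add: W_def)
  have dd: "0 \<le> d'" "d' \<le> d"
  proof -
    have a: "0 \<le> 1 - 4 * t\<^sup>2 / (c * N)" "1 - 4 * t\<^sup>2 / (c * N) \<le> 1 - (2 * real (Suc k))\<^sup>2 / m"
    proof -
      show "0 \<le> 1 - 4 * t\<^sup>2 / (c * N)" using small cN by simp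
      have "4 * t\<^sup>2 / m \<le> 4 * t\<^sup>2 / (c * N)" using c cN by (intro divide_left_mono) auto
      then show "1 - 4 * t\<^sup>2 / (c * N) \<le> 1 - (2 * real (Suc k))\<^sup>2 / m"
        unfolding t[symmetric] power_mult_distrib by simp
    qed
    have b: "0 \<le> 1 - 2 * t * l1 * C / N" "1 - 2 * t * l1 * C / N \<le> 1 - 2 * Suc k * lam * U\<^sup>2"
    proof -
      show "0 \<le> 1 - 2 * t * l1 * C / N" using small N by simp
      have "2 * t * lam * C / N \<le> 2 * t * l1 * C / N" using lt N by (intro divide_right_mono) auto
      then show "1 - 2 * t * l1 * C / N \<le> 1 - 2 * Suc k * lam * U\<^sup>2" unfolding U2 by (simp add: t)
    qed
    have c: "0 \<le> 1 - 8 * t\<^sup>2 * C / N" "1 - 8 * t\<^sup>2 * C / N \<le> (1 - 4 * Suc k * U\<^sup>2) ^ (2 * k)"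
    proof -
      show "0 \<le> 1 - 8 * t\<^sup>2 * C / N" using small N by simp
      have "4 * t * (C / N) \<le> 1" using tC N t2 C by (simp add: field_simps)
      then have "1 + real (2 * k) * (- (4 * t * (C / N))) \<le> (1 + - (4 * t * (C / N))) ^ (2 * k)"
        by (intro Bernoulli_inequality) simp
      moreover have "real (2 * k) * (4 * t * (C / N)) \<le> 8 * t\<^sup>2 * C / N"
      proof -
        have "real (2 * k) * (4 * t * (C / N)) \<le> (2 * t) * (4 * t * (C / N))"
          using t2 N C t by (intro mult_right_mono) auto
        then show ?thesis by (simp add: power2_eq_square)
      qed
      ultimately show "1 - 8 * t\<^sup>2 * C / N \<le> (1 - 4 * Suc k * U\<^sup>2) ^ (2 * k)" unfolding U2 by (simp add: t)
    qed
    show "0 \<le> d'" unfolding d'_def using a b c by simp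
    show "d' \<le> d" unfolding d'_def d_def using a b c by (intro mult_mono) auto
  qed
  \<comment> \<open>Conditioning multiplies the growth rate by 1 + O(t/N), which over t steps
    amounts to exp(O(t^2/N)).\<close>
  have ratio: "mu / lam \<le> exp (16 * t * C / (N * g0))"
  proof -
    have "mu / lam = 1 + 16 * t * (C / N) / gam" using lam by (simp add: mu_def U2 t)
    also have "\<dots> \<le> 1 + 16 * t * (C / N) / g0" using gpos t2 C N by (intro add_left_mono divide_left_mono) auto
    also have "\<dots> = 1 + 16 * t * C / (N * g0)" by simp
    also have "\<dots> \<le> exp (16 * t * C / (N * g0))" by (rule exp_ge_add_one_self)
    finally show ?thesis .
  qed
  have mu0: "0 \<le> mu"
    unfolding mu_def using lam gpos by (intro mult_nonneg_nonneg add_nonneg_nonneg divide_nonneg_pos) auto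
  then have mul0: "0 \<le> mu / lam" using lam by simp
  have r1: "(mu / lam) ^ Suc k \<le> exp (16 * t\<^sup>2 * C / (N * g0))"
  proof -
    have "(mu / lam) ^ Suc k \<le> exp (16 * t * C / (N * g0)) ^ Suc k" using ratio mul0 by (rule power_mono)
    also have "\<dots> = exp (16 * t\<^sup>2 * C / (N * g0))"
      by (simp only: exp_of_nat_mult[symmetric] t) (simp add: power2_eq_square)
    finally show ?thesis .
  qed
  have r2: "(mu / lam) ^ (2 * Suc k) \<le> X"
  proof -
    have "(mu / lam) ^ (2 * Suc k) = ((mu / lam) ^ Suc k)\<^sup>2" by (metis power_even_eq)
    also have "\<dots> \<le> (exp (16 * t\<^sup>2 * C / (N * g0)))\<^sup>2" by (intro power_mono r1 zero_le_power mul0)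
    also have "\<dots> = X" by (simp add: X_def exp_double[symmetric])
    finally show ?thesis .
  qed
  have B: "B \<le> lam ^ Suc k / N * B'" "0 \<le> B"
  proof -
    have "mu ^ Suc k = lam ^ Suc k * (mu / lam) ^ Suc k" using lam by (simp add: power_divide)
    also have "\<dots> \<le> lam ^ Suc k * exp (16 * t\<^sup>2 * C / (N * g0))" using r1 lam by (intro mult_left_mono) auto
    finally have 1: "mu ^ Suc k \<le> lam ^ Suc k * exp (16 * t\<^sup>2 * C / (N * g0))" .
    have 2: "1 + 4 / gam \<le> 1 + 4 / g0" using gpos by (intro add_left_mono divide_left_mono) auto
    have "8 * lam * t / gam \<le> 8 * l1 * t / g0"
      using gpos t2 lam by (intro frac_le mult_right_mono mult_left_mono mult_nonneg_nonneg) auto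
    then have 3: "1 + 8 * lam * t / gam \<le> 1 + 8 * l1 * t / g0" by simp
    have "mu ^ Suc k * (C / N) * (1 + 4 / gam) * (1 + 8 * lam * t / gam) \<le>
       (lam ^ Suc k * exp (16 * t\<^sup>2 * C / (N * g0))) * (C / N) * (1 + 4 / g0) * (1 + 8 * l1 * t / g0)"
      using 1 2 3 mu0 C N gpos t2 lam by (intro mult_mono mult_nonneg_nonneg) auto
    moreover have "6 \<le> lam ^ Suc k / N * 6" using lamk N by (simp add: field_simps)
    ultimately show "B \<le> lam ^ Suc k / N * B'"
    proof -
      assume le: "mu ^ Suc k * (C / N) * (1 + 4 / gam) * (1 + 8 * lam * t / gam) \<le>
          lam ^ Suc k * exp (16 * t\<^sup>2 * C / (N * g0)) * (C / N) * (1 + 4 / g0) * (1 + 8 * l1 * t / g0)"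
        and six: "6 \<le> lam ^ Suc k / N * 6"
      have "x * y * (C / N) * a * b = x / N * (y * C * a * b)" for x y a b :: real by simp
      from le[unfolded this] six show ?thesis
        unfolding B_def B'_def U2 distrib_left by (rule add_mono)
    qed
    show "0 \<le> B" unfolding B_def U2 using mu0 C N gpos t2 lam
      by (intro add_nonneg_nonneg mult_nonneg_nonneg) auto
  qed
  have "mu ^ (2 * Suc k) * S4 + 4 * Suc k * B\<^sup>2 \<le> W * (X + 8 * t / N * B'\<^sup>2)"
  proof -
    have "mu ^ (2 * Suc k) * S4 = W * (mu / lam) ^ (2 * Suc k)"
      using lam by (simp add: W_def power_divide)
    also have "\<dots> \<le> W * X" using r2 Wpos by (intro mult_left_mono) auto
    finally have 1: "mu ^ (2 * Suc k) * S4 \<le> W * X" .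
    have "B\<^sup>2 \<le> (lam ^ Suc k / N * B')\<^sup>2" using B by (intro power_mono) auto
    also have "\<dots> = lam ^ (2 * Suc k) * (1 / (2 * N)) * (2 / N * B'\<^sup>2)"
      by (simp only: power_mult_distrib power_divide power_even_eq) (simp add: power2_eq_square)
    also have "\<dots> \<le> W * (2 / N * B'\<^sup>2)"
      unfolding W_def using S4 lam N by (intro mult_right_mono mult_left_mono) auto
    finally have "4 * t * B\<^sup>2 \<le> 4 * t * (W * (2 / N * B'\<^sup>2))" using t2 by (intro mult_left_mono) auto
    with 1 show ?thesis by (simp add: algebra_simps t)
  qed
  moreover have P0: "0 \<le> P" by (simp add: P_def)
  ultimately have "d\<^sup>2 * W \<le> W * (X + 8 * t / N * B'\<^sup>2) * P"
    using main by (meson mult_right_mono order_trans)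
  moreover have "d'\<^sup>2 * W \<le> d\<^sup>2 * W" using dd Wpos by (intro mult_right_mono power_mono) auto
  ultimately have "W * d'\<^sup>2 \<le> W * ((X + 8 * t / N * B'\<^sup>2) * P)" by (simp add: mult_ac)
  then have "d'\<^sup>2 \<le> (X + 8 * t / N * B'\<^sup>2) * P" using Wpos by simp
  moreover have "0 < X + 8 * t / N * B'\<^sup>2"
    using t2 N by (intro add_pos_nonneg) (auto simp: X_def)
  ultimately show ?thesis
    unfolding d'_def[symmetric] X_def[symmetric] B'_def[symmetric] P_def[symmetric]
    by (simp add: divide_le_eq mult.commute)
qed

section \<open>Asymptotics of power sums\<close>

text \<open>Comparison with the integral of x powr (-a), term by term: by the mean value theorem (1
  - a) i powr (-a) and (1 - a) (i + 1) powr (-a) enclose an increment of x powr (1 - a), and the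
  increments telescope.\<close>

lemma power_sum_bounds:
  fixes a :: real
  assumes "0 \<le> a" "a < 1"
  shows "((real n + 1) powr (1 - a) - 1) / (1 - a) \<le> (\<Sum>i=1..n. real i powr (- a))"
    and "(\<Sum>i=1..n. real i powr (- a)) \<le> real n powr (1 - a) / (1 - a)"
proof -
  have mvt: "\<exists>z>real i. z < real i + 1 \<and> (real i + 1) powr (1 - a) - real i powr (1 - a) = (1 - a) * z powr (- a)"
    if "i > 0" for i :: nat
  proof -
    have "\<exists>z::real. real i < z \<and> z < real i + 1 \<and>
      (real i + 1) powr (1 - a) - real i powr (1 - a) = (real i + 1 - real i) * ((1 - a) * z powr (1 - a - 1))"
    proof (rule MVT2)
      fix x assume "real i \<le> x"
      with that have "0 < x" by simp
      then show "((\<lambda>x. x powr (1 - a)) has_real_derivative (1 - a) * x powr (1 - a - 1)) (at x)"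
        by (rule has_real_derivative_powr)
    qed simp
    then show ?thesis by auto
  qed
  have "(real n + 1) powr (1 - a) - 1 \<le> (1 - a) * (\<Sum>i=1..n. real i powr (- a))"
  proof (induction n)
    case (Suc n)
    obtain z where z: "z > real (Suc n)" "(real (Suc n) + 1) powr (1 - a) - real (Suc n) powr (1 - a) = (1 - a) * z powr (- a)"
      using mvt[of "Suc n"] by auto
    have "z powr (- a) \<le> real (Suc n) powr (- a)" using z assms by (intro powr_mono2') auto
    then have "(1 - a) * z powr (- a) \<le> (1 - a) * real (Suc n) powr (- a)" using assms by (intro mult_left_mono) auto
    with z Suc show ?case by (simp add: algebra_simps)
  qed auto
  then show "((real n + 1) powr (1 - a) - 1) / (1 - a) \<le> (\<Sum>i=1..n. real i powr (- a))"
    using assms by (simp add: divide_le_eq mult.commute)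
  have "(1 - a) * (\<Sum>i=1..n. real i powr (- a)) \<le> real n powr (1 - a)"
  proof (induction n)
    case (Suc n)
    show ?case
    \<comment> \<open>The interval from 0 to 1 is treated apart, as the derivative blows up at 0 for
      a > 0; there the claim is 1 - a \<le> 1.\<close>
    proof (cases "n = 0")
      case False
      obtain z where z: "z > real n" "z < real n + 1" "(real n + 1) powr (1 - a) - real n powr (1 - a) = (1 - a) * z powr (- a)"
        using mvt[of n] False by auto
      have "(real n + 1) powr (- a) \<le> z powr (- a)" using z assms by (intro powr_mono2') auto
      then have "(1 - a) * (real n + 1) powr (- a) \<le> (1 - a) * z powr (- a)" using assms by (intro mult_left_mono) auto
      with z Suc show ?thesis by (simp add: algebra_simps)
    qed (use assms in auto)
  qed auto
  then show "(\<Sum>i=1..n. real i powr (- a)) \<le> real n powr (1 - a) / (1 - a)"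
    using assms by (simp add: le_divide_eq mult.commute)
qed

lemma power_sum_asymp:
  fixes a :: real
  assumes "0 \<le> a" "a < 1"
  shows "(\<lambda>n. (\<Sum>i=1..n. real i powr (- a)) / real n powr (1 - a)) \<longlonglongrightarrow> 1 / (1 - a)"
proof (rule tendsto_sandwich)
  define b where "b = 1 - a"
  have b: "0 < b" using assms by (simp add: b_def)
  have "(\<lambda>n. ((real n + 1) powr b - 1) / b / real n powr b) \<longlonglongrightarrow> inverse b"
    using b by real_asymp
  then show "(\<lambda>n. ((real n + 1) powr (1 - a) - 1) / (1 - a) / real n powr (1 - a)) \<longlonglongrightarrow> 1 / (1 - a)"
    by (simp add: b_def inverse_eq_divide)
  show "\<forall>\<^sub>F n in sequentially. ((real n + 1) powr (1 - a) - 1) / (1 - a) / real n powr (1 - a) \<le>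
      (\<Sum>i=1..n. real i powr (- a)) / real n powr (1 - a)"
    by (intro always_eventually allI divide_right_mono power_sum_bounds(1)[OF assms]) auto
  show "\<forall>\<^sub>F n in sequentially. (\<Sum>i=1..n. real i powr (- a)) / real n powr (1 - a) \<le> 1 / (1 - a)"
    using eventually_gt_at_top[of 0]
  proof eventually_elim
    case (elim n)
    then show ?case using power_sum_bounds(2)[OF assms, of n] by (simp add: divide_le_eq)
  qed
qed auto

section \<open>Scale-free weights\<close>

text \<open>Differentiating the geometric series twice gives the coefficients (n+1)(n+2), which
  dominate n^2.\<close>

lemma summable_square_times_geometric:
  assumes "0 \<le> r" "r < (1::real)"
  shows "summable (\<lambda>k. (real k)\<^sup>2 * r ^ k)"
proof -
  have 1: "summable (\<lambda>n. diffs (\<lambda>_. 1) n * x ^ n)" if "norm x < 1" for x :: real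
    by (rule termdiff_converges[OF that]) (simp add: summable_geometric)
  have "summable (\<lambda>n. diffs (diffs (\<lambda>_. 1)) n * r ^ n)"
    using assms by (intro termdiff_converges[of r 1] 1) auto
  then show ?thesis
  proof (rule summable_comparison_test')
    fix n
    show "norm ((real n)\<^sup>2 * r ^ n) \<le> diffs (diffs (\<lambda>_. 1)) n * r ^ n"
      using assms unfolding diffs_def by (simp add: power2_eq_square mult_right_mono algebra_simps)
  qed
qed

context
  fixes \<beta> :: real
begin

definition var_weight :: "nat \<Rightarrow> real" where "var_weight i = real i powr (- \<beta>)"

definition sum_weight :: "nat \<Rightarrow> real" where "sum_weight n = (\<Sum>i=1..n. var_weight i)"

definition sum_weight2 :: "nat set \<Rightarrow> real" where "sum_weight2 A = (\<Sum>i\<in>A. (var_weight i)\<^sup>2)"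

lemma var_weight_pos: "i \<ge> 1 \<Longrightarrow> 0 < var_weight i"
  by (simp add: var_weight_def)

lemma sum_literals: "(\<Sum>a\<in>A \<times> (UNIV :: bool set). f (fst a)) = 2 * (\<Sum>i\<in>A. f i :: real)"
proof -
  have "(\<Sum>a\<in>A \<times> (UNIV :: bool set). f (fst a)) = (\<Sum>i\<in>A. \<Sum>b\<in>(UNIV :: bool set). f i)"
    unfolding sum.cartesian_product by (simp add: split_def)
  then show ?thesis by (simp add: sum_distrib_left)
qed

text \<open>Four sign patterns for each ordered pair of variables, and two ordered pairs of literals
  for each clause, give the factor 2. The subtracted squares are the pairs with coinciding
  variables.\<close>

lemma sum_clause_weight:
  "(\<Sum>C\<in>clauses n. clause_weight \<beta> C) = 2 * ((sum_weight n)\<^sup>2 - sum_weight2 {1..n})"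
proof -
  define V where "V = {1..n} \<times> (UNIV :: bool set)"
  define P where "P = {ab \<in> V \<times> V. fst (fst ab) \<noteq> fst (snd ab)}"
  define f where "f ab = var_weight (fst (fst ab)) * var_weight (fst (snd ab))" for ab :: "literal \<times> literal"
  define g where "g ab = {fst ab, snd ab}" for ab :: "literal \<times> literal"
  have fin: "finite V" "finite P" by (auto simp: V_def P_def)
  have img: "g ` P = clauses n"
  proof (intro equalityI subsetI)
    fix C assume "C \<in> clauses n"
    then obtain i a j b where "C = {(i, a), (j, b)}" "i \<in> {1..n}" "j \<in> {1..n}" "i \<noteq> j"
      unfolding clauses_def by blast
    then show "C \<in> g ` P" by (intro image_eqI[of _ _ "((i, a), (j, b))"]) (auto simp: g_def P_def V_def)
  next
    fix C assume "C \<in> g ` P"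
    then obtain i a j b where "((i, a), (j, b)) \<in> P" "C = g ((i, a), (j, b))" by fastforce
    then have "C = {(i, a), (j, b)}" "i \<in> {1..n}" "j \<in> {1..n}" "i \<noteq> j"
      by (auto simp: g_def P_def V_def)
    then show "C \<in> clauses n" unfolding clauses_def by blast
  qed
  have fib: "(\<Sum>ab | ab \<in> P \<and> g ab = C. f ab) = 2 * clause_weight \<beta> C" if CC: "C \<in> clauses n" for C
  proof -
    obtain i a j b where C: "C = {(i, a), (j, b)}" "i \<in> {1..n}" "j \<in> {1..n}" "i \<noteq> j"
      using CC unfolding clauses_def by blast
    then have "{ab. ab \<in> P \<and> g ab = C} = {((i, a), (j, b)), ((j, b), (i, a))}"
      by (auto simp: g_def P_def V_def doubleton_eq_iff)
    then show ?thesis using C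
      by (simp add: f_def clause_weight_pair var_weight_def)
  qed
  have "(\<Sum>ab\<in>P. f ab) = (\<Sum>C\<in>clauses n. 2 * clause_weight \<beta> C)"
    unfolding sum.image_gen[OF fin(2), of f g] img by (intro sum.cong refl fib)
  then have 1: "2 * (\<Sum>C\<in>clauses n. clause_weight \<beta> C) = (\<Sum>ab\<in>P. f ab)"
    by (simp add: sum_distrib_left)
  have "(\<Sum>ab\<in>P. f ab) = (\<Sum>ab\<in>V \<times> V. if fst (fst ab) \<noteq> fst (snd ab) then f ab else 0)"
    unfolding P_def using fin by (intro sum.inter_filter) auto
  also have "\<dots> = (\<Sum>a\<in>V. \<Sum>b\<in>V. if fst a \<noteq> fst b then var_weight (fst a) * var_weight (fst b) else 0)"
    unfolding f_def by (simp add: sum.cartesian_product split_def)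
  also have "\<dots> = (\<Sum>a\<in>V. 2 * (\<Sum>j=1..n. if fst a \<noteq> j then var_weight (fst a) * var_weight j else 0))"
    unfolding V_def by (intro sum.cong refl sum_literals[where f="\<lambda>j. if fst _ \<noteq> j then var_weight (fst _) * var_weight j else 0"])
  also have "\<dots> = 2 * (\<Sum>i=1..n. 2 * (\<Sum>j=1..n. if i \<noteq> j then var_weight i * var_weight j else 0))"
    unfolding V_def by (rule sum_literals)
  also have "\<dots> = 4 * (\<Sum>i=1..n. \<Sum>j=1..n. if i \<noteq> j then var_weight i * var_weight j else 0)"
    by (simp add: sum_distrib_left)
  also have "(\<Sum>i=1..n. \<Sum>j=1..n. if i \<noteq> j then var_weight i * var_weight j else 0) =
      (\<Sum>i=1..n. var_weight i * sum_weight n - (var_weight i)\<^sup>2)"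
  proof (intro sum.cong refl)
    fix i assume i: "i \<in> {1..n}"
    have "(\<Sum>j=1..n. if i \<noteq> j then var_weight i * var_weight j else 0) =
       (\<Sum>j=1..n. var_weight i * var_weight j - (if i = j then var_weight i * var_weight j else 0))"
      by (intro sum.cong) auto
    also have "\<dots> = var_weight i * sum_weight n - (var_weight i)\<^sup>2"
      using i by (simp add: sum_subtractf sum_weight_def sum_distrib_left power2_eq_square)
    finally show "(\<Sum>j=1..n. if i \<noteq> j then var_weight i * var_weight j else 0) =
      var_weight i * sum_weight n - (var_weight i)\<^sup>2" .
  qed
  also have "\<dots> = (sum_weight n)\<^sup>2 - sum_weight2 {1..n}"
    by (simp add: sum_subtractf sum_weight2_def sum_distrib_right[symmetric] sum_weight_def power2_eq_square)
  finally show ?thesis using 1 by simp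
qed

lemma normalizer_pos: "n \<ge> 2 \<Longrightarrow> 0 < (sum_weight n)\<^sup>2 - sum_weight2 {1..n}"
proof -
  assume n: "n \<ge> 2"
  have "0 < (\<Sum>C\<in>clauses n. clause_weight \<beta> C)"
    using finite_clauses clauses_nonempty[OF n] clause_weight_pos by (intro sum_pos) auto
  then show ?thesis unfolding sum_clause_weight by simp
qed

lemma pmf_imp_clause:
  assumes "n \<ge> 2" "a \<in> {1..n} \<times> UNIV" "b \<in> {1..n} \<times> UNIV" "fst a \<noteq> fst b"
  shows "pmf (random_clause n \<beta>) (imp_clause a b) =
    var_weight (fst a) * var_weight (fst b) / (2 * ((sum_weight n)\<^sup>2 - sum_weight2 {1..n}))"
proof -
  obtain i x j y where ab: "a = (i, x)" "b = (j, y)" by (cases a; cases b)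
  have cl: "imp_clause a b = {(i, \<not> x), (j, y)}" by (simp add: ab imp_clause_def neg_def)
  have "imp_clause a b \<in> clauses n" unfolding cl clauses_def using assms ab by auto
  then show ?thesis
    unfolding pmf_random_clause[OF assms(1)] sum_clause_weight cl
    using assms ab by (simp add: clause_weight_pair var_weight_def)
qed

text \<open>An edge between literals of one variable, or outside the range, belongs to no clause and
  has probability 0. Hence the product form bounds all edges without side conditions, and sums over
  arbitrary walks can use it.\<close>

lemma pmf_imp_clause_le:
  assumes "n \<ge> 2"
  shows "pmf (random_clause n \<beta>) (imp_clause a b) \<le>
    var_weight (fst a) * var_weight (fst b) / (2 * ((sum_weight n)\<^sup>2 - sum_weight2 {1..n}))"
proof (cases "imp_clause a b \<in> clauses n")
  case True
  then obtain i x j y where C: "imp_clause a b = {(i, x), (j, y)}" "i \<in> {1..n}" "j \<in> {1..n}" "i \<noteq> j"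
    unfolding clauses_def by blast
  then have "a \<in> {1..n} \<times> UNIV" "b \<in> {1..n} \<times> UNIV" "fst a \<noteq> fst b"
    by (auto simp: imp_clause_def doubleton_eq_iff neg_def mem_Times_iff)
  from pmf_imp_clause[OF assms this] show ?thesis by simp
next
  case False
  then have "pmf (random_clause n \<beta>) (imp_clause a b) = 0" using pmf_random_clause[OF assms] by simp
  moreover have "0 \<le> var_weight (fst a) * var_weight (fst b) / (2 * ((sum_weight n)\<^sup>2 - sum_weight2 {1..n}))"
    using normalizer_pos[OF assms] by (auto simp: var_weight_def)
  ultimately show ?thesis by simp
qed

text \<open>The factor 2 counts the two signs of each variable, so that the squares sum to 1 over
  the literals on A.\<close>

definition lit_weight :: "nat set \<Rightarrow> literal \<Rightarrow> real" where
  "lit_weight A a = var_weight (fst a) / sqrt (2 * sum_weight2 A)"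

text \<open>The nonzero eigenvalue of the rank one kernel on the literals over A. The normalizer
  still involves all n variables: only the walks are confined to A, not the sampling.\<close>

definition branching :: "nat \<Rightarrow> nat \<Rightarrow> nat set \<Rightarrow> real" where
  "branching n m A = real m * sum_weight2 A / ((sum_weight n)\<^sup>2 - sum_weight2 {1..n})"

lemma sum_weight2_pos:
  assumes "finite A" "A \<noteq> {}" "0 \<notin> A"
  shows "0 < sum_weight2 A"
proof -
  have "0 < (var_weight i)\<^sup>2" if "i \<in> A" for i
  proof -
    have "i \<ge> 1" using that assms(3) by (cases i) auto
    then show ?thesis using var_weight_pos[of i] by simp
  qed
  then show ?thesis unfolding sum_weight2_def by (rule sum_pos[OF assms(1,2)])
qed

lemma lit_weight_nonneg: "0 \<le> lit_weight A a"
  by (simp add: lit_weight_def var_weight_def sum_weight2_def sum_nonneg)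

lemma lit_weight_neg: "lit_weight A (neg a) = lit_weight A a"
  by (simp add: lit_weight_def)

lemma lit_weight_square:
  "(lit_weight A a)\<^sup>2 = (var_weight (fst a))\<^sup>2 / (2 * sum_weight2 A)"
  by (simp add: lit_weight_def power_divide sum_weight2_def sum_nonneg)

lemma sum_lit_weight_square:
  assumes "0 < sum_weight2 A"
  shows "(\<Sum>a\<in>A \<times> UNIV. (lit_weight A a)\<^sup>2) = 1"
  unfolding lit_weight_square sum_literals[where f="\<lambda>i. (var_weight i)\<^sup>2 / (2 * sum_weight2 A)"]
  using assms by (simp add: sum_divide_distrib[symmetric] flip: sum_weight2_def)

lemma branching_lit_weight:
  assumes "0 < sum_weight2 A"
  shows "branching n m A * lit_weight A a * lit_weight A b =
    real m * (var_weight (fst a) * var_weight (fst b) / (2 * ((sum_weight n)\<^sup>2 - sum_weight2 {1..n})))"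
proof -
  have "lit_weight A a * lit_weight A b = var_weight (fst a) * var_weight (fst b) / (2 * sum_weight2 A)"
    using assms by (simp add: lit_weight_def)
  moreover have "x * q / z * (y / (2 * q)) = x * (y / (2 * z))" if "q > 0" for x y z q :: real
    using that by (cases "z = 0") (auto simp: field_simps)
  ultimately show ?thesis using assms by (simp only: branching_def mult.assoc)
qed

lemma rate_eq:
  assumes "0 < sum_weight2 A" "n \<ge> 2" "a \<in> {1..n} \<times> UNIV" "b \<in> {1..n} \<times> UNIV" "fst a \<noteq> fst b"
  shows "real m * pmf (random_clause n \<beta>) (imp_clause a b) = branching n m A * lit_weight A a * lit_weight A b"
  unfolding branching_lit_weight[OF assms(1)] pmf_imp_clause[OF assms(2-)] ..

lemma rate_le:
  assumes "0 < sum_weight2 A" "n \<ge> 2"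
  shows "real m * pmf (random_clause n \<beta>) (imp_clause a b) \<le> branching n m A * lit_weight A a * lit_weight A b"
  unfolding branching_lit_weight[OF assms(1)] by (intro mult_left_mono pmf_imp_clause_le[OF assms(2)]) auto

lemma set_pmf_random_clause: "n \<ge> 2 \<Longrightarrow> set_pmf (random_clause n \<beta>) \<subseteq> clauses n"
  using pmf_random_clause[of n \<beta>] by (auto simp: set_pmf_iff split: if_splits)

lemma prob_random_2sat:
  "measure_pmf.prob (random_2sat n m \<beta>) {F. Q F} = measure_pmf.prob (replicate_pmf m (random_clause n \<beta>)) {cs. Q (mset cs)}"
  by (simp add: random_2sat_def vimage_def)

text \<open>No variable weight exceeds 1, so U^2 = 1 / (2 \<open>sum_weight2 \<beta> {1..n}\<close>)
  bounds the squared literal weights. This turns the 4k^2 choices of the ends into the factor 2k^2 /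
  \<open>sum_weight2 \<beta> {1..n}\<close>.\<close>

lemma unsat_prob_le_branching:
  assumes beta: "0 \<le> \<beta>" and n: "n \<ge> 2" and lam: "branching n m {1..n} \<le> L" "0 \<le> L" "L < 1"
  shows "measure_pmf.prob (random_2sat n m \<beta>) {F. \<not> satisfiable F} \<le>
    (2 / sum_weight2 {1..n}) * (\<Sum>k. (real k)\<^sup>2 * L ^ k)"
proof -
  define U where "U = 1 / sqrt (2 * sum_weight2 {1..n})"
  have pos: "0 < sum_weight2 {1..n}" using n by (intro sum_weight2_pos) auto
  have lam0: "0 \<le> branching n m {1..n}"
    using pos normalizer_pos[OF n] by (simp add: branching_def)
  have "measure_pmf.prob (random_2sat n m \<beta>) {F. \<not> satisfiable F} \<le>
     (\<Sum>k=1..n. branching n m {1..n} ^ Suc k * (4 * (real k)\<^sup>2) * U\<^sup>2)"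
    unfolding prob_random_2sat
  proof (rule unsat_prob_le_sum_bicycles[where u = "lit_weight {1..n}", OF set_pmf_random_clause[OF n]
        rate_le[OF pos n] lit_weight_nonneg _ sum_lit_weight_square[OF pos] lam0])
    fix a assume "a \<in> {1..n} \<times> (UNIV :: bool set)"
    then have "1 \<le> real (fst a)" by auto
    then have "var_weight (fst a) \<le> 1"
      using beta powr_mono[of "- \<beta>" 0 "real (fst a)"] by (simp add: var_weight_def)
    then show "lit_weight {1..n} a \<le> U"
      using pos by (simp add: lit_weight_def U_def divide_right_mono)
  qed
  also have "\<dots> \<le> (\<Sum>k=1..n. (2 / sum_weight2 {1..n}) * ((real k)\<^sup>2 * L ^ k))"
  proof (intro sum_mono)
    fix k
    have "branching n m {1..n} ^ Suc k \<le> L ^ Suc k" using lam lam0 by (intro power_mono) auto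
    also have "\<dots> \<le> L ^ k" using lam by (simp add: mult_left_le_one_le)
    finally have "branching n m {1..n} ^ Suc k * (4 * (real k)\<^sup>2) * U\<^sup>2 \<le> L ^ k * (4 * (real k)\<^sup>2) * U\<^sup>2"
      by (intro mult_right_mono) auto
    moreover have "U\<^sup>2 = 1 / (2 * sum_weight2 {1..n})" using pos by (simp add: U_def power_divide)
    ultimately show "branching n m {1..n} ^ Suc k * (4 * (real k)\<^sup>2) * U\<^sup>2 \<le> (2 / sum_weight2 {1..n}) * ((real k)\<^sup>2 * L ^ k)"
      by (simp only:) (simp add: mult_ac)
  qed
  also have "\<dots> = (2 / sum_weight2 {1..n}) * (\<Sum>k=1..n. (real k)\<^sup>2 * L ^ k)"
    by (simp add: sum_distrib_left)
  also have "\<dots> \<le> (2 / sum_weight2 {1..n}) * (\<Sum>k. (real k)\<^sup>2 * L ^ k)"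
    using pos lam by (intro mult_left_mono sum_le_suminf summable_square_times_geometric) auto
  finally show ?thesis .
qed

text \<open>Adding a clause preserves unsatisfiability. Above the threshold this reduces an
  arbitrary m(n) to the least admissible one, whose ratio to n converges.\<close>

lemma unsat_prob_mono:
  assumes "m \<le> m'"
  shows "measure_pmf.prob (random_2sat n m \<beta>) {F. \<not> satisfiable F} \<le> measure_pmf.prob (random_2sat n m' \<beta>) {F. \<not> satisfiable F}"
proof -
  let ?p = "random_clause n \<beta>"
  have mono: "\<not> satisfiable (mset (x # cs))" if "\<not> satisfiable (mset cs)" for x cs
    using that by (auto simp: satisfiable_def satisfies_def)
  have "measure_pmf.prob (replicate_pmf m ?p) {cs. \<not> satisfiable (mset cs)} \<le>
     measure_pmf.prob (replicate_pmf (Suc m) ?p) {cs. \<not> satisfiable (mset cs)}" for m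
  proof -
    have "measure_pmf.prob (replicate_pmf m ?p) {cs. \<not> satisfiable (mset cs)} =
       (\<integral>x. measure_pmf.prob (replicate_pmf m ?p) {cs. \<not> satisfiable (mset cs)} \<partial>measure_pmf ?p)" by simp
    also have "\<dots> \<le> (\<integral>x. measure_pmf.prob (replicate_pmf m ?p) {cs. x # cs \<in> {cs. \<not> satisfiable (mset cs)}} \<partial>measure_pmf ?p)"
      using mono by (intro integral_mono measure_pmf.finite_measure_mono measure_pmf.integrable_const_bound[where B=1]) auto
    finally show ?thesis unfolding measure_replicate_pmf_Suc .
  qed
  from lift_Suc_mono_le[of "\<lambda>m. measure_pmf.prob (replicate_pmf m ?p) {cs. \<not> satisfiable (mset cs)}", OF this assms]
  show ?thesis unfolding prob_random_2sat .
qed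

end

section \<open>The phase transition\<close>

lemma var_weight_square: "(var_weight \<beta> i)\<^sup>2 = real i powr (- (2 * \<beta>))"
  by (simp add: var_weight_def power2_eq_square flip: powr_add)

lemma sum_weight2_eq: "sum_weight2 \<beta> A = (\<Sum>i\<in>A. real i powr (- (2 * \<beta>)))"
  by (simp add: sum_weight2_def var_weight_square)

text \<open>After division by n powr (2 - 2\<beta>), the square of the weight sum tends to 1 / (1 -
  \<beta>)^2, while the correction for coinciding variables is O(1/n). The numerator f is left open
  to cover both the full and the truncated sum of squares.\<close>

lemma normalizer_ratio_limit:
  assumes beta: "0 \<le> \<beta>" "\<beta> < 1 / 2"
    and f: "(\<lambda>n. f n / real n powr (1 - 2 * \<beta>)) \<longlonglongrightarrow> x"
  shows "(\<lambda>n. real n * f n / ((sum_weight \<beta> n)\<^sup>2 - sum_weight2 \<beta> {1..n})) \<longlonglongrightarrow> x * (1 - \<beta>)\<^sup>2"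
proof -
  define q where "q n = sum_weight2 \<beta> {1..n} / real n powr (1 - 2 * \<beta>)" for n
  define s where "s n = sum_weight \<beta> n / real n powr (1 - \<beta>)" for n
  have q: "q \<longlonglongrightarrow> 1 / (1 - 2 * \<beta>)"
    unfolding q_def[abs_def] sum_weight2_eq using beta by (intro power_sum_asymp) auto
  have s: "s \<longlonglongrightarrow> 1 / (1 - \<beta>)"
    unfolding s_def[abs_def] sum_weight_def var_weight_def using beta by (intro power_sum_asymp) auto
  have "(\<lambda>n. q n * (1 / real n)) \<longlonglongrightarrow> 1 / (1 - 2 * \<beta>) * 0"
    by (intro tendsto_mult q lim_1_over_n)
  then have qn: "(\<lambda>n. q n / real n) \<longlonglongrightarrow> 0" by simp
  have "(\<lambda>n. (f n / real n powr (1 - 2 * \<beta>)) / ((s n)\<^sup>2 - q n / real n)) \<longlonglongrightarrow> x / ((1 / (1 - \<beta>))\<^sup>2 - 0)"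
    using beta by (intro tendsto_divide f tendsto_diff tendsto_power s qn) auto
  then have lim: "(\<lambda>n. (f n / real n powr (1 - 2 * \<beta>)) / ((s n)\<^sup>2 - q n / real n)) \<longlonglongrightarrow> x * (1 - \<beta>)\<^sup>2"
    by (simp add: power_divide)
  show ?thesis
  proof (rule Lim_transform_eventually[OF lim])
    show "\<forall>\<^sub>F n in sequentially. (f n / real n powr (1 - 2 * \<beta>)) / ((s n)\<^sup>2 - q n / real n) =
        real n * f n / ((sum_weight \<beta> n)\<^sup>2 - sum_weight2 \<beta> {1..n})"
      using eventually_gt_at_top[of 0]
    proof eventually_elim
      case (elim n)
      define y where "y = real n powr (1 - 2 * \<beta>)"
      have y: "y > 0" using elim by (simp add: y_def)
      have "(real n powr (1 - \<beta>))\<^sup>2 = real n powr (1 + (1 - 2 * \<beta>))"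
        by (simp add: power2_eq_square flip: powr_add)
      also have "\<dots> = real n * y" unfolding y_def powr_add[of "real n" 1] using elim by simp
      finally have "(s n)\<^sup>2 = (sum_weight \<beta> n)\<^sup>2 / (real n * y)" by (simp add: s_def power_divide)
      moreover have "q n = sum_weight2 \<beta> {1..n} / y" by (simp add: q_def y_def)
      ultimately have "(s n)\<^sup>2 - q n / real n = ((sum_weight \<beta> n)\<^sup>2 - sum_weight2 \<beta> {1..n}) / (real n * y)"
        by (simp add: diff_divide_distrib mult.commute)
      then show ?case using elim y by (simp add: y_def[symmetric])
    qed
  qed
qed

lemma critical_ratio_limit:
  assumes "0 \<le> \<beta>" "\<beta> < 1 / 2"
  shows "(\<lambda>n. real n * sum_weight2 \<beta> {1..n} / ((sum_weight \<beta> n)\<^sup>2 - sum_weight2 \<beta> {1..n}))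
    \<longlonglongrightarrow> (1 - \<beta>)\<^sup>2 / (1 - 2 * \<beta>)"
  using normalizer_ratio_limit[OF assms, of "\<lambda>n. sum_weight2 \<beta> {1..n}" "1 / (1 - 2 * \<beta>)"]
    power_sum_asymp[of "2 * \<beta>"] assms by (simp add: sum_weight2_eq)

lemma sum_weight2_at_top:
  assumes "0 \<le> \<beta>" "\<beta> < 1 / 2"
  shows "filterlim (\<lambda>n. sum_weight2 \<beta> {1..n}) at_top sequentially"
proof (rule filterlim_at_top_mono)
  define b where "b = 1 - 2 * \<beta>"
  have "0 < b" using assms by (simp add: b_def)
  then show "filterlim (\<lambda>n. ((real n + 1) powr b - 1) / b) at_top sequentially"
    by real_asymp
  show "\<forall>\<^sub>F n in sequentially. ((real n + 1) powr b - 1) / b \<le> sum_weight2 \<beta> {1..n}"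
    unfolding b_def sum_weight2_eq using assms by (intro always_eventually allI power_sum_bounds) auto
qed

section \<open>Below the threshold\<close>

lemma satisfiable_below_threshold:
  fixes m :: "nat \<Rightarrow> nat"
  assumes beta: "0 \<le> \<beta>" "\<beta> < 1 / 2" and c: "c < (1 - 2 * \<beta>) / (1 - \<beta>)\<^sup>2"
    and m: "\<And>n. n \<ge> 2 \<Longrightarrow> real (m n) / real n \<le> c"
  shows "(\<lambda>n. measure_pmf.prob (random_2sat n (m n) \<beta>) {F. satisfiable F}) \<longlonglongrightarrow> 1"
proof -
  define tau where "tau = (1 - \<beta>)\<^sup>2 / (1 - 2 * \<beta>)"
  have tau: "0 < tau" using beta by (simp add: tau_def)
  have ctau: "c * tau < 1" using c beta by (simp add: tau_def field_simps)
  \<comment> \<open>Ratios are nonnegative, so the hypothesis at n = 2 forces c to be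
    nonnegative.\<close>
  have c0: "0 \<le> c" using m[of 2] by (meson divide_nonneg_nonneg of_nat_0_le_iff order_refl order_trans)
  \<comment> \<open>The midpoint of c tau and 1: eventually above the branching number, yet small
    enough for the series to converge.\<close>
  define L where "L = (c * tau + 1) / 2"
  have L: "c * tau < L" "0 \<le> L" "L < 1" using ctau c0 tau by (auto simp: L_def)
  have "(\<lambda>n. c * (real n * sum_weight2 \<beta> {1..n} / ((sum_weight \<beta> n)\<^sup>2 - sum_weight2 \<beta> {1..n}))) \<longlonglongrightarrow> c * tau"
    unfolding tau_def by (intro tendsto_mult tendsto_const critical_ratio_limit beta)
  from order_tendstoD(2)[OF this L(1)]
  have ev: "\<forall>\<^sub>F n in sequentially. branching \<beta> n (m n) {1..n} \<le> L"
    using eventually_ge_at_top[of 2]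
  proof eventually_elim
    case (elim n)
    have "real (m n) \<le> c * real n" using m[OF elim(2)] elim by (simp add: divide_le_eq)
    then have "branching \<beta> n (m n) {1..n} \<le>
        c * real n * sum_weight2 \<beta> {1..n} / ((sum_weight \<beta> n)\<^sup>2 - sum_weight2 \<beta> {1..n})"
      unfolding branching_def using normalizer_pos[OF elim(2), of \<beta>]
      by (intro divide_right_mono mult_right_mono) (auto simp: sum_weight2_def intro!: sum_nonneg)
    with elim show ?case by simp
  qed
  have "(\<lambda>n. (2 / sum_weight2 \<beta> {1..n}) * (\<Sum>k. (real k)\<^sup>2 * L ^ k)) \<longlonglongrightarrow> 0 * (\<Sum>k. (real k)\<^sup>2 * L ^ k)"
    by (intro tendsto_mult tendsto_const tendsto_divide_0[OF tendsto_const]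
        filterlim_at_top_imp_at_infinity sum_weight2_at_top beta)
  then have up: "(\<lambda>n. (2 / sum_weight2 \<beta> {1..n}) * (\<Sum>k. (real k)\<^sup>2 * L ^ k)) \<longlonglongrightarrow> 0" by simp
  have "(\<lambda>n. measure_pmf.prob (random_2sat n (m n) \<beta>) {F. \<not> satisfiable F}) \<longlonglongrightarrow> 0"
  proof (rule tendsto_sandwich[OF _ _ tendsto_const up])
    show "\<forall>\<^sub>F n in sequentially. measure_pmf.prob (random_2sat n (m n) \<beta>) {F. \<not> satisfiable F} \<le>
        (2 / sum_weight2 \<beta> {1..n}) * (\<Sum>k. (real k)\<^sup>2 * L ^ k)"
      using ev eventually_ge_at_top[of 2]
      by eventually_elim (rule unsat_prob_le_branching[OF beta(1) _ _ L(2,3)])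
  qed auto
  then have "(\<lambda>n. 1 - measure_pmf.prob (random_2sat n (m n) \<beta>) {F. \<not> satisfiable F}) \<longlonglongrightarrow> 1 - 0"
    by (intro tendsto_diff tendsto_const)
  moreover have "1 - measure_pmf.prob M {F. \<not> satisfiable F} = measure_pmf.prob M {F. satisfiable F}" for M
    using measure_pmf.prob_compl[of "{F. \<not> satisfiable F}" M] by (simp add: Collect_neg_eq[symmetric] Compl_eq_Diff_UNIV[symmetric])
  ultimately show ?thesis by simp
qed

section \<open>Above the threshold\<close>

lemma unsat_bound_tendsto:
  fixes t :: "nat \<Rightarrow> real" and c l1 C g0 :: real
  assumes t: "\<And>n. 1 \<le> t n" "(\<lambda>n. t n ^ 3 / real n) \<longlonglongrightarrow> 0" and pos: "0 < c" "0 < g0"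
  shows "(\<lambda>n. ((1 - 4 * (t n)\<^sup>2 / (c * n)) * (1 - 2 * t n * l1 * C / n) * (1 - 8 * (t n)\<^sup>2 * C / n))\<^sup>2 /
     (exp (32 * (t n)\<^sup>2 * C / (n * g0)) +
      8 * t n / n * (exp (16 * (t n)\<^sup>2 * C / (n * g0)) * C * (1 + 4 / g0) * (1 + 8 * l1 * t n / g0) + 6)\<^sup>2)) \<longlonglongrightarrow> 1"
    and "(\<lambda>n. (t n)\<^sup>2 / real n) \<longlonglongrightarrow> 0" and "(\<lambda>n. t n / real n) \<longlonglongrightarrow> 0"
proof -
  define x where "x n = (t n)\<^sup>2 / real n" for n
  define y where "y n = t n / real n" for n
  \<comment> \<open>The factor t/n is moved into the square as r. Inside, the bracket grows like t,
    and r t is the square root of t^3/n, so it vanishes in the limit.\<close>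
  define r where "r n = sqrt (y n)" for n
  have le: "t n \<le> t n ^ 3" "(t n)\<^sup>2 \<le> t n ^ 3" for n
    using power_increasing[of 1 3 "t n"] power_increasing[of 2 3 "t n"] t(1)[of n] by auto
  have t0: "0 \<le> t n" for n using t(1)[of n] by simp
  have x: "x \<longlonglongrightarrow> 0" unfolding x_def[abs_def]
    by (rule tendsto_sandwich[OF _ _ tendsto_const t(2)])
      (auto intro!: always_eventually divide_right_mono le)
  then show "(\<lambda>n. (t n)\<^sup>2 / real n) \<longlonglongrightarrow> 0" by (simp add: x_def[abs_def])
  have y: "y \<longlonglongrightarrow> 0" unfolding y_def[abs_def]
    by (rule tendsto_sandwich[OF _ _ tendsto_const t(2)])
      (auto intro!: always_eventually divide_right_mono le divide_nonneg_nonneg t0)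
  then show "(\<lambda>n. t n / real n) \<longlonglongrightarrow> 0" by (simp add: y_def[abs_def])
  have r: "r \<longlonglongrightarrow> 0" unfolding r_def[abs_def] using tendsto_real_sqrt[OF y] by simp
  have rt: "(\<lambda>n. r n * t n) \<longlonglongrightarrow> 0"
  proof -
    have "r n * t n = sqrt (t n ^ 3 / real n)" for n
    proof -
      have "r n * t n = sqrt (y n) * sqrt ((t n)\<^sup>2)" using t0[of n] by (simp add: r_def)
      also have "\<dots> = sqrt (t n ^ 3 / real n)"
        unfolding real_sqrt_mult[symmetric] by (simp add: y_def power2_eq_square power3_eq_cube)
      finally show ?thesis .
    qed
    with tendsto_real_sqrt[OF t(2)] show ?thesis by simp
  qed
  let ?lim = "((1 - 4 / c * 0) * (1 - 2 * l1 * C * 0) * (1 - 8 * C * 0))\<^sup>2 /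
     (exp (32 * C / g0 * 0) + 8 * (exp (16 * C / g0 * 0) * C * (1 + 4 / g0) * (0 + 8 * l1 / g0 * 0) + 6 * 0)\<^sup>2) :: real"
  have "(\<lambda>n. ((1 - 4 / c * x n) * (1 - 2 * l1 * C * y n) * (1 - 8 * C * x n))\<^sup>2 /
     (exp (32 * C / g0 * x n) + 8 * (exp (16 * C / g0 * x n) * C * (1 + 4 / g0) * (r n + 8 * l1 / g0 * (r n * t n)) + 6 * r n)\<^sup>2))
     \<longlonglongrightarrow> ?lim"
    by (intro tendsto_intros x y r rt) auto
  also have "?lim = 1" by simp
  also have "(\<lambda>n. ((1 - 4 / c * x n) * (1 - 2 * l1 * C * y n) * (1 - 8 * C * x n))\<^sup>2 /
     (exp (32 * C / g0 * x n) + 8 * (exp (16 * C / g0 * x n) * C * (1 + 4 / g0) * (r n + 8 * l1 / g0 * (r n * t n)) + 6 * r n)\<^sup>2)) =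
     (\<lambda>n. ((1 - 4 * (t n)\<^sup>2 / (c * n)) * (1 - 2 * t n * l1 * C / n) * (1 - 8 * (t n)\<^sup>2 * C / n))\<^sup>2 /
     (exp (32 * (t n)\<^sup>2 * C / (n * g0)) +
      8 * t n / n * (exp (16 * (t n)\<^sup>2 * C / (n * g0)) * C * (1 + 4 / g0) * (1 + 8 * l1 * t n / g0) + 6)\<^sup>2))"
  proof (intro ext arg_cong2[where f="(/)"] arg_cong2[where f="(+)"] arg_cong[where f="\<lambda>x. x\<^sup>2"])
    fix n
    have r2: "(r n)\<^sup>2 = t n / n" using t0[of n] by (simp add: r_def y_def)
    have "exp (16 * C / g0 * x n) * C * (1 + 4 / g0) * (r n + 8 * l1 / g0 * (r n * t n)) + 6 * r n =
       r n * (exp (16 * (t n)\<^sup>2 * C / (n * g0)) * C * (1 + 4 / g0) * (1 + 8 * l1 * t n / g0) + 6)"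
      by (simp add: x_def algebra_simps)
    then show "8 * (exp (16 * C / g0 * x n) * C * (1 + 4 / g0) * (r n + 8 * l1 / g0 * (r n * t n)) + 6 * r n)\<^sup>2 =
       8 * t n / n * (exp (16 * (t n)\<^sup>2 * C / (n * g0)) * C * (1 + 4 / g0) * (1 + 8 * l1 * t n / g0) + 6)\<^sup>2"
      by (simp add: power_mult_distrib r2)
  qed (simp_all add: x_def y_def mult_ac)
  finally show "(\<lambda>n. ((1 - 4 * (t n)\<^sup>2 / (c * n)) * (1 - 2 * t n * l1 * C / n) * (1 - 8 * (t n)\<^sup>2 * C / n))\<^sup>2 /
     (exp (32 * (t n)\<^sup>2 * C / (n * g0)) +
      8 * t n / n * (exp (16 * (t n)\<^sup>2 * C / (n * g0)) * C * (1 + 4 / g0) * (1 + 8 * l1 * t n / g0) + 6)\<^sup>2)) \<longlonglongrightarrow> 1" .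
qed

lemma sum_weight2_tail:
  assumes "0 \<le> \<beta>" "\<beta> < 1 / 2" "k \<le> n" "real k \<le> x"
  shows "sum_weight2 \<beta> {1..n} - x powr (1 - 2 * \<beta>) / (1 - 2 * \<beta>) \<le> sum_weight2 \<beta> {k<..n}"
proof -
  have "{1..n} = {1..k} \<union> {k<..n}" using assms(3) by auto
  then have "sum_weight2 \<beta> {1..n} = sum_weight2 \<beta> {1..k} + sum_weight2 \<beta> {k<..n}"
    unfolding sum_weight2_def by (simp only:) (rule sum.union_disjoint; auto)
  moreover have "sum_weight2 \<beta> {1..k} \<le> real k powr (1 - 2 * \<beta>) / (1 - 2 * \<beta>)"
    unfolding sum_weight2_eq using assms by (intro power_sum_bounds(2)) auto
  moreover have "real k powr (1 - 2 * \<beta>) / (1 - 2 * \<beta>) \<le> x powr (1 - 2 * \<beta>) / (1 - 2 * \<beta>)"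
    using assms by (intro divide_right_mono powr_mono2) auto
  ultimately show ?thesis by linarith
qed

text \<open>The remaining indices lie between e n and n, so squared weights exceed their minimum by
  at most the factor e powr (-2\<beta>), and at least (1 - e) n variables share the total
  mass.\<close>

lemma lit_weight_square_le:
  assumes beta: "0 \<le> \<beta>" and e: "0 < e" "e < 1" and k: "k = nat \<lfloor>e * real n\<rfloor>" and n: "n \<ge> 1"
    and a: "fst a \<in> {k<..n}"
  shows "(lit_weight \<beta> {k<..n} a)\<^sup>2 \<le> e powr (- (2 * \<beta>)) / (2 * (1 - e)) / real n"
proof -
  let ?y = "real n powr (- (2 * \<beta>))"
  have y: "0 < ?y" using n by simp
  have kn: "real k \<le> e * n" "e * n < real k + 1" using e by (auto simp: k)
  have "e * n \<le> real (fst a)" using a kn by auto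
  then have "real (fst a) powr (- (2 * \<beta>)) \<le> (e * n) powr (- (2 * \<beta>))"
    using beta e n by (intro powr_mono2') auto
  also have "\<dots> = e powr (- (2 * \<beta>)) * ?y" using e by (simp add: powr_mult)
  finally have num: "real (fst a) powr (- (2 * \<beta>)) \<le> e powr (- (2 * \<beta>)) * ?y" .
  have "real (card {k<..n}) * ?y \<le> sum_weight2 \<beta> {k<..n}"
    unfolding sum_weight2_eq using beta by (intro sum_bounded_below powr_mono2') auto
  moreover have "(1 - e) * n \<le> real (card {k<..n})"
  proof -
    have "e * n \<le> n" using e by (simp add: mult_left_le_one_le)
    then have "k \<le> n" using kn by linarith
    then show ?thesis using kn by (simp add: of_nat_diff algebra_simps)
  qed
  ultimately have den: "(1 - e) * n * ?y \<le> sum_weight2 \<beta> {k<..n}"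
    using y mult_right_mono[of "(1 - e) * n" "real (card {k<..n})" ?y] by linarith
  have "(lit_weight \<beta> {k<..n} a)\<^sup>2 \<le> (e powr (- (2 * \<beta>)) * ?y) / (2 * ((1 - e) * n * ?y))"
    unfolding lit_weight_square var_weight_square using num den e n y
    by (intro frac_le) auto
  also have "\<dots> = e powr (- (2 * \<beta>)) / (2 * (1 - e)) / real n"
    using y by simp
  finally show ?thesis .
qed

lemma unsatisfiable_above_threshold:
  fixes m :: "nat \<Rightarrow> nat"
  assumes beta: "0 \<le> \<beta>" "\<beta> < 1 / 2" and c: "c > (1 - 2 * \<beta>) / (1 - \<beta>)\<^sup>2"
    and m: "\<And>n. n \<ge> 2 \<Longrightarrow> real (m n) / real n \<ge> c"
  shows "(\<lambda>n. measure_pmf.prob (random_2sat n (m n) \<beta>) {F. \<not> satisfiable F}) \<longlonglongrightarrow> 1"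
proof -
  define b where "b = 1 - 2 * \<beta>"
  define tau where "tau = (1 - \<beta>)\<^sup>2 / b"
  have b: "0 < b" "b \<le> 1" using beta by (auto simp: b_def)
  have tau: "0 < tau" using beta b by (simp add: tau_def)
  have ctau: "1 < c * tau" using c beta by (simp add: tau_def b_def field_simps)
  have c0: "0 < c" using ctau tau by (smt (verit) mult_nonpos_nonneg)
  \<comment> \<open>Truncation multiplies the limit c tau by 1 - e powr b; this e makes the product
    (c tau + 1) / 2, which is still greater than 1.\<close>
  define e where "e = ((1 - 1 / (c * tau)) / 2) powr (1 / b)"
  have eb: "e powr b = (1 - 1 / (c * tau)) / 2" and e: "0 < e" "e < 1"
  proof -
    have *: "0 < (1 - 1 / (c * tau)) / 2" "(1 - 1 / (c * tau)) / 2 < 1"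
    proof -
      define x where "x = 1 / (c * tau)"
      have "0 < x" "x < 1" using ctau by (auto simp: x_def)
      then show "0 < (1 - 1 / (c * tau)) / 2" "(1 - 1 / (c * tau)) / 2 < 1"
        unfolding x_def[symmetric] by simp_all
    qed
    then show "e powr b = (1 - 1 / (c * tau)) / 2" using b by (simp add: e_def powr_powr)
    show "0 < e" unfolding e_def powr_gt_zero using *(1) by (metis less_irrefl)
    show "e < 1" unfolding e_def using * b powr_less_mono2[of "1 / b" "(1 - 1 / (c * tau)) / 2" 1] by simp
  qed
  \<comment> \<open>Bounds for lam that hold eventually: l0 lies midway between 1 and the truncated
    limit, l1 above the untruncated limit c tau.\<close>
  define l0 where "l0 = (1 + (c * tau + 1) / 2) / 2"
  define l1 where "l1 = c * tau + 1"
  define g0 where "g0 = (l0 - 1) / 2"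
  have l0: "1 < l0" "l0 < (c * tau + 1) / 2" using ctau by (auto simp: l0_def)
  have l1: "0 < l1" using ctau by (simp add: l1_def)
  have g0: "0 < g0" using l0 by (simp add: g0_def)
  define C where "C = e powr (- (2 * \<beta>)) / (2 * (1 - e))"
  have C: "0 < C" using e by (simp add: C_def)
  define m0 where "m0 n = nat \<lceil>c * real n\<rceil>" for n
  define A where "A n = {nat \<lfloor>e * real n\<rfloor><..n}" for n
  define lam where "lam n = branching \<beta> n (m0 n) (A n)" for n
  define Z where "Z n = (sum_weight \<beta> n)\<^sup>2 - sum_weight2 \<beta> {1..n}" for n
  have m0: "c * real n \<le> m0 n" "m0 n \<le> c * real n + 1" for n
  proof -
    have "0 \<le> c * real n" using c0 by simp
    then show "c * real n \<le> m0 n" "m0 n \<le> c * real n + 1" unfolding m0_def by linarith+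
  qed
  have kn: "nat \<lfloor>e * real n\<rfloor> \<le> n" "real (nat \<lfloor>e * real n\<rfloor>) \<le> e * n" for n
  proof -
    have "0 \<le> e * real n" "e * real n \<le> real n" using e by (auto simp: mult_left_le_one_le)
    then show "nat \<lfloor>e * real n\<rfloor> \<le> n" "real (nat \<lfloor>e * real n\<rfloor>) \<le> e * n" by linarith+
  qed
  have Asub: "A n \<subseteq> {1..n}" for n by (auto simp: A_def)
  have Apos: "0 < sum_weight2 \<beta> (A n)" if "n \<ge> 1" for n
  proof (rule sum_weight2_pos)
    have "e * real n < real n" using e that by simp
    then have "nat \<lfloor>e * real n\<rfloor> < n" using kn(2)[of n] by linarith
    then show "A n \<noteq> {}" by (auto simp: A_def)
  qed (auto simp: A_def)
  have lam_low: "\<forall>\<^sub>F n in sequentially. l0 \<le> lam n"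
  proof -
    define f where "f n = sum_weight2 \<beta> {1..n} - (e * real n) powr b / b" for n
    have "(\<lambda>n. sum_weight2 \<beta> {1..n} / real n powr b - e powr b / b) \<longlonglongrightarrow> 1 / b - e powr b / b"
      unfolding sum_weight2_eq b_def using beta by (intro tendsto_diff power_sum_asymp tendsto_const) auto
    moreover have "\<forall>\<^sub>F n in sequentially. sum_weight2 \<beta> {1..n} / real n powr b - e powr b / b = f n / real n powr b"
      using eventually_gt_at_top[of 0]
    proof eventually_elim
      case (elim n)
      then show ?case using e by (simp add: f_def powr_mult diff_divide_distrib)
    qed
    ultimately have "(\<lambda>n. f n / real n powr (1 - 2 * \<beta>)) \<longlonglongrightarrow> 1 / b - e powr b / b"
      unfolding b_def[symmetric] by (rule Lim_transform_eventually)
    from normalizer_ratio_limit[OF beta this]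
    have "(\<lambda>n. c * (real n * f n / Z n)) \<longlonglongrightarrow> c * ((1 / b - e powr b / b) * (1 - \<beta>)\<^sup>2)"
      unfolding Z_def by (intro tendsto_mult tendsto_const)
    also have "c * ((1 / b - e powr b / b) * (1 - \<beta>)\<^sup>2) = c * tau * (1 - e powr b)"
      by (simp add: tau_def algebra_simps diff_divide_distrib)
    also have "\<dots> = (c * tau + 1) / 2" unfolding eb using c0 tau by (simp add: field_simps)
    finally have "\<forall>\<^sub>F n in sequentially. l0 < c * (real n * f n / Z n)"
      using l0 by (intro order_tendstoD(1)) auto
    then show ?thesis using eventually_ge_at_top[of 2]
    proof eventually_elim
      case (elim n)
      have Z: "0 < Z n" unfolding Z_def using elim by (intro normalizer_pos) auto
      have "f n \<le> sum_weight2 \<beta> (A n)"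
        unfolding f_def A_def b_def using beta kn by (intro sum_weight2_tail) auto
      then have "c * real n * f n \<le> c * real n * sum_weight2 \<beta> (A n)"
        using c0 by (intro mult_left_mono) auto
      also have "\<dots> \<le> m0 n * sum_weight2 \<beta> (A n)"
        using m0 Apos[of n] elim by (intro mult_right_mono) auto
      finally have "c * real n * f n / Z n \<le> lam n"
        unfolding lam_def branching_def Z_def[symmetric] using Z by (intro divide_right_mono) auto
      with elim show ?case by simp
    qed
  qed
  have lam_up: "\<forall>\<^sub>F n in sequentially. lam n \<le> l1"
  proof -
    have "(\<lambda>n. (c + 1 / real n) * (real n * sum_weight2 \<beta> {1..n} / Z n)) \<longlonglongrightarrow> (c + 0) * tau"
      unfolding Z_def tau_def b_def by (intro tendsto_mult tendsto_add tendsto_const lim_1_over_n critical_ratio_limit beta)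
    then have "\<forall>\<^sub>F n in sequentially. (c + 1 / real n) * (real n * sum_weight2 \<beta> {1..n} / Z n) < l1"
      by (rule order_tendstoD(2)) (simp add: l1_def)
    then show ?thesis using eventually_ge_at_top[of 2]
    proof eventually_elim
      case (elim n)
      have Z: "0 < Z n" unfolding Z_def using elim by (intro normalizer_pos) auto
      have "sum_weight2 \<beta> (A n) \<le> sum_weight2 \<beta> {1..n}"
        unfolding sum_weight2_def by (intro sum_mono2 Asub) auto
      then have "m0 n * sum_weight2 \<beta> (A n) \<le> (c * real n + 1) * sum_weight2 \<beta> {1..n}"
        using m0 Apos[of n] c0 elim by (intro mult_mono) auto
      then have "lam n \<le> (c * real n + 1) * sum_weight2 \<beta> {1..n} / Z n"
        unfolding lam_def branching_def Z_def[symmetric] using Z by (intro divide_right_mono) auto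
      also have "c * real n + 1 = (c + 1 / real n) * real n" using elim by (simp add: field_simps)
      finally show ?case using elim by simp
    qed
  qed
  \<comment> \<open>Chosen so that \<open>l0 ^ Suc (k n)\<close> is at least n; the added 1 ensures
    k \<ge> 1, so both halves of a snake are nonempty.\<close>
  define k where "k n = nat \<lceil>ln (real n) / ln l0\<rceil> + 1" for n
  define t where "t n = real (Suc (k n))" for n
  have t1: "1 \<le> t n" for n by (simp add: t_def)
  have t_low: "ln (real n) / ln l0 \<le> t n" for n unfolding t_def k_def by linarith
  have lnl0: "0 < ln l0" using l0 by simp
  have t_up: "t n \<le> 1 / ln l0 * ln (real n) + 3" if "n \<ge> 1" for n
  proof -
    have "0 \<le> ln (real n) / ln l0" using that lnl0 by simp
    then show ?thesis unfolding t_def k_def by simp linarith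
  qed
  have t3: "(\<lambda>n. t n ^ 3 / real n) \<longlonglongrightarrow> 0"
  proof (rule tendsto_sandwich[OF _ _ tendsto_const])
    have "0 < 1 / ln l0" using lnl0 by simp
    then show "(\<lambda>n. (1 / ln l0 * ln (real n) + 3) ^ 3 / real n) \<longlonglongrightarrow> 0" by real_asymp
    show "\<forall>\<^sub>F n in sequentially. t n ^ 3 / real n \<le> (1 / ln l0 * ln (real n) + 3) ^ 3 / real n"
      using eventually_ge_at_top[of 1]
    proof eventually_elim
      case (elim n)
      then show ?case using t_up[of n] t1[of n] by (intro divide_right_mono power_mono) auto
    qed
    show "\<forall>\<^sub>F n in sequentially. 0 \<le> t n ^ 3 / real n" by (simp add: t_def)
  qed
  note bound_lim = unsat_bound_tendsto(1)[OF t1 t3 c0 g0, where ?l1.0 = l1 and C = C]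
  note lims = unsat_bound_tendsto(2,3)[OF t1 t3 c0 g0]
  have small: "\<forall>\<^sub>F n in sequentially. (t n)\<^sup>2 / real n < c / 4"
      "\<forall>\<^sub>F n in sequentially. (t n)\<^sup>2 / real n < 1 / (8 * C)"
      "\<forall>\<^sub>F n in sequentially. t n / real n < 1 / (2 * l1 * C)"
  proof -
    have "0 < c / 4" "0 < 1 / (8 * C)" "0 < 1 / (2 * l1 * C)" using c0 C ctau by (auto simp: l1_def)
    then show "\<forall>\<^sub>F n in sequentially. (t n)\<^sup>2 / real n < c / 4"
      "\<forall>\<^sub>F n in sequentially. (t n)\<^sup>2 / real n < 1 / (8 * C)"
      "\<forall>\<^sub>F n in sequentially. t n / real n < 1 / (2 * l1 * C)"
      by (blast intro: order_tendstoD(2)[OF lims(1)] order_tendstoD(2)[OF lims(2)])+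
  qed
  have t_large: "\<forall>\<^sub>F n in sequentially. 1 / g0 \<le> t n"
  proof -
    have "filterlim (\<lambda>n. ln (real n) / ln l0) at_top sequentially" using lnl0 by real_asymp
    then have "\<forall>\<^sub>F n in sequentially. 1 / g0 \<le> ln (real n) / ln l0" by (simp add: filterlim_at_top)
    then show ?thesis by eventually_elim (use t_low order_trans in blast)
  qed
  show ?thesis
  proof (rule tendsto_sandwich[OF _ _ bound_lim tendsto_const])
    show "\<forall>\<^sub>F n in sequentially. ((1 - 4 * (t n)\<^sup>2 / (c * n)) * (1 - 2 * t n * l1 * C / n) * (1 - 8 * (t n)\<^sup>2 * C / n))\<^sup>2 /
       (exp (32 * (t n)\<^sup>2 * C / (n * g0)) +
        8 * t n / n * (exp (16 * (t n)\<^sup>2 * C / (n * g0)) * C * (1 + 4 / g0) * (1 + 8 * l1 * t n / g0) + 6)\<^sup>2)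
       \<le> measure_pmf.prob (random_2sat n (m n) \<beta>) {F. \<not> satisfiable F}"
      using lam_low lam_up small t_large eventually_ge_at_top[of 2]
    proof eventually_elim
      case (elim n)
      have n: "n \<ge> 2" "0 < real n" using elim by auto
      have pos: "0 < sum_weight2 \<beta> (A n)" using n by (intro Apos) auto
      define V where "V = A n \<times> (UNIV :: bool set)"
      have VV: "V \<subseteq> {1..n} \<times> UNIV" using Asub by (auto simp: V_def)
      have "((1 - 4 * (t n)\<^sup>2 / (c * n)) * (1 - 2 * t n * l1 * C / n) * (1 - 8 * (t n)\<^sup>2 * C / n))\<^sup>2 /
       (exp (32 * (t n)\<^sup>2 * C / (n * g0)) +
        8 * t n / n * (exp (16 * (t n)\<^sup>2 * C / (n * g0)) * C * (1 + 4 / g0) * (1 + 8 * l1 * t n / g0) + 6)\<^sup>2)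
        \<le> measure_pmf.prob (replicate_pmf (m0 n) (random_clause n \<beta>)) {cs. \<not> satisfiable (mset cs)}"
      proof (rule unsat_prob_ge_explicit[where V = V and u = "lit_weight \<beta> (A n)" and lam = "lam n"
            and ?l0.0 = l0 and k = "k n"])
        show "finite V" by (simp add: V_def A_def)
        show "neg a \<in> V" if "a \<in> V" for a using that by (simp add: V_def mem_Times_iff)
        show "real (card V) \<le> 2 * real n"
          using card_mono[OF _ Asub, of n] by (simp add: V_def card_cartesian_product)
        show "(lit_weight \<beta> (A n) a)\<^sup>2 \<le> C / real n" if "a \<in> V" for a
          unfolding C_def A_def using that n beta e by (intro lit_weight_square_le) (auto simp: V_def A_def mem_Times_iff)
        show "(\<Sum>z\<in>V. (lit_weight \<beta> (A n) z)\<^sup>2) = 1"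
          unfolding V_def by (rule sum_lit_weight_square[OF pos])
        show "real (m0 n) * pmf (random_clause n \<beta>) (imp_clause a b) = lam n * lit_weight \<beta> (A n) a * lit_weight \<beta> (A n) b"
          if "a \<in> V" "b \<in> V" "fst a \<noteq> fst b" for a b
          unfolding lam_def using that VV by (intro rate_eq pos n) auto
        show "real (m0 n) * pmf (random_clause n \<beta>) (imp_clause a b) \<le> lam n * lit_weight \<beta> (A n) a * lit_weight \<beta> (A n) b" for a b
          unfolding lam_def by (intro rate_le pos n)
        show "real n \<le> l0 ^ Suc (k n)"
        proof -
          have "real n = exp (ln (real n) / ln l0 * ln l0)" using n lnl0 by simp
          also have "\<dots> \<le> exp (t n * ln l0)" using t_low[of n] lnl0 by (simp add: divide_le_eq)
          also have "\<dots> = l0 ^ Suc (k n)" using l0 unfolding t_def by (simp only: exp_of_nat_mult) simp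
          finally show ?thesis .
        qed
        show "c * real n \<le> real (m0 n)" by (rule m0)
        show "1 \<le> t n * g0" using elim g0 by (simp add: field_simps)
        show "4 * (t n)\<^sup>2 \<le> c * real n" "2 * t n * l1 * C \<le> real n" "8 * (t n)\<^sup>2 * C \<le> real n"
          using elim n C l1 by (auto simp: field_simps)
      qed (use elim l0 c0 C n in \<open>auto simp: lit_weight_nonneg lit_weight_neg g0_def t_def k_def\<close>)
      also have "\<dots> = measure_pmf.prob (random_2sat n (m0 n) \<beta>) {F. \<not> satisfiable F}"
        by (simp only: prob_random_2sat)
      also have "\<dots> \<le> measure_pmf.prob (random_2sat n (m n) \<beta>) {F. \<not> satisfiable F}"
      proof (rule unsat_prob_mono)
        have "c * real n \<le> real (m n)" using m[OF n(1)] n by (simp add: le_divide_eq)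
        then show "m0 n \<le> m n" unfolding m0_def by linarith
      qed
      finally show ?case .
    qed
  qed auto
qed

theorem corollary1:
  fixes \<beta> :: real
  assumes "0 \<le> \<beta>" and "\<beta> < 1 / 2"
  shows "(\<forall>(c::real) (m::nat \<Rightarrow> nat).
            c < (1 - 2 * \<beta>) / (1 - \<beta>)\<^sup>2 \<longrightarrow> (\<forall>n\<ge>2. real (m n) / real n \<le> c) \<longrightarrow>
            (\<lambda>n. measure_pmf.prob (random_2sat n (m n) \<beta>) {F. satisfiable F}) \<longlonglongrightarrow> 1)
       \<and> (\<forall>(c::real) (m::nat \<Rightarrow> nat).
            c > (1 - 2 * \<beta>) / (1 - \<beta>)\<^sup>2 \<longrightarrow> (\<forall>n\<ge>2. real (m n) / real n \<ge> c) \<longrightarrow>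
            (\<lambda>n. measure_pmf.prob (random_2sat n (m n) \<beta>) {F. \<not> satisfiable F}) \<longlonglongrightarrow> 1)"
  using satisfiable_below_threshold[OF assms] unsatisfiable_above_threshold[OF assms] by blast

end
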